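(* Let $a>b>1$ be fixed and consider the majority dynamics process described in the context, with a fixed initial configuration $y_0$ for each $N$. Suppose $$\Delta_0>0,\qquad \frac{\Delta_0}{\sqrt{N/\log N}}\to\infty\quad\text{as }N\to\infty.$$ Then for every $\varepsilon>0$ there exist constants $c=c(a,b,\varepsilon)>0$ and $\xi=\xi(a,b)>0$ such that, for all sufficiently large $N$, $$\mathbb P\left(R_{\lceil N^{I_0+\varepsilon}\rceil}=\emptyset\right)\ge 1-\exp\left(-c\frac{\Delta_0^2\log N}{N}\right)-4N^{-\xi}.$$
   Context: Process. Fix constants $a>b>1$ and put $\alpha=a\log N/N$, $\beta=b\log N/N$ ($N$ large enough that $\alpha\le 1$; natural logarithm). Let $V=[N]=\{1,\dots,N\}$. An opinion configuration is $y_t\in\{\pm1\}^V$, with $B_t=\{v:y_t(v)=+1\}$ (blue) and $R_t=\{v:y_t(v)=-1\}$ (red). For each $N$ the initial configuration $y_0$ is fixed; let $\mathcal F_t=\sigma(y_0,G_1,\dots,G_t)$. Conditionally on $\mathcal F_t$, $G_{t+1}$ is a random graph on $V$ in which each pair $\{u,v\}$, $u\ne v$, is an edge independently with probability $\alpha$ if $y_t(u)=y_t(v)$ and $\beta$ otherwise. All vertices update synchronously: $y_{t+1}(v)=+1$ if $v$ has strictly more $G_{t+1}$-neighbors in $B_t$ than in $R_t$, $y_{t+1}(v)=-1$ if strictly fewer, and $y_{t+1}(v)=y_t(v)$ in case of a tie. The unweighted advantage is $\Delta_t=|B_t|-|R_t|$. Exponent. $I(x,y)=\big(\max\{\sqrt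 x-\sqrt y,0\}\big)^2$ and $I_0=I\big(a|R_0|/N,\;b|B_0|/N\big)$ (which may depend on $N$). *)

theory Defs
  imports "HOL-Probability.Probability"
begin

text \<open>
  A configuration on the vertex set \<open>{1..N}\<close> is a function with values in \<open>{-1, 1}\<close> on
  \<open>{1..N}\<close>; its values elsewhere are irrelevant. A graph is its set of edges, and an edge is a
  two-element set of vertices.
\<close>

type_synonym configuration = "nat \<Rightarrow> int"
type_synonym graph = "nat set set"

definition vertices :: "nat \<Rightarrow> nat set" where
  "vertices N = {1..N}"

definition vertex_pairs :: "nat \<Rightarrow> nat set set" where
  "vertex_pairs N = {{u, v} | u v. u \<in> vertices N \<and> v \<in> vertices N \<and> u \<noteq> v}"

definition is_configuration :: "nat \<Rightarrow> configuration \<Rightarrow> bool" where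
  "is_configuration N y \<longleftrightarrow> (\<forall>v\<in>vertices N. y v = 1 \<or> y v = -1)"

definition blue :: "nat \<Rightarrow> configuration \<Rightarrow> nat set" where
  "blue N y = {v \<in> vertices N. y v = 1}"

definition red :: "nat \<Rightarrow> configuration \<Rightarrow> nat set" where
  "red N y = {v \<in> vertices N. y v = -1}"

definition advantage :: "nat \<Rightarrow> configuration \<Rightarrow> real" where
  "advantage N y = real (card (blue N y)) - real (card (red N y))"

definition neighbors :: "nat \<Rightarrow> graph \<Rightarrow> nat \<Rightarrow> nat set" where
  "neighbors N G v = {u \<in> vertices N. {u, v} \<in> G}"

definition majority_update :: "nat \<Rightarrow> graph \<Rightarrow> configuration \<Rightarrow> configuration" where
  "majority_update N G y = (\<lambda>v.
     let nb = card (neighbors N G v \<inter> blue N y);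
         nr = card (neighbors N G v \<inter> red N y)
     in if nb > nr then 1 else if nb < nr then -1 else y v)"

definition edge_prob :: "real \<Rightarrow> nat \<Rightarrow> real" where
  "edge_prob a N = a * ln (real N) / real N"

text \<open>
  \<open>bernoulli_pmf\<close> truncates its parameter to \<open>[0, 1]\<close>, so the following is the intended random graph
  whenever \<open>edge_prob a N \<le> 1\<close> and \<open>edge_prob b N \<le> 1\<close>, which holds for all large \<open>N\<close>.
\<close>

definition random_graph_pmf :: "real \<Rightarrow> real \<Rightarrow> nat \<Rightarrow> configuration \<Rightarrow> graph pmf" where
  "random_graph_pmf a b N y =
     map_pmf (\<lambda>present. {e \<in> vertex_pairs N. present e})
       (Pi_pmf (vertex_pairs N) False
          (\<lambda>e. bernoulli_pmf
                 (if \<forall>u\<in>e. \<forall>v\<in>e. y u = y v then edge_prob a N else edge_prob b N)))"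

text \<open>
  The configuration \<open>y\<^sub>t\<close> is a function of \<open>y\<^sub>0\<close> and the history \<open>[G\<^sub>1, \<dots>, G\<^sub>t]\<close>.
\<close>

definition opinions :: "nat \<Rightarrow> configuration \<Rightarrow> graph list \<Rightarrow> configuration" where
  "opinions N y0 Gs = fold (majority_update N) Gs y0"

text \<open>
  Joint law of \<open>[G\<^sub>1, \<dots>, G\<^sub>t]\<close>. The history generates the information available at
  time \<open>t\<close>, so the monadic bind prescribes the conditional law of the next graph given it.
\<close>

primrec history_pmf ::
    "real \<Rightarrow> real \<Rightarrow> nat \<Rightarrow> configuration \<Rightarrow> nat \<Rightarrow> graph list pmf" where
  "history_pmf a b N y0 0 = return_pmf []"
| "history_pmf a b N y0 (Suc t) =
     bind_pmf (history_pmf a b N y0 t) (\<lambda>Gs.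
       map_pmf (\<lambda>G. Gs @ [G]) (random_graph_pmf a b N (opinions N y0 Gs)))"

definition rate_I :: "real \<Rightarrow> real \<Rightarrow> real" where
  "rate_I x y = (max (sqrt x - sqrt y) 0)\<^sup>2"

definition exponent0 :: "real \<Rightarrow> real \<Rightarrow> nat \<Rightarrow> configuration \<Rightarrow> real" where
  "exponent0 a b N y0 =
     rate_I (a * real (card (red N y0)) / real N) (b * real (card (blue N y0)) / real N)"

end

theory Submission
  imports Defs "HOL-Real_Asymp.Real_Asymp"
begin

text \<open>
  The idea is to follow the advantage \<open>\<Delta>\<close> of blue over red through potentials that decrease on
  average in every round. Write \<open>R\<close> and \<open>B\<close> for the numbers of red and blue vertices and \<open>p\<close> for the
  probability that a red vertex turns blue.

  \<^emph>\<open>Drift.\<close> A vertex flips if one binomial count exceeds another one. A term-by-term comparison of the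
  two double sums (\<open>outvote_ratio\<close>) shows that the expected number \<open>R p\<close> of flips from red to blue is
  at least \<open>exp ((a - b) \<Delta> ln N / N)\<close> times the expected number of flips from blue to red. The drift of
  \<open>\<Delta>\<close> is therefore of order \<open>p \<Delta> ln N\<close> while \<open>\<Delta>\<close> is small and the two classes are comparable, and
  \<open>p\<close> is \<open>N\<close> to the power \<open>- I\<^sub>0 - o(1)\<close> or larger (\<open>red_flip_prob_lower\<close>). Hence \<open>\<Delta>\<close> grows
  by a constant factor in at most \<open>N\<close> to the power \<open>I\<^sub>0 + o(1)\<close> rounds.

  \<^emph>\<open>Fluctuations.\<close> The flips of two vertices are coupled only through the edge between them. For equal
  colours the covariance is at most \<open>2 \<alpha>\<close> times the product of the flip probabilities (\<open>\<alpha>\<close> is the edge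
  probability within a colour), for different colours it has the favourable sign, so
  the variance of a round is of order \<open>N p\<close> (\<open>variance_gain\<close>). During the time in which \<open>\<Delta>\<close>
  doubles, the accumulated variance is of order \<open>N / ln N\<close>. This is why an initial
  advantage of larger order than \<open>sqrt (N / ln N)\<close> suffices, and why it is lost with a probability of the order
  \<open>exp (- c \<Delta>\<^sub>0\<^sup>2 ln N / N)\<close> only.

  \<^emph>\<open>Phases.\<close> While \<open>\<Delta>\<close> is below a power of \<open>N\<close> slightly above \<open>sqrt N\<close>, the potential
  \<open>exp (K (\<Delta>\<^sub>0 / (2 \<Delta>) - 1))\<close> with \<open>K\<close> of order \<open>\<Delta>\<^sub>0\<^sup>2 ln N / N\<close> is a supermartingale
  (\<open>exponential_potential\<close>); it bounds the probability of dropping to \<open>\<Delta>\<^sub>0 / 2\<close>. This needs a tail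
  bound for a single round that is better than Chebyshev's inequality by a power of \<open>N\<close>
  (\<open>block_tail\<close>); it is available because flips are rare near balance (\<open>red_flip_prob_upper\<close>). From
  then on second moments suffice, with the potential \<open>1 / \<Delta>\<close> (\<open>reciprocal_potential\<close>), which in both
  phases also bounds the time. Once the red fraction is below a constant, one more round
  removes all red vertices because \<open>a\<close> and \<open>b\<close> exceed \<open>1\<close> (\<open>survival_few_red\<close>). The general lemma
  \<open>survival_le_potentials\<close> turns potentials into bounds for the process.
\<close>


section \<open>Expectations under finitely supported laws\<close>

abbreviation expect :: "'a pmf \<Rightarrow> ('a \<Rightarrow> real) \<Rightarrow> real" where
  "expect \<equiv> measure_pmf.expectation"

lemma expect_add:
  "finite (set_pmf M) \<Longrightarrow> expect M (\<lambda>x. f x + g x) = expect M f + expect M g"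
  by (simp add: integrable_measure_pmf_finite)

lemma expect_diff:
  "finite (set_pmf M) \<Longrightarrow> expect M (\<lambda>x. f x - g x) = expect M f - expect M g"
  by (simp add: integrable_measure_pmf_finite)

lemma expect_sum:
  "finite (set_pmf M) \<Longrightarrow> expect M (\<lambda>x. \<Sum>i\<in>I. f i x) = (\<Sum>i\<in>I. expect M (f i))"
  by (simp add: integrable_measure_pmf_finite)

lemma expect_mono:
  assumes "finite (set_pmf M)" "\<And>x. x \<in> set_pmf M \<Longrightarrow> f x \<le> g x"
  shows "expect M f \<le> expect M g"
  by (rule integral_mono_AE) (auto simp: integrable_measure_pmf_finite assms AE_measure_pmf_iff)

lemma expect_cong:
  "(\<And>x. x \<in> set_pmf M \<Longrightarrow> f x = g x) \<Longrightarrow> expect M f = expect M g"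
  by (rule integral_cong_AE) (auto simp: AE_measure_pmf_iff)

lemma expect_const: "expect M (\<lambda>_. c) = c"
  by simp

lemma expect_bind:
  assumes "finite (set_pmf p)" "\<And>x. x \<in> set_pmf p \<Longrightarrow> finite (set_pmf (f x))"
  shows "expect (bind_pmf p f) h = expect p (\<lambda>x. expect (f x) h)"
proof -
  have "expect (bind_pmf p f) h = (\<Sum>a\<in>set_pmf p. pmf p a *\<^sub>R expect (f a) h)"
    by (rule pmf_expectation_bind) (use assms in auto)
  also have "\<dots> = expect p (\<lambda>x. expect (f x) h)"
    by (rule integral_measure_pmf [symmetric]) (use assms in auto)
  finally show ?thesis .
qed

lemma prob_eq_expect: "measure_pmf.prob M {x. P x} = expect M (\<lambda>x. of_bool (P x))"
proof -
  have "expect M (\<lambda>x. of_bool (P x)) = expect M (indicator {x. P x})"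
    by (rule expect_cong) (simp add: indicator_def)
  then show ?thesis by simp
qed

lemma chebyshev_sum_sq:
  assumes fin: "finite (set_pmf M)" and t: "t > 0"
  shows "measure_pmf.prob M {x. \<bar>f x\<bar> \<ge> t} \<le> expect M (\<lambda>x. (f x)\<^sup>2) / t\<^sup>2"
proof -
  have "measure_pmf.prob M {x. \<bar>f x\<bar> \<ge> t} \<le> expect M (\<lambda>x. (f x)\<^sup>2 / t\<^sup>2)"
    unfolding prob_eq_expect
  proof (rule expect_mono [OF fin])
    fix x
    show "of_bool (\<bar>f x\<bar> \<ge> t) \<le> (f x)\<^sup>2 / t\<^sup>2"
    proof (cases "\<bar>f x\<bar> \<ge> t")
      case True
      then have "t\<^sup>2 \<le> \<bar>f x\<bar>\<^sup>2" using t by (intro power_mono) auto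
      then show ?thesis using t True by simp
    qed simp
  qed
  then show ?thesis by simp
qed

lemma prob_exp_markov:
  assumes fin: "finite (set_pmf M)" and s: "s \<ge> 0"
  shows "measure_pmf.prob M {x. f x \<ge> t} \<le> expect M (\<lambda>x. exp (s * f x)) * exp (- s * t)"
proof -
  have "measure_pmf.prob M {x. f x \<ge> t} \<le> expect M (\<lambda>x. exp (s * f x) * exp (- s * t))"
    unfolding prob_eq_expect
  proof (rule expect_mono [OF fin])
    fix x
    have "1 \<le> exp (s * f x - s * t)" if "f x \<ge> t"
      using that s by (simp add: mult_left_mono)
    then show "of_bool (f x \<ge> t) \<le> exp (s * f x) * exp (- s * t)"
      by (simp flip: exp_add)
  qed
  then show ?thesis by simp
qed

lemma exp_le_quadratic:
  fixes x :: real
  assumes "x \<le> 1"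
  shows "exp x \<le> 1 + x + x\<^sup>2"
proof (cases "0 \<le> x")
  case True
  then show ?thesis using exp_bound assms by simp
next
  case False
  have "1 - x \<le> exp (- x)" using exp_ge_add_one_self[of "- x"] by simp
  then have "exp x \<le> 1 / (1 - x)"
    using False by (simp add: exp_minus field_simps)
  also have "\<dots> \<le> 1 + x + x\<^sup>2"
  proof -
    have "(1 + x + x\<^sup>2) * (1 - x) = 1 - x * x\<^sup>2" by (simp add: algebra_simps power2_eq_square)
    moreover have "x * x\<^sup>2 \<le> 0" using False by (simp add: mult_nonpos_nonneg)
    ultimately have "1 \<le> (1 + x + x\<^sup>2) * (1 - x)" by simp
    then show ?thesis using False by (simp add: pos_divide_le_eq)
  qed
  finally show ?thesis .
qed

section \<open>Product laws and resampling\<close>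

definition depends_on :: "(('e \<Rightarrow> 'b) \<Rightarrow> 'c) \<Rightarrow> 'e set \<Rightarrow> bool" where
  "depends_on f S \<longleftrightarrow> (\<forall>w w'. (\<forall>x\<in>S. w x = w' x) \<longrightarrow> f w = f w')"

definition mix :: "'e set \<Rightarrow> ('e \<Rightarrow> 'b) \<Rightarrow> ('e \<Rightarrow> 'b) \<Rightarrow> 'e \<Rightarrow> 'b" where
  "mix S x z = (\<lambda>e. if e \<in> S then x e else z e)"

lemma depends_onD: "depends_on f S \<Longrightarrow> (\<And>x. x \<in> S \<Longrightarrow> w x = w' x) \<Longrightarrow> f w = f w'"
  unfolding depends_on_def by blast

text \<open>
  Coordinates of a product law are independent, so those in \<open>S\<close> may be taken from one sample and
  the rest from a second, independent one. Conditioning on the coordinates in \<open>S\<close> then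
  means holding the first sample fixed.
\<close>

lemma Pi_pmf_resample:
  assumes A: "finite A"
  shows "Pi_pmf A d p = bind_pmf (Pi_pmf A d p) (\<lambda>x. map_pmf (mix S x) (Pi_pmf A d p))"
proof -
  let ?M = "Pi_pmf A d p"
  have "?M = Pi_pmf ((A \<inter> S) \<union> (A - S)) d p" by (simp add: Int_Diff_Un)
  also have "\<dots> = map_pmf (\<lambda>(f,g) x. if x \<in> A \<inter> S then f x else g x)
      (pair_pmf (Pi_pmf (A \<inter> S) d p) (Pi_pmf (A - S) d p))"
    by (rule Pi_pmf_union) (use A in auto)
  also have "Pi_pmf (A \<inter> S) d p = map_pmf (\<lambda>f x. if x \<in> A \<inter> S then f x else d) ?M"
    by (rule Pi_pmf_subset) (use A in auto)
  also have "Pi_pmf (A - S) d p = map_pmf (\<lambda>f x. if x \<in> A - S then f x else d) ?M"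
    by (rule Pi_pmf_subset) (use A in auto)
  also have "map_pmf (\<lambda>(f,g) x. if x \<in> A \<inter> S then f x else g x)
      (pair_pmf (map_pmf (\<lambda>f x. if x \<in> A \<inter> S then f x else d) ?M)
        (map_pmf (\<lambda>f x. if x \<in> A - S then f x else d) ?M))
     = bind_pmf ?M (\<lambda>x. map_pmf (\<lambda>z. \<lambda>e. if e \<in> A \<inter> S then x e else if e \<in> A - S then z e else d) ?M)"
    unfolding pair_pmf_def map_pmf_def
    by (simp add: bind_assoc_pmf bind_return_pmf)
       (intro bind_pmf_cong refl arg_cong[where f=return_pmf], auto)
  also have "\<dots> = bind_pmf ?M (\<lambda>x. map_pmf (mix S x) ?M)"
  proof (intro bind_pmf_cong refl map_pmf_cong)
    fix x z assume "x \<in> set_pmf ?M" "z \<in> set_pmf ?M"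
    with set_Pi_pmf_subset [OF A, of d p] have "x e = d" "z e = d" if "e \<notin> A" for e
      using that by auto
    then show "(\<lambda>e. if e \<in> A \<inter> S then x e else if e \<in> A - S then z e else d) = mix S x z"
      by (auto simp: mix_def fun_eq_iff)
  qed
  finally show ?thesis .
qed

locale finite_product =
  fixes A :: "'e set" and p :: "'e \<Rightarrow> bool pmf"
  assumes finA: "finite A"
begin

definition M :: "('e \<Rightarrow> bool) pmf" where
  "M = Pi_pmf A False p"

lemma finite_support: "finite (set_pmf M)"
proof -
  have "set_pmf M \<subseteq> PiE_dflt A False (\<lambda>_. UNIV)"
    unfolding M_def using set_Pi_pmf_subset' [OF finA] by (force simp: PiE_dflt_def)
  then show ?thesis
    by (rule finite_subset) (use finA in \<open>auto intro: finite_PiE_dflt\<close>)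
qed

lemma expect_resample: "expect M h = expect M (\<lambda>x. expect M (\<lambda>z. h (mix S x z)))"
proof -
  have "expect M h = expect (bind_pmf M (\<lambda>x. map_pmf (mix S x) M)) h"
    unfolding M_def using Pi_pmf_resample [OF finA] by metis
  also have "\<dots> = expect M (\<lambda>x. expect (map_pmf (mix S x) M) h)"
    by (rule expect_bind) (auto simp: finite_support)
  finally show ?thesis by simp
qed

lemma expect_mult_disjoint:
  assumes "depends_on f S" "depends_on g T" "S \<inter> T = {}"
  shows "expect M (\<lambda>w. f w * g w) = expect M f * expect M g"
proof -
  have f: "f (mix S x z) = f x" for x z
    by (rule depends_onD [OF assms(1)]) (simp add: mix_def)
  have g: "g (mix S x z) = g z" for x z
    by (rule depends_onD [OF assms(2)]) (use assms(3) in \<open>auto simp: mix_def\<close>)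
  have "expect M (\<lambda>w. f w * g w) = expect M (\<lambda>x. expect M (\<lambda>z. f (mix S x z) * g (mix S x z)))"
    by (rule expect_resample)
  then show ?thesis by (simp add: f g)
qed

lemma expect_prod_disjoint:
  assumes "finite K" "\<And>v. v \<in> K \<Longrightarrow> depends_on (f v) (S v)"
    "\<And>u v. u \<in> K \<Longrightarrow> v \<in> K \<Longrightarrow> u \<noteq> v \<Longrightarrow> S u \<inter> S v = {}"
  shows "expect M (\<lambda>w. \<Prod>v\<in>K. f v w) = (\<Prod>v\<in>K. expect M (f v))"
  using assms
proof (induction rule: finite_induct)
  case (insert v K)
  have dep: "depends_on (\<lambda>w. \<Prod>u\<in>K. f u w) (\<Union>u\<in>K. S u)"
    unfolding depends_on_def
  proof (intro allI impI prod.cong refl)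
    fix w w' :: "'e \<Rightarrow> bool" and u assume "\<forall>x\<in>\<Union> (S ` K). w x = w' x" "u \<in> K"
    then show "f u w = f u w'"
      using insert.prems(1)[of u] unfolding depends_on_def by blast
  qed
  have "S v \<inter> S u = {}" if "u \<in> K" for u
    using insert.prems(2)[of v u] that insert.hyps by blast
  then have "S v \<inter> (\<Union>u\<in>K. S u) = {}" by blast
  then have "expect M (\<lambda>w. f v w * (\<Prod>u\<in>K. f u w)) = expect M (f v) * expect M (\<lambda>w. \<Prod>u\<in>K. f u w)"
    by (intro expect_mult_disjoint [OF _ dep]) (use insert.prems in auto)
  with insert show ?case by simp
qed simp

lemma expect_condition_edge:
  assumes e: "e \<in> A"
  shows "expect M h = pmf (p e) True * expect M (\<lambda>w. h (w(e := True)))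
           + (1 - pmf (p e) True) * expect M (\<lambda>w. h (w(e := False)))"
proof -
  define k where "k = (\<lambda>b. expect M (\<lambda>w. h (w(e := b))))"
  have eq: "mix {e} x z = z(e := x e)" for x z :: "'e \<Rightarrow> bool"
    by (auto simp: mix_def)
  have "expect M h = expect M (\<lambda>x. expect M (\<lambda>z. h (mix {e} x z)))"
    by (rule expect_resample)
  then have "expect M h = expect M (\<lambda>x. k (x e))"
    by (simp add: eq k_def)
  also have "\<dots> = expect (map_pmf (\<lambda>x. x e) M) k" by simp
  also have "map_pmf (\<lambda>x. x e) M = p e"
    unfolding M_def using Pi_pmf_component [OF finA, of e False p] e by simp
  also have "expect (p e) k = pmf (p e) True * k True + pmf (p e) False * k False"
    by (subst integral_measure_pmf [where A = UNIV]) (auto simp: UNIV_bool)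
  also have "pmf (p e) False = 1 - pmf (p e) True"
    by (simp add: pmf_False_conv_True)
  finally show ?thesis by (simp add: k_def)
qed

end

section \<open>The chain of configurations\<close>

lemma finite_vertex_pairs: "finite (vertex_pairs N)"
proof -
  have "vertex_pairs N \<subseteq> Pow (vertices N)" by (auto simp: vertex_pairs_def)
  then show ?thesis by (rule finite_subset) (simp add: vertices_def)
qed

lemma finite_random_graph: "finite (set_pmf (random_graph_pmf a b N y))"
proof -
  have "set_pmf (random_graph_pmf a b N y) \<subseteq> Pow (vertex_pairs N)"
    by (auto simp: random_graph_pmf_def)
  then show ?thesis by (rule finite_subset) (simp add: finite_vertex_pairs)
qed

lemma finite_history: "finite (set_pmf (history_pmf a b N y n))"
  by (induction n) (auto simp: finite_random_graph)

text \<open>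
  The recursion of \<^const>\<open>history_pmf\<close> splits off the last round; arguments by potentials
  condition on the first one.
\<close>

lemma history_pmf_first_step:
  "history_pmf a b N y (Suc n) = bind_pmf (random_graph_pmf a b N y)
     (\<lambda>G. map_pmf ((#) G) (history_pmf a b N (majority_update N G y) n))"
proof (induction n)
  case 0
  then show ?case by (simp add: bind_return_pmf map_pmf_def opinions_def)
next
  case (Suc n)
  have "history_pmf a b N y (Suc (Suc n)) =
     bind_pmf (bind_pmf (random_graph_pmf a b N y)
       (\<lambda>G. map_pmf ((#) G) (history_pmf a b N (majority_update N G y) n)))
     (\<lambda>Gs. map_pmf (\<lambda>G. Gs @ [G]) (random_graph_pmf a b N (opinions N y Gs)))"
    by (subst history_pmf.simps(2)) (simp only: Suc.IH)
  also have "\<dots> = bind_pmf (random_graph_pmf a b N y)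
     (\<lambda>G. map_pmf ((#) G) (history_pmf a b N (majority_update N G y) (Suc n)))"
    by (simp add: map_pmf_def bind_assoc_pmf bind_return_pmf opinions_def)
  finally show ?case .
qed

text \<open>
  Red vertices exist after round \<open>n\<close> only if they existed in every earlier round, because the
  all-blue configuration is absorbing.
\<close>

definition survival :: "real \<Rightarrow> real \<Rightarrow> nat \<Rightarrow> nat \<Rightarrow> configuration \<Rightarrow> real" where
  "survival a b N n y =
     measure_pmf.prob (history_pmf a b N y n) {Gs. red N (opinions N y Gs) \<noteq> {}}"

lemma survival_le_1: "survival a b N n y \<le> 1"
  by (simp add: survival_def)

lemma survival_0: "survival a b N 0 y = of_bool (red N y \<noteq> {})"
  by (simp add: survival_def opinions_def indicator_def)

lemma survival_Suc:
  "survival a b N (Suc n) y =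
     expect (random_graph_pmf a b N y) (\<lambda>G. survival a b N n (majority_update N G y))"
proof -
  have "survival a b N (Suc n) y = expect (random_graph_pmf a b N y)
      (\<lambda>G. expect (map_pmf ((#) G) (history_pmf a b N (majority_update N G y) n))
        (\<lambda>Gs. of_bool (red N (opinions N y Gs) \<noteq> {})))"
    unfolding survival_def prob_eq_expect history_pmf_first_step
    by (rule expect_bind) (auto simp: finite_random_graph finite_history)
  then show ?thesis
    by (simp add: survival_def prob_eq_expect opinions_def)
qed

lemma majority_update_is_configuration:
  "is_configuration N y \<Longrightarrow> is_configuration N (majority_update N G y)"
  by (auto simp: is_configuration_def majority_update_def Let_def)

lemma majority_update_all_blue:
  assumes "is_configuration N y" "red N y = {}"
  shows "red N (majority_update N G y) = {}"
proof -
  have "majority_update N G y v \<noteq> -1" if "v \<in> vertices N" for v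
  proof -
    have "y v \<noteq> -1" using assms(2) that by (auto simp: red_def)
    then show ?thesis using assms(2) by (simp add: majority_update_def Let_def)
  qed
  then show ?thesis by (auto simp: red_def)
qed

lemma survival_all_blue:
  assumes "is_configuration N y" "red N y = {}"
  shows "survival a b N n y = 0"
  using assms
proof (induction n arbitrary: y)
  case (Suc n)
  have "survival a b N n (majority_update N G y) = 0" for G
    by (rule Suc.IH [OF majority_update_is_configuration [OF Suc.prems(1)]
          majority_update_all_blue [OF Suc.prems]])
  then show ?case by (simp add: survival_Suc)
qed (simp add: survival_0)

lemma survival_Suc_le: "is_configuration N y \<Longrightarrow> survival a b N (Suc n) y \<le> survival a b N n y"
proof (induction n arbitrary: y)
  case 0
  then show ?case
    by (cases "red N y = {}") (auto simp: survival_all_blue survival_0 survival_le_1 simp del: One_nat_def)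
next
  case (Suc n)
  show ?case
    unfolding survival_Suc [of _ _ _ "Suc n"] survival_Suc [of _ _ _ n y]
    by (rule expect_mono) (use Suc in \<open>auto simp: finite_random_graph majority_update_is_configuration\<close>)
qed

lemma survival_antimono:
  assumes "is_configuration N y" "m \<le> n"
  shows "survival a b N n y \<le> survival a b N m y"
  using assms(2)
proof (induction rule: dec_induct)
  case (step n)
  then show ?case using survival_Suc_le [OF assms(1), of a b n] by linarith
qed simp

text \<open>
  Two potentials control the process outside a target set \<open>A\<close>. The first one, \<open>f\<close>, is a
  supermartingale that is at least \<open>1\<close> where the process has failed, so \<open>f y\<close> bounds the
  probability of ever failing. The second one, \<open>g\<close>, is at least \<open>1\<close> where the process is
  still active and shrinks by the factor \<open>1 - q\<close> per round, so it bounds the probability of being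
  active for long. Induction over the number of rounds handles both without stopping times; the
  bound on \<open>A\<close> is carried along, which lets one phase be plugged into the next.
\<close>

lemma survival_le_potentials:
  fixes f g :: "configuration \<Rightarrow> real"
  assumes f0: "\<And>y. 0 \<le> f y" and g0: "\<And>y. 0 \<le> g y" and q: "0 \<le> q" "q \<le> 1" and e0: "0 \<le> e0"
    and target: "\<And>y m. is_configuration N y \<Longrightarrow> A y \<Longrightarrow> survival a b N (n0 + m) y \<le> e0"
    and active: "\<And>y. is_configuration N y \<Longrightarrow> \<not> A y \<Longrightarrow> f y < 1 \<Longrightarrow>
      1 \<le> g y
      \<and> expect (random_graph_pmf a b N y) (\<lambda>G. f (majority_update N G y)) \<le> f y
      \<and> expect (random_graph_pmf a b N y) (\<lambda>G. g (majority_update N G y)) \<le> (1 - q) * g y"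
  shows "is_configuration N y \<Longrightarrow> survival a b N (n0 + n) y \<le> e0 + f y + (1 - q) ^ n * g y"
proof (induction n arbitrary: y)
  case 0
  show ?case
  proof (cases "A y \<or> f y \<ge> 1")
    case True
    with target [OF 0, of 0] survival_le_1[of a b N n0 y] f0[of y] g0[of y] e0 show ?thesis by auto
  next
    case False
    with active [OF 0] have "1 \<le> g y" by auto
    with survival_le_1[of a b N n0 y] f0[of y] e0 show ?thesis by simp
  qed
next
  case (Suc n)
  have nn: "0 \<le> (1 - q) ^ n * g y" "0 \<le> (1 - q) ^ Suc n * g y" for n y using g0 q by auto
  show ?case
  proof (cases "A y \<or> f y \<ge> 1")
    case True
    then show ?thesis
      using target [OF Suc.prems, of "Suc n"] survival_le_1[of a b N "n0 + Suc n" y] f0[of y] nn(2)[of n y] e0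
      by linarith
  next
    case False
    let ?P = "random_graph_pmf a b N y"
    let ?u = "\<lambda>G. majority_update N G y"
    from active [OF Suc.prems] False have *:
      "expect ?P (\<lambda>G. f (?u G)) \<le> f y" "expect ?P (\<lambda>G. g (?u G)) \<le> (1 - q) * g y" by auto
    have "survival a b N (n0 + Suc n) y = expect ?P (\<lambda>G. survival a b N (n0 + n) (?u G))"
      by (simp add: survival_Suc)
    also have "\<dots> \<le> expect ?P (\<lambda>G. (e0 + f (?u G)) + (1 - q) ^ n * g (?u G))"
      by (rule expect_mono)
        (auto simp: finite_random_graph intro!: Suc.IH majority_update_is_configuration Suc.prems)
    also have "\<dots> = e0 + expect ?P (\<lambda>G. f (?u G)) + (1 - q) ^ n * expect ?P (\<lambda>G. g (?u G))"
      by (simp add: expect_add finite_random_graph)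
    also have "\<dots> \<le> e0 + f y + (1 - q) ^ n * ((1 - q) * g y)"
      using * q by (intro add_mono mult_left_mono) auto
    finally show ?thesis by (simp add: algebra_simps)
  qed
qed

section \<open>Comparing two binomial counts\<close>

definition binom_weight :: "nat \<Rightarrow> real \<Rightarrow> nat \<Rightarrow> real" where
  "binom_weight n p k = real (n choose k) * p ^ k * (1 - p) ^ (n - k)"

text \<open>
  The probability that a binomial \<open>(m, p)\<close> variable exceeds an independent binomial \<open>(n, r)\<close>
  variable: with \<open>m\<close> opponents and \<open>n\<close> other supporters, a vertex changes its opinion with this
  probability.
\<close>

definition outvote :: "nat \<Rightarrow> real \<Rightarrow> nat \<Rightarrow> real \<Rightarrow> real" where
  "outvote m p n r = (\<Sum>i\<le>m. \<Sum>j\<le>n. of_bool (j < i) * (binom_weight m p i * binom_weight n r j))"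

lemma binom_weight_nonneg: "0 \<le> p \<Longrightarrow> p \<le> 1 \<Longrightarrow> 0 \<le> binom_weight n p k"
  by (simp add: binom_weight_def)

text \<open>
  Total positivity of the binomial coefficients: the ratio of consecutive coefficients
  \<open>(n choose (m+1)) / (n choose m) = (n - m) / (m + 1)\<close> increases with \<open>n\<close>.
\<close>

lemma binomial_total_positivity:
  fixes c r :: nat
  assumes "j \<le> m" "r \<le> c"
  shows "(r choose m) * (c choose j) \<le> (c choose m) * (r choose j)"
  using assms(1)
proof (induction rule: dec_induct)
  case (step m)
  have abs: "Suc m * (n choose Suc m) = (n - m) * (n choose m)" for n :: nat
    by (simp only: binomial_absorption binomial_absorb_comp)
  have "Suc m * ((r choose Suc m) * (c choose j)) = (r - m) * ((r choose m) * (c choose j))"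
    by (metis abs mult.assoc)
  also have "\<dots> \<le> (c - m) * ((c choose m) * (r choose j))"
    by (rule mult_le_mono [OF diff_le_mono [OF assms(2)] step.IH])
  also have "\<dots> = Suc m * ((c choose Suc m) * (r choose j))"
    by (metis abs mult.assoc)
  finally show ?case by (metis Suc_mult_le_cancel1)
qed simp

lemma exp_diff_mult_le:
  fixes \<alpha> \<beta> :: real
  assumes "0 \<le> \<beta>" "\<beta> \<le> \<alpha>" "\<alpha> < 1"
  shows "(1 - \<alpha>) * exp (\<alpha> - \<beta>) \<le> 1 - \<beta>"
proof -
  let ?d = "\<alpha> - \<beta>"
  have "1 - ?d \<le> exp (- ?d)" using exp_ge_add_one_self[of "- ?d"] by (simp add: algebra_simps)
  then have "exp ?d * (1 - ?d) \<le> 1"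
    by (metis exp_ge_zero exp_minus_inverse mult_left_mono)
  have "(1 - \<alpha>) \<le> (1 - \<beta>) * (1 - ?d)"
    using assms by (simp add: algebra_simps) (metis mult_right_mono)
  then have "(1 - \<alpha>) * exp ?d \<le> (1 - \<beta>) * (1 - ?d) * exp ?d"
    by (rule mult_right_mono) simp
  also have "\<dots> \<le> (1 - \<beta>) * 1"
    using \<open>exp ?d * (1 - ?d) \<le> 1\<close> assms
    by (simp only: mult.assoc mult.commute[of "1 - ?d"]) (intro mult_left_mono, auto)
  finally show ?thesis by simp
qed

text \<open>
  The source of the drift. With \<open>B\<close> blue and \<open>R \<le> B\<close> red vertices, both sides are expected numbers
  of flips, blue to red on the left and red to blue on the right, and they are compared term by term
  in the double sum. The binomial coefficients favour the majority by total positivity. The edge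
  weights differ by the factor \<open>((1 - \<beta>) / (1 - \<alpha>)) ^ (B - R)\<close>, which gives the exponential gain. The
  comparison is exact for all sizes, so it also resolves advantages far below
  \<open>sqrt N\<close>, where the two numbers of flips agree to leading order.
\<close>

lemma outvote_ratio:
  fixes \<alpha> \<beta> :: real
  assumes ab: "0 \<le> \<beta>" "\<beta> \<le> \<alpha>" "\<alpha> < 1" and BR: "1 \<le> R" "R \<le> B"
  shows "real B * outvote R \<beta> (B - 1) \<alpha> * exp ((\<alpha> - \<beta>) * real (B - R))
           \<le> real R * outvote B \<beta> (R - 1) \<alpha>"
proof -
  define d where "d = B - R"
  have a1: "0 \<le> \<alpha>" "0 \<le> 1 - \<alpha>" "0 \<le> 1 - \<beta>" using ab by auto
  obtain c r where c: "B = Suc c" and r: "R = Suc r" using BR by (metis Suc_le_D One_nat_def Suc_le_D order_trans)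
  have rc: "r \<le> c" using BR c r by simp
  let ?L = "\<lambda>i j. binom_weight R \<beta> i * binom_weight c \<alpha> j"
  let ?U = "\<lambda>i j. binom_weight B \<beta> i * binom_weight r \<alpha> j"
  have trm: "real B * ?L i j * exp ((\<alpha> - \<beta>) * real d) \<le> real R * ?U i j" if "i \<le> R" "j < i" for i j
  proof -
    obtain m where i: "i = Suc m" using \<open>j < i\<close> by (cases i) auto
    have jm: "j \<le> m" and mr: "m \<le> r" using that i r by auto
    have "Suc m * (B * (R choose i) * (c choose j)) = B * R * ((r choose m) * (c choose j))"
      unfolding i r using Suc_times_binomial_eq[of r m] by (simp only: mult_ac)
    also have "\<dots> \<le> B * R * ((c choose m) * (r choose j))"
      using binomial_total_positivity [OF jm rc] by simp
    also have "\<dots> = Suc m * (R * (B choose i) * (r choose j))"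
    proof -
      have "B * R * ((c choose m) * (r choose j)) = R * (Suc c * (c choose m)) * (r choose j)"
        unfolding c by (simp only: mult_ac)
      also have "Suc c * (c choose m) = Suc m * (B choose i)"
        unfolding i c using Suc_times_binomial_eq[of c m] by (simp only: mult.commute)
      finally show ?thesis by (simp only: mult_ac)
    qed
    finally have "B * (R choose i) * (c choose j) \<le> R * (B choose i) * (r choose j)"
      by (metis Suc_mult_le_cancel1)
    then have comb: "real B * real (R choose i) * real (c choose j)
        \<le> real R * real (B choose i) * real (r choose j)"
      by (metis of_nat_le_iff of_nat_mult)
    have e1: "B - i = (R - i) + d" "c - j = (r - j) + d"
      using that c r rc jm mr unfolding d_def by auto
    have "((1 - \<alpha>) * exp (\<alpha> - \<beta>)) ^ d \<le> (1 - \<beta>) ^ d"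
      using exp_diff_mult_le [OF ab] a1 by (intro power_mono) auto
    then have pw: "(1 - \<alpha>) ^ d * exp ((\<alpha> - \<beta>) * real d) \<le> (1 - \<beta>) ^ d"
      by (simp add: power_mult_distrib exp_of_nat_mult mult.commute[of _ "real d"])
    define w where "w = \<beta> ^ i * (1 - \<beta>) ^ (R - i) * \<alpha> ^ j * (1 - \<alpha>) ^ (r - j)"
    have w0: "0 \<le> w" using ab a1 by (simp add: w_def)
    have "real B * ?L i j * exp ((\<alpha> - \<beta>) * real d)
       = (real B * real (R choose i) * real (c choose j)) * w * ((1 - \<alpha>) ^ d * exp ((\<alpha> - \<beta>) * real d))"
      unfolding binom_weight_def w_def e1 power_add by (simp only: mult_ac)
    also have "\<dots> \<le> (real R * real (B choose i) * real (r choose j)) * w * (1 - \<beta>) ^ d"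
      by (rule mult_mono [OF mult_right_mono [OF comb w0] pw]) (use w0 a1 in auto)
    also have "\<dots> = real R * ?U i j"
      unfolding binom_weight_def w_def e1 power_add by (simp only: mult_ac)
    finally show ?thesis .
  qed
  have U0: "0 \<le> ?U i j" for i j
    using ab a1 by (intro mult_nonneg_nonneg binom_weight_nonneg) auto
  have "real B * outvote R \<beta> c \<alpha> * exp ((\<alpha> - \<beta>) * real d)
     = (\<Sum>i\<le>R. \<Sum>j\<le>c. of_bool (j < i) * (real B * ?L i j * exp ((\<alpha> - \<beta>) * real d)))"
    unfolding outvote_def sum_distrib_left sum_distrib_right by (simp only: mult_ac)
  also have "\<dots> \<le> (\<Sum>i\<le>R. \<Sum>j\<le>c. of_bool (j < i) * (real R * ?U i j))"
    by (intro sum_mono) (use trm in \<open>auto simp: of_bool_def\<close>)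
  also have "\<dots> = (\<Sum>i\<le>R. \<Sum>j\<le>r. of_bool (j < i) * (real R * ?U i j))"
    by (intro sum.cong refl sum.mono_neutral_right) (use r rc in auto)
  also have "\<dots> \<le> (\<Sum>i\<le>B. \<Sum>j\<le>r. of_bool (j < i) * (real R * ?U i j))"
    by (intro sum_mono2) (use BR U0 in \<open>auto intro!: sum_nonneg\<close>)
  also have "\<dots> = real R * outvote B \<beta> r \<alpha>"
    unfolding outvote_def sum_distrib_left by (simp only: mult_ac)
  finally show ?thesis by (simp add: c r d_def)
qed

lemma sum_binom_weight: "(\<Sum>i\<le>m. binom_weight m p i * s ^ i) = (1 + p * (s - 1)) ^ m"
proof -
  have "(p * s + (1 - p)) ^ m = (\<Sum>i\<le>m. binom_weight m p i * s ^ i)"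
    by (subst binomial_ring) (auto simp: binom_weight_def power_mult_distrib intro!: sum.cong)
  then show ?thesis by (simp add: algebra_simps)
qed

lemma sum_binom_weight_le_exp:
  assumes "0 \<le> p" "p \<le> 1" "0 \<le> s"
  shows "(\<Sum>i\<le>m. binom_weight m p i * s ^ i) \<le> exp (p * real m * (s - 1))"
proof -
  have "0 \<le> 1 + p * (s - 1)"
    using assms mult_left_le[of p 1] by (simp add: algebra_simps)
       (smt (verit) mult_nonneg_nonneg)
  moreover have "1 + p * (s - 1) \<le> exp (p * (s - 1))" by (rule exp_ge_add_one_self)
  ultimately have "(1 + p * (s - 1)) ^ m \<le> exp (p * (s - 1)) ^ m" by (intro power_mono) auto
  also have "\<dots> = exp (p * real m * (s - 1))"
    by (simp add: exp_of_nat_mult [symmetric] mult_ac)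
  finally show ?thesis by (simp add: sum_binom_weight)
qed

lemma double_binom_sum_le_exp:
  assumes p: "0 \<le> p" "p \<le> 1" and r: "0 \<le> r" "r \<le> 1" and s: "0 < s"
    and P: "\<And>i j. P i j \<Longrightarrow> 1 \<le> s ^ i * t ^ j" and t: "0 < t"
  shows "(\<Sum>i\<le>m. \<Sum>j\<le>n. of_bool (P i j) * (binom_weight m p i * binom_weight n r j))
         \<le> exp (p * real m * (s - 1) + r * real n * (t - 1))"
proof -
  have "(\<Sum>i\<le>m. \<Sum>j\<le>n. of_bool (P i j) * (binom_weight m p i * binom_weight n r j))
     \<le> (\<Sum>i\<le>m. \<Sum>j\<le>n. (binom_weight m p i * s ^ i) * (binom_weight n r j * t ^ j))"
  proof (intro sum_mono)
    fix i j
    have w: "0 \<le> binom_weight m p i * binom_weight n r j"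
      using p r by (simp add: binom_weight_nonneg)
    have "of_bool (P i j) \<le> s ^ i * t ^ j" using P[of i j] s t by (cases "P i j") auto
    then have "of_bool (P i j) * (binom_weight m p i * binom_weight n r j)
      \<le> (s ^ i * t ^ j) * (binom_weight m p i * binom_weight n r j)"
      using w by (intro mult_right_mono)
    then show "of_bool (P i j) * (binom_weight m p i * binom_weight n r j)
      \<le> (binom_weight m p i * s ^ i) * (binom_weight n r j * t ^ j)" by (simp only: mult_ac)
  qed
  also have "\<dots> = (\<Sum>i\<le>m. binom_weight m p i * s ^ i) * (\<Sum>j\<le>n. binom_weight n r j * t ^ j)"
    by (rule sum_product [symmetric])
  also have "\<dots> \<le> exp (p * real m * (s - 1)) * exp (r * real n * (t - 1))"
    using p r s t
    by (intro mult_mono sum_binom_weight_le_exp) (auto intro!: sum_nonneg mult_nonneg_nonneg binom_weight_nonneg)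
  finally show ?thesis by (simp add: exp_add)
qed

text \<open>
  Chernoff bounds for the two outcomes of the comparison, from the exponential moment of the
  difference of the two counts.
\<close>

lemma outvote_le_exp:
  assumes p: "0 \<le> p" "p \<le> 1" and r: "0 \<le> r" "r \<le> 1" and s: "1 \<le> s"
  shows "outvote m p n r \<le> exp (p * real m * (s - 1) - r * real n * (1 - 1 / s))"
proof -
  have "outvote m p n r \<le> exp (p * real m * (s - 1) + r * real n * (1 / s - 1))"
    unfolding outvote_def
  proof (rule double_binom_sum_le_exp)
    fix i j :: nat assume "j < i"
    then have "s ^ j \<le> s ^ i" using s by (intro power_increasing) auto
    then show "1 \<le> s ^ i * (1 / s) ^ j" using s by (simp add: field_simps)
  qed (use assms in auto)
  then show ?thesis by (simp add: algebra_simps)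
qed

lemma one_minus_outvote_le_exp:
  assumes p: "0 \<le> p" "p \<le> 1" and r: "0 \<le> r" "r \<le> 1" and s: "1 \<le> s"
  shows "1 - outvote m p n r \<le> exp (r * real n * (s - 1) - p * real m * (1 - 1 / s))"
proof -
  let ?w = "\<lambda>i j. binom_weight m p i * binom_weight n r j"
  have "(\<Sum>i\<le>m. \<Sum>j\<le>n. ?w i j) = (\<Sum>i\<le>m. binom_weight m p i) * (\<Sum>j\<le>n. binom_weight n r j)"
    by (rule sum_product [symmetric])
  also have "\<dots> = 1" using sum_binom_weight[of m p 1] sum_binom_weight[of n r 1] by simp
  finally have "1 = (\<Sum>i\<le>m. \<Sum>j\<le>n. ?w i j)" by simp
  also have "\<dots> = outvote m p n r + (\<Sum>i\<le>m. \<Sum>j\<le>n. of_bool (i \<le> j) * ?w i j)"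
    unfolding outvote_def sum.distrib [symmetric] by (intro sum.cong refl) auto
  finally have "1 - outvote m p n r = (\<Sum>i\<le>m. \<Sum>j\<le>n. of_bool (i \<le> j) * ?w i j)" by simp
  also have "\<dots> \<le> exp (p * real m * (1 / s - 1) + r * real n * (s - 1))"
  proof (rule double_binom_sum_le_exp)
    fix i j :: nat assume "i \<le> j"
    then have "s ^ i \<le> s ^ j" using s by (intro power_increasing) auto
    then show "1 \<le> (1 / s) ^ i * s ^ j" using s by (simp add: field_simps)
  qed (use assms in auto)
  finally show ?thesis by (simp add: algebra_simps)
qed

lemma fact_le_power_div_exp:
  assumes "1 \<le> i"
  shows "fact i \<le> exp 1 * real i * (real i / exp 1) ^ i"
  using assms
proof (induction rule: dec_induct)
  case (step i)
  have i: "0 < real i" using step by simp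
  have "1 / (real i + 1) \<le> ln ((real i + 1) / real i)"
    using ln_le_minus_one[of "real i / (real i + 1)"] i by (simp add: ln_div field_simps)
  then have "1 \<le> real (Suc i) * ln ((real i + 1) / real i)"
    using i by (simp add: field_simps)
  then have "exp 1 \<le> exp (ln ((real i + 1) / real i)) ^ Suc i"
    by (simp only: exp_of_nat_mult [symmetric] exp_le_cancel_iff)
  then have "exp 1 \<le> ((real i + 1) / real i) ^ Suc i" using i by simp
  then have key: "exp 1 * real i ^ Suc i \<le> (real i + 1) ^ Suc i"
    using i by (simp add: power_divide field_simps)
  have "fact (Suc i) = real (Suc i) * fact i" by simp
  also have "\<dots> \<le> real (Suc i) * (exp 1 * real i * (real i / exp 1) ^ i)"
    using step.IH by (intro mult_left_mono) auto
  also have "\<dots> = real (Suc i) * (exp 1 * real i ^ Suc i) / exp 1 ^ i"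
    by (simp add: power_divide)
  also have "\<dots> \<le> real (Suc i) * (real i + 1) ^ Suc i / exp 1 ^ i"
    using key by (intro divide_right_mono mult_left_mono) auto
  also have "\<dots> = exp 1 * real (Suc i) * (real (Suc i) / exp 1) ^ Suc i"
    by (simp add: power_divide field_simps)
  finally show ?case .
qed simp

text \<open>
  For \<open>k\<close> of order at most \<open>sqrt n\<close> and \<open>p\<close> of order at most \<open>1 / sqrt n\<close> the Poisson approximation
  of a binomial weight is correct up to a constant.
\<close>

lemma binom_weight_ge_poisson:
  assumes p: "0 \<le> p" "p \<le> 1 / 2" and k: "2 * real k ^ 2 \<le> real n" and np: "real n * p\<^sup>2 \<le> 1"
  shows "exp (- 2) / 2 * (real n * p) ^ k / fact k * exp (- (real n * p)) \<le> binom_weight n p k"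
proof (cases "n = 0")
  case True
  with k have "k = 0" by simp
  moreover have "exp (- 2) \<le> (1 :: real)" by simp
  then have "exp (- 2) \<le> (2 :: real)" by linarith
  ultimately show ?thesis using True by (simp add: binom_weight_def)
next
  case False
  then have n: "real n > 0" by simp
  have kn: "k \<le> n"
  proof -
    have "k \<le> 2 * k ^ 2" by (simp add: power2_eq_square)
    also have "\<dots> \<le> n" using k by (metis of_nat_le_iff of_nat_mult of_nat_numeral of_nat_power)
    finally show ?thesis .
  qed
  have "1 / 2 \<le> 1 + real k * (- (real k / real n))"
    using k n by (simp add: field_simps power2_eq_square)
  also have "\<dots> \<le> (1 - real k / real n) ^ k"
    using Bernoulli_inequality[of "- (real k / real n)" k] kn n by (simp add: field_simps)
  finally have h1: "1 / 2 \<le> (1 - real k / real n) ^ k" .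
  have "real n ^ k * (1 - real k / real n) ^ k = (real n - real k) ^ k"
    using n by (simp add: power_mult_distrib [symmetric] field_simps)
  also have "\<dots> \<le> (\<Prod>i<k. real n - real i)"
  proof -
    have "(real n - real k) ^ k = (\<Prod>i<k. real n - real k)" by simp
    also have "\<dots> \<le> (\<Prod>i<k. real n - real i)" by (intro prod_mono) (use kn in auto)
    finally show ?thesis .
  qed
  also have "\<dots> = real (n choose k) * fact k"
    by (simp add: binomial_gbinomial gbinomial_prod_rev atLeast0LessThan)
  finally have h2: "real n ^ k * (1 - real k / real n) ^ k \<le> real (n choose k) * fact k" .
  have "real n ^ k * (1 / 2) \<le> real n ^ k * (1 - real k / real n) ^ k"
    using h1 by (intro mult_left_mono) auto
  with h2 have h3: "real n ^ k / (2 * fact k) \<le> real (n choose k)"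
    by (simp add: field_simps)
  have "exp (- p - 2 * p\<^sup>2) \<le> 1 - p"
    using ln_one_minus_pos_lower_bound[of p] p by (simp add: ln_ge_iff)
  then have "exp (- p - 2 * p\<^sup>2) ^ n \<le> (1 - p) ^ n" by (intro power_mono) auto
  moreover have "exp (- p - 2 * p\<^sup>2) ^ n = exp (real n * (- p - 2 * p\<^sup>2))"
    by (simp add: exp_of_nat_mult)
  moreover have "exp (- (real n * p) - 2) \<le> exp (real n * (- p - 2 * p\<^sup>2))"
    using np by (simp add: algebra_simps)
  moreover have "(1 - p) ^ n \<le> (1 - p) ^ (n - k)" using p by (intro power_decreasing) auto
  ultimately have h4: "exp (- (real n * p) - 2) \<le> (1 - p) ^ (n - k)" by linarith
  have "exp (- 2) / 2 * (real n * p) ^ k / fact k * exp (- (real n * p))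
     = real n ^ k / (2 * fact k) * p ^ k * exp (- (real n * p) - 2)"
    by (simp add: power_mult_distrib exp_diff exp_minus field_simps)
  also have "\<dots> \<le> real (n choose k) * p ^ k * (1 - p) ^ (n - k)"
    using h3 h4 p by (intro mult_mono) auto
  finally show ?thesis by (simp add: binom_weight_def)
qed

text \<open>
  The matching lower bound. When the mean \<open>\<mu>\<close> of the first count is below the mean \<open>\<nu>\<close> of
  the second, the cheapest way of winning is that both counts are near \<open>sqrt (\<mu> \<nu>)\<close>. The single term
  with counts \<open>i + 1\<close> and \<open>i\<close> there already has the right exponent
  \<open>(sqrt \<mu> - sqrt \<nu>)\<^sup>2\<close>, up to factors that are polynomial in the means.
\<close>

lemma outvote_ge:
  assumes p: "0 \<le> p" "p \<le> 1 / 2" and r: "0 \<le> r" "r \<le> 1 / 2"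
    and mp: "real m * p\<^sup>2 \<le> 1" and nr: "real n * r\<^sup>2 \<le> 1"
    and \<mu>: "\<mu> = real m * p" "0 < \<mu>" and \<nu>: "\<nu> = real n * r" "0 < \<nu>"
    and w: "w = sqrt (\<mu> * \<nu>)" and wm: "2 * (w + 1)\<^sup>2 \<le> real m" and wn: "2 * (w + 1)\<^sup>2 \<le> real n"
  shows "outvote m p n r \<ge> exp (- 8) / 4 * \<mu> / (w + 1) ^ 3 * exp (- (sqrt \<mu> - sqrt \<nu>)\<^sup>2)"
proof -
  define i where "i = nat \<lfloor>w\<rfloor>"
  have w0: "0 \<le> w" using \<mu> \<nu> by (simp add: w)
  have iw: "real i \<le> w" "w \<le> real i + 1" using w0 unfolding i_def by linarith+
  have i1: "2 * real (Suc i) ^ 2 \<le> real m" "2 * real i ^ 2 \<le> real n"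
  proof -
    have "real (Suc i) ^ 2 \<le> (w + 1) ^ 2" using iw by (intro power_mono) auto
    then show "2 * real (Suc i) ^ 2 \<le> real m" using wm by linarith
    have "real i ^ 2 \<le> (w + 1) ^ 2" using iw by (intro power_mono) auto
    then show "2 * real i ^ 2 \<le> real n" using wn by linarith
  qed
  have im: "Suc i \<le> m"
  proof -
    have "Suc i \<le> 2 * Suc i ^ 2" by (simp add: power2_eq_square)
    also have "\<dots> \<le> m" using i1(1) by (metis of_nat_le_iff of_nat_mult of_nat_numeral of_nat_power)
    finally show ?thesis .
  qed
  have "i \<le> n"
  proof -
    have "i \<le> 2 * i ^ 2" by (simp add: power2_eq_square)
    also have "\<dots> \<le> n" using i1(2) by (metis of_nat_le_iff of_nat_mult of_nat_numeral of_nat_power)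
    finally show ?thesis .
  qed
  have bw0: "0 \<le> binom_weight m p k" "0 \<le> binom_weight n r k" for k
    using p r by (auto intro: binom_weight_nonneg)
  have "of_bool (i < Suc i) * (binom_weight m p (Suc i) * binom_weight n r i)
     \<le> (\<Sum>j\<le>n. of_bool (j < Suc i) * (binom_weight m p (Suc i) * binom_weight n r j))"
    by (rule member_le_sum) (use \<open>i \<le> n\<close> bw0 in auto)
  also have "\<dots> \<le> outvote m p n r"
    unfolding outvote_def by (rule member_le_sum) (use im bw0 in \<open>auto intro!: sum_nonneg\<close>)
  finally have one: "binom_weight m p (Suc i) * binom_weight n r i \<le> outvote m p n r" by simp
  \<comment> \<open>Stirling, in the form \<open>i! \<le> e i (i / e)^i\<close>; the rounding of \<open>w\<close> to \<open>i\<close> costs a constant\<close>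
  have pw: "exp (2 * w) * exp (- 4) / (w + 1)\<^sup>2 \<le> (\<mu> * \<nu>) ^ i / (fact i)\<^sup>2"
  proof (cases "i = 0")
    case True
    then have "w \<le> 1" using iw by simp
    then have "exp (2 * w) * exp (- 4) \<le> 1" by (simp flip: exp_add)
    also have "1 \<le> (w + 1)\<^sup>2" using w0 by (simp add: power2_eq_square algebra_simps)
    finally show ?thesis using True w0 by (simp add: field_simps)
  next
    case False
    then have i: "1 \<le> i" "0 < real i" by auto
    have "(fact i)\<^sup>2 \<le> (exp 1 * real i * (real i / exp 1) ^ i)\<^sup>2"
      using fact_le_power_div_exp [OF i(1)] by (intro power_mono) auto
    also have "\<dots> = exp 2 * (real i)\<^sup>2 * (real i)\<^sup>2 ^ i / exp (2 * real i)"
      by (simp add: power_divide power_mult_distrib exp_of_nat_mult [symmetric] exp_double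
            power_mult [symmetric] power2_eq_square mult_ac power_add [symmetric] mult_2)
         (simp add: exp_of_nat_mult [symmetric] exp_add [symmetric] power_mult_distrib [symmetric] field_simps)
    also have "\<dots> \<le> exp 2 * (w + 1)\<^sup>2 * (\<mu> * \<nu>) ^ i / exp (2 * w - 2)"
    proof (intro frac_le mult_mono power_mono)
      have "(real i)\<^sup>2 \<le> w\<^sup>2" using iw by (intro power_mono) auto
      also have "w\<^sup>2 = \<mu> * \<nu>" using \<mu> \<nu> by (simp add: w)
      finally show "(real i)\<^sup>2 \<le> \<mu> * \<nu>" .
    qed (use iw w0 \<mu> \<nu> in auto)
    finally have "(fact i)\<^sup>2 \<le> exp 2 * (w + 1)\<^sup>2 * (\<mu> * \<nu>) ^ i / exp (2 * w - 2)" .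
    then have "exp (2 * w - 2) * (fact i)\<^sup>2 \<le> exp 2 * ((w + 1)\<^sup>2 * (\<mu> * \<nu>) ^ i)"
      by (simp add: pos_le_divide_eq mult_ac)
    then have "exp (- 2) * (exp (2 * w - 2) * (fact i)\<^sup>2) \<le> exp (- 2) * (exp 2 * ((w + 1)\<^sup>2 * (\<mu> * \<nu>) ^ i))"
      by (intro mult_left_mono) auto
    then have "exp (2 * w) * exp (- 4) * (fact i)\<^sup>2 \<le> (w + 1)\<^sup>2 * (\<mu> * \<nu>) ^ i"
      by (simp add: mult.assoc [symmetric] exp_add [symmetric])
    then show ?thesis using w0 by (simp add: field_simps)
  qed
  have f1: "fact (Suc i) \<le> (w + 1) * fact i"
    using iw by (simp add: mult_right_mono)
  have "exp (- 8) / 4 * \<mu> / (w + 1) ^ 3 * exp (- (sqrt \<mu> - sqrt \<nu>)\<^sup>2)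
     = exp (- 4) / 4 * (\<mu> / (w + 1)) * (exp (2 * w) * exp (- 4) / (w + 1)\<^sup>2) * exp (- \<mu> - \<nu>)"
  proof -
    have "(sqrt \<mu> - sqrt \<nu>)\<^sup>2 = \<mu> + \<nu> - 2 * w"
      using \<mu>(2) \<nu>(2) by (simp add: power2_diff w real_sqrt_mult)
    then have *: "exp (- (sqrt \<mu> - sqrt \<nu>)\<^sup>2) = exp (2 * w) * exp (- \<mu> - \<nu>)"
      by (simp flip: exp_add)
    have **: "exp (- 8) = exp (- 4) * exp (- 4 :: real)" by (simp flip: exp_add)
    show ?thesis unfolding * ** using w0 by (simp add: field_simps power2_eq_square power3_eq_cube)
  qed
  also have "\<dots> \<le> exp (- 4) / 4 * (\<mu> / (w + 1)) * ((\<mu> * \<nu>) ^ i / (fact i)\<^sup>2) * exp (- \<mu> - \<nu>)"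
    using pw \<mu> w0 by (intro mult_right_mono mult_left_mono) auto
  also have "\<dots> = exp (- 4) / 4 * \<mu> * (\<mu> * \<nu>) ^ i / (((w + 1) * fact i) * fact i) * exp (- \<mu> - \<nu>)"
    by (simp add: power2_eq_square)
  also have "\<dots> \<le> exp (- 4) / 4 * \<mu> * (\<mu> * \<nu>) ^ i / (fact (Suc i) * fact i) * exp (- \<mu> - \<nu>)"
  proof (intro mult_right_mono divide_left_mono)
    show "0 < (w + 1) * fact i * fact i * (fact (Suc i) * fact i)"
      using w0 by (intro mult_pos_pos) (auto simp del: fact_Suc)
  qed (use f1 \<mu> \<nu> in \<open>auto simp del: fact_Suc\<close>)
  also have "\<dots> = (exp (- 2) / 2 * (real m * p) ^ Suc i / fact (Suc i) * exp (- (real m * p)))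
      * (exp (- 2) / 2 * (real n * r) ^ i / fact i * exp (- (real n * r)))"
  proof -
    have e: "exp (- 4) = exp (- 2) * exp (- 2 :: real)" "exp (- \<mu> - \<nu>) = exp (- \<mu>) * exp (- \<nu>)"
      by (simp_all flip: exp_add)
    show ?thesis unfolding e \<mu>(1) [symmetric] \<nu>(1) [symmetric]
      by (simp add: power_mult_distrib field_simps del: fact_Suc)
  qed
  also have "\<dots> \<le> binom_weight m p (Suc i) * binom_weight n r i"
  proof (rule mult_mono)
    show "exp (- 2) / 2 * (real m * p) ^ Suc i / fact (Suc i) * exp (- (real m * p)) \<le> binom_weight m p (Suc i)"
      using i1 by (intro binom_weight_ge_poisson p mp) auto
    show "exp (- 2) / 2 * (real n * r) ^ i / fact i * exp (- (real n * r)) \<le> binom_weight n r i"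
      using i1 by (intro binom_weight_ge_poisson r nr) auto
  qed (use bw0 r in auto)
  finally show ?thesis using one by linarith
qed

section \<open>One round of the dynamics\<close>

text \<open>
  One round for a fixed colouring. The randomness is a function that tells for each pair whether it is
  an edge; the two colours enter symmetrically, so each statement about a vertex covers both.
\<close>

locale coloured_graph =
  fixes V :: "nat set" and y :: "nat \<Rightarrow> int" and \<alpha> \<beta> :: real
  assumes finV: "finite V" and colour: "v \<in> V \<Longrightarrow> y v = 1 \<or> y v = -1"
    and beta0: "0 \<le> \<beta>" and beta_alpha: "\<beta> \<le> \<alpha>" and alpha_half: "\<alpha> \<le> 1 / 2"
begin

definition pairs :: "nat set set" where
  "pairs = {{u, v} | u v. u \<in> V \<and> v \<in> V \<and> u \<noteq> v}"

definition edge_p :: "nat set \<Rightarrow> real" where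
  "edge_p e = (if \<forall>u\<in>e. \<forall>v\<in>e. y u = y v then \<alpha> else \<beta>)"

lemma finite_pairs: "finite pairs"
proof -
  have "pairs \<subseteq> Pow V" by (auto simp: pairs_def)
  then show ?thesis by (rule finite_subset) (simp add: finV)
qed

sublocale finite_product pairs "\<lambda>e. bernoulli_pmf (edge_p e)"
  by standard (rule finite_pairs)

lemma alpha0: "0 \<le> \<alpha>" using beta0 beta_alpha by simp

lemma edge_p_range: "0 \<le> edge_p e" "edge_p e \<le> 1 / 2" "edge_p e \<le> \<alpha>"
  using beta0 beta_alpha alpha_half alpha0 by (auto simp: edge_p_def)

lemma edge_p_pair: "edge_p {u, v} = (if y u = y v then \<alpha> else \<beta>)"
  by (auto simp: edge_p_def)

definition star :: "nat \<Rightarrow> nat set set" where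
  "star v = {{u, v} | u. u \<in> V \<and> u \<noteq> v}"

definition agreeing :: "nat \<Rightarrow> (nat set \<Rightarrow> bool) \<Rightarrow> nat" where
  "agreeing v w = card {u \<in> V. u \<noteq> v \<and> y u = y v \<and> w {u, v}}"

definition disagreeing :: "nat \<Rightarrow> (nat set \<Rightarrow> bool) \<Rightarrow> nat" where
  "disagreeing v w = card {u \<in> V. y u \<noteq> y v \<and> w {u, v}}"

definition flip :: "nat \<Rightarrow> (nat set \<Rightarrow> bool) \<Rightarrow> real" where
  "flip v w = of_bool (agreeing v w < disagreeing v w)"

lemma flip_range: "0 \<le> flip v w" "flip v w \<le> 1"
  by (auto simp: flip_def)

lemma flip_sq: "flip v w * flip v w = flip v w"
  by (simp add: flip_def)

lemma depends_on_flip: "depends_on (flip v) (star v)"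
  unfolding depends_on_def
proof (intro allI impI)
  fix w w' :: "nat set \<Rightarrow> bool" assume *: "\<forall>x\<in>star v. w x = w' x"
  have e: "w {u, v} = w' {u, v}" if "u \<in> V" "u \<noteq> v" for u
    using * that unfolding star_def by blast
  have "agreeing v w = agreeing v w'"
    unfolding agreeing_def by (intro arg_cong[where f = card]) (use e in auto)
  moreover have "disagreeing v w = disagreeing v w'"
    unfolding disagreeing_def by (intro arg_cong[where f = card]) (use e in auto)
  ultimately show "flip v w = flip v w'" by (simp add: flip_def)
qed

text \<open>
  Edges to the own colour hold a vertex back, edges to the other colour push it.
\<close>

lemma flip_mono:
  assumes "\<And>u. u \<in> V \<Longrightarrow> u \<noteq> v \<Longrightarrow> y u = y v \<Longrightarrow> w' {u, v} \<Longrightarrow> w {u, v}"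
    and "\<And>u. u \<in> V \<Longrightarrow> y u \<noteq> y v \<Longrightarrow> w {u, v} \<Longrightarrow> w' {u, v}"
  shows "flip v w \<le> flip v w'"
proof -
  have "agreeing v w' \<le> agreeing v w"
    unfolding agreeing_def by (intro card_mono) (use assms finV in auto)
  moreover have "disagreeing v w \<le> disagreeing v w'"
    unfolding disagreeing_def by (intro card_mono) (use assms finV in auto)
  ultimately show ?thesis by (auto simp: flip_def)
qed

lemma card_edges_law:
  assumes U: "U \<subseteq> V" "v \<in> V" "v \<notin> U" and q: "\<And>u. u \<in> U \<Longrightarrow> edge_p {u, v} = q" "0 \<le> q" "q \<le> 1"
  shows "map_pmf (\<lambda>w. card {u \<in> U. w {u, v}}) M = binomial_pmf (card U) q"
proof -
  define F where "F = (\<lambda>u. {u, v}) ` U"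
  have inj: "inj_on (\<lambda>u. {u, v}) U" using U by (auto simp: inj_on_def doubleton_eq_iff)
  have F: "F \<subseteq> pairs" "finite F" "card F = card U"
  proof -
    show "F \<subseteq> pairs" using U by (auto simp: F_def pairs_def)
    show "finite F" using U finV by (auto simp: F_def intro: finite_subset)
    show "card F = card U" unfolding F_def by (rule card_image [OF inj])
  qed
  have cnt: "card {e \<in> F. w e} = card {u \<in> U. w {u, v}}" for w
  proof -
    have "{e \<in> F. w e} = (\<lambda>u. {u, v}) ` {u \<in> U. w {u, v}}" by (auto simp: F_def)
    then show ?thesis using inj by (simp add: card_image inj_on_subset)
  qed
  have "binomial_pmf (card U) q = map_pmf (\<lambda>f. card {x\<in>F. f x}) (Pi_pmf F False (\<lambda>_. bernoulli_pmf q))"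
    by (rule binomial_pmf_altdef') (use F q in auto)
  also have "Pi_pmf F False (\<lambda>_. bernoulli_pmf q) = Pi_pmf F False (\<lambda>e. bernoulli_pmf (edge_p e))"
    by (rule Pi_pmf_cong) (use q in \<open>auto simp: F_def\<close>)
  also have "\<dots> = map_pmf (\<lambda>f x. if x \<in> F then f x else False) M"
    unfolding M_def by (rule Pi_pmf_subset) (use F finite_pairs in auto)
  also have "map_pmf (\<lambda>f. card {x\<in>F. f x}) \<dots> = map_pmf (\<lambda>w. card {e \<in> F. w e}) M"
    unfolding map_pmf_comp by (intro map_pmf_cong refl arg_cong[where f = card]) auto
  finally show ?thesis by (simp add: cnt)
qed

lemma expect_card_edges:
  assumes "U \<subseteq> V" "v \<in> V" "v \<notin> U" "\<And>u. u \<in> U \<Longrightarrow> edge_p {u, v} = q" "0 \<le> q" "q \<le> 1"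
  shows "expect M (\<lambda>w. of_bool (card {u \<in> U. w {u, v}} = i)) = binom_weight (card U) q i"
proof -
  have "expect M (\<lambda>w. of_bool (card {u \<in> U. w {u, v}} = i))
      = measure_pmf.prob (map_pmf (\<lambda>w. card {u \<in> U. w {u, v}}) M) {i}"
    by (simp add: prob_eq_expect [symmetric] vimage_def)
  also have "\<dots> = pmf (binomial_pmf (card U) q) i"
    by (subst card_edges_law [OF assms]) (simp_all add: measure_pmf_single)
  also have "\<dots> = binom_weight (card U) q i"
    using assms by (simp add: binom_weight_def)
  finally show ?thesis .
qed

lemma expect_flip:
  assumes v: "v \<in> V"
  shows "expect M (flip v) =
    outvote (card {u \<in> V. y u \<noteq> y v}) \<beta> (card {u \<in> V. y u = y v} - 1) \<alpha>"
proof -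
  define Q where "Q = {u \<in> V. y u \<noteq> y v}"
  define C where "C = {u \<in> V. u \<noteq> v \<and> y u = y v}"
  define o' where "o' = (\<lambda>w::nat set \<Rightarrow> bool. card {u \<in> Q. w {u, v}})"
  define c' where "c' = (\<lambda>w::nat set \<Rightarrow> bool. card {u \<in> C. w {u, v}})"
  have fin: "finite Q" "finite C" using finV by (auto simp: Q_def C_def)
  have o_le: "o' w \<le> card Q" for w unfolding o'_def using fin by (intro card_mono) auto
  have c_le: "c' w \<le> card C" for w unfolding c'_def using fin by (intro card_mono) auto
  have "disagreeing v = o'" unfolding disagreeing_def o'_def Q_def
    by (intro ext arg_cong[where f = card]) auto
  moreover have "agreeing v = c'" unfolding agreeing_def c'_def C_def
    by (intro ext arg_cong[where f = card]) auto
  ultimately have flip: "flip v w = of_bool (c' w < o' w)" for w by (simp add: flip_def)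
  have expand: "flip v w = (\<Sum>i\<le>card Q. \<Sum>j\<le>card C. of_bool (j < i) * (of_bool (o' w = i) * of_bool (c' w = j)))" for w
  proof -
    have "(\<Sum>i\<le>card Q. \<Sum>j\<le>card C. of_bool (j < i) * (of_bool (o' w = i) * of_bool (c' w = j)))
       = (\<Sum>i\<le>card Q. \<Sum>j\<le>card C. if j = c' w then if i = o' w then of_bool (c' w < o' w) else 0 else (0::real))"
      by (intro sum.cong refl) auto
    also have "\<dots> = of_bool (c' w < o' w)"
      using o_le[of w] c_le[of w] by (simp add: sum.delta)
    finally show ?thesis by (simp add: flip)
  qed
  have EO: "expect M (\<lambda>w. of_bool (o' w = i)) = binom_weight (card Q) \<beta> i" for i
    unfolding o'_def
    by (rule expect_card_edges) (use v beta0 beta_alpha alpha_half in \<open>auto simp: Q_def edge_p_pair\<close>)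
  have EC: "expect M (\<lambda>w. of_bool (c' w = j)) = binom_weight (card C) \<alpha> j" for j
    unfolding c'_def
    by (rule expect_card_edges) (use v beta0 beta_alpha alpha_half in \<open>auto simp: C_def edge_p_pair\<close>)
  let ?SO = "(\<lambda>u. {u, v}) ` Q" and ?SC = "(\<lambda>u. {u, v}) ` C"
  have dO: "depends_on (\<lambda>w. of_bool (o' w = i) :: real) ?SO" for i
    unfolding depends_on_def
  proof (intro allI impI)
    fix w w' :: "nat set \<Rightarrow> bool" assume "\<forall>x\<in>?SO. w x = w' x"
    then have "{u \<in> Q. w {u, v}} = {u \<in> Q. w' {u, v}}" by auto
    then show "of_bool (o' w = i) = (of_bool (o' w' = i) :: real)" by (simp add: o'_def)
  qed
  have dC: "depends_on (\<lambda>w. of_bool (c' w = i) :: real) ?SC" for i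
    unfolding depends_on_def
  proof (intro allI impI)
    fix w w' :: "nat set \<Rightarrow> bool" assume "\<forall>x\<in>?SC. w x = w' x"
    then have "{u \<in> C. w {u, v}} = {u \<in> C. w' {u, v}}" by auto
    then show "of_bool (c' w = i) = (of_bool (c' w' = i) :: real)" by (simp add: c'_def)
  qed
  have disj: "?SO \<inter> ?SC = {}" by (auto simp: Q_def C_def doubleton_eq_iff)
  have EP: "expect M (\<lambda>w. of_bool (o' w = i) * of_bool (c' w = j))
     = binom_weight (card Q) \<beta> i * binom_weight (card C) \<alpha> j" for i j
    by (subst expect_mult_disjoint [OF dO dC disj]) (simp add: EO EC)
  have "expect M (flip v) = outvote (card Q) \<beta> (card C) \<alpha>"
  proof -
    have "expect M (flip v) = expect M (\<lambda>w. \<Sum>i\<le>card Q. \<Sum>j\<le>card C.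
        of_bool (j < i) * (of_bool (o' w = i) * of_bool (c' w = j)))"
      by (rule expect_cong) (rule expand)
    then show ?thesis
      by (simp only: expect_sum [OF finite_support] integral_mult_right_zero EP outvote_def)
  qed
  moreover have "card C = card {u \<in> V. y u = y v} - 1"
  proof -
    have "C = {u \<in> V. y u = y v} - {v}" by (auto simp: C_def)
    then show ?thesis using v by simp
  qed
  ultimately show ?thesis by (simp add: Q_def)
qed

lemma expect_cov:
  "expect M (\<lambda>w. (f w - expect M f) * (g w - expect M g)) = expect M (\<lambda>w. f w * g w) - expect M f * expect M g"
proof -
  have "expect M (\<lambda>w. (f w - expect M f) * (g w - expect M g))
     = expect M (\<lambda>w. f w * g w - expect M f * g w - (expect M g * f w - expect M f * expect M g))"
    by (rule expect_cong) (simp add: algebra_simps)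
  also have "\<dots> = expect M (\<lambda>w. f w * g w) - expect M f * expect M g
      - (expect M g * expect M f - expect M f * expect M g)"
    by (simp only: expect_diff [OF finite_support] integral_mult_right_zero expect_const)
  finally show ?thesis by simp
qed

text \<open>
  The flips of two vertices depend on disjoint sets of edges, except for the edge between them.
  Conditioning on that single edge makes them independent.
\<close>

lemma cov_flip:
  assumes uv: "u \<in> V" "v \<in> V" "u \<noteq> v"
  shows "expect M (\<lambda>w. flip u w * flip v w) - expect M (flip u) * expect M (flip v)
     = edge_p {u, v} * (1 - edge_p {u, v})
       * (expect M (\<lambda>w. flip u (w({u, v} := True))) - expect M (\<lambda>w. flip u (w({u, v} := False))))
       * (expect M (\<lambda>w. flip v (w({u, v} := True))) - expect M (\<lambda>w. flip v (w({u, v} := False))))"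
proof -
  let ?e = "{u, v}"
  let ?x = "\<lambda>v b. expect M (\<lambda>w. flip v (w(?e := b)))"
  have e: "?e \<in> pairs" using uv by (auto simp: pairs_def)
  have tr: "pmf (bernoulli_pmf (edge_p ?e)) True = edge_p ?e"
    using edge_p_range[of ?e] by simp
  have dep: "depends_on (\<lambda>w. flip v (w(?e := b))) (star v - {?e})" for v b
    unfolding depends_on_def
    by (intro allI impI depends_onD [OF depends_on_flip]) auto
  have "star u \<inter> star v \<subseteq> {?e}"
    using uv by (auto simp: star_def doubleton_eq_iff)
  then have disj: "(star u - {?e}) \<inter> (star v - {?e}) = {}" by blast
  have both: "expect M (\<lambda>w. flip u (w(?e := b)) * flip v (w(?e := b))) = ?x u b * ?x v b" for b
    by (rule expect_mult_disjoint [OF dep dep disj])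
  show ?thesis
    unfolding expect_condition_edge [OF e, of "\<lambda>w. flip u w * flip v w"]
      expect_condition_edge [OF e, of "flip u"] expect_condition_edge [OF e, of "flip v"] both tr
    by algebra
qed

text \<open>
  The shared edge holds both vertices back, so the influences are bounded by the flip probabilities
  without it, and these exceed the unconditional ones by a factor of at most \<open>1 / (1 - \<alpha>)\<close>. The
  covariance is therefore of order \<open>\<alpha>\<close> times the product of the flip probabilities, with no
  loss in the exponents.
\<close>

lemma cov_flip_same:
  assumes uv: "u \<in> V" "v \<in> V" "u \<noteq> v" and same: "y u = y v"
  shows "expect M (\<lambda>w. flip u w * flip v w) - expect M (flip u) * expect M (flip v)
     \<le> 2 * \<alpha> * (expect M (flip u) * expect M (flip v))"
proof -
  let ?e = "{u, v}"
  let ?x = "\<lambda>v b. expect M (\<lambda>w. flip v (w(?e := b)))"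
  have e: "?e \<in> pairs" using uv by (auto simp: pairs_def)
  have ea: "edge_p ?e = \<alpha>" using same by (simp add: edge_p_pair)
  have tr: "pmf (bernoulli_pmf (edge_p ?e)) True = \<alpha>"
    using edge_p_range[of ?e] ea by simp
  have a: "0 \<le> \<alpha>" "1 / 2 \<le> 1 - \<alpha>" using alpha0 alpha_half by auto
  have le: "?x v' True \<le> ?x v' False" if "v' \<in> {u, v}" for v'
  proof (rule expect_mono [OF finite_support])
    fix w show "flip v' (w(?e := True)) \<le> flip v' (w(?e := False))"
      by (rule flip_mono) (use that same in \<open>auto simp: doubleton_eq_iff split: if_splits\<close>)
  qed
  have x0: "0 \<le> ?x v' b" for v' b by (simp add: flip_range)
  have x1: "(1 - \<alpha>) * ?x v' False \<le> expect M (flip v')" for v'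
    unfolding expect_condition_edge [OF e, of "flip v'"] tr using a x0[of v' True] by simp
  have P0: "0 \<le> expect M (flip v')" for v' by (simp add: flip_range)
  have "expect M (\<lambda>w. flip u w * flip v w) - expect M (flip u) * expect M (flip v)
     = \<alpha> * (1 - \<alpha>) * ((?x u False - ?x u True) * (?x v False - ?x v True))"
    unfolding cov_flip [OF uv] ea by algebra
  also have "\<dots> \<le> \<alpha> * (1 - \<alpha>) * (?x u False * ?x v False)"
    using a le[of u] le[of v] x0 by (intro mult_left_mono mult_mono) auto
  also have "\<dots> \<le> \<alpha> * (1 - \<alpha>) * (?x u False * ?x v False) * (2 * (1 - \<alpha>))"
    using mult_left_mono[of 1 "2 * (1 - \<alpha>)" "\<alpha> * (1 - \<alpha>) * (?x u False * ?x v False)"] a x0[of u False] x0[of v False]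
    by simp
  also have "\<dots> = 2 * \<alpha> * (((1 - \<alpha>) * ?x u False) * ((1 - \<alpha>) * ?x v False))"
    by algebra
  also have "\<dots> \<le> 2 * \<alpha> * (expect M (flip u) * expect M (flip v))"
    using a x0 x1 P0 by (intro mult_left_mono mult_mono) auto
  finally show ?thesis .
qed

text \<open>
  The shared edge pushes both vertices. The positive correlation is harmless because opposite flips
  enter the change of the advantage with opposite signs.
\<close>

lemma cov_flip_diff:
  assumes uv: "u \<in> V" "v \<in> V" "u \<noteq> v" and diff: "y u \<noteq> y v"
  shows "expect M (flip u) * expect M (flip v) \<le> expect M (\<lambda>w. flip u w * flip v w)"
proof -
  let ?e = "{u, v}"
  let ?x = "\<lambda>v b. expect M (\<lambda>w. flip v (w(?e := b)))"
  have le: "?x v' False \<le> ?x v' True" if "v' \<in> {u, v}" for v'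
  proof (rule expect_mono [OF finite_support])
    fix w show "flip v' (w(?e := False)) \<le> flip v' (w(?e := True))"
      by (rule flip_mono) (use that diff in \<open>auto simp: doubleton_eq_iff split: if_splits\<close>)
  qed
  have "0 \<le> edge_p ?e * (1 - edge_p ?e) * (?x u True - ?x u False) * (?x v True - ?x v False)"
    using le edge_p_range[of ?e] by (intro mult_nonneg_nonneg) auto
  then show ?thesis using cov_flip [OF uv] by linarith
qed

end

section \<open>Drift and fluctuations of one round\<close>

context coloured_graph
begin

text \<open>
  Class sizes and flip probabilities of the two colours: \<open>P\<close> stands for opinion \<open>1\<close> and
  \<open>M\<close> for opinion \<open>-1\<close>.
\<close>

definition nP :: nat where "nP = card {v \<in> V. y v = 1}"
definition nM :: nat where "nM = card {v \<in> V. y v = -1}"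
definition pM :: real where "pM = outvote nP \<beta> (nM - 1) \<alpha>"
definition pP :: real where "pP = outvote nM \<beta> (nP - 1) \<alpha>"

lemma expect_flip_minus: "v \<in> V \<Longrightarrow> y v = -1 \<Longrightarrow> expect M (flip v) = pM"
proof -
  assume v: "v \<in> V" "y v = -1"
  have "{u \<in> V. y u \<noteq> y v} = {u \<in> V. y u = 1}" "{u \<in> V. y u = y v} = {u \<in> V. y u = -1}"
    using v colour by auto
  then show ?thesis unfolding expect_flip [OF v(1)] pM_def nP_def nM_def by simp
qed

lemma expect_flip_plus: "v \<in> V \<Longrightarrow> y v = 1 \<Longrightarrow> expect M (flip v) = pP"
proof -
  assume v: "v \<in> V" "y v = 1"
  have "{u \<in> V. y u \<noteq> y v} = {u \<in> V. y u = -1}" "{u \<in> V. y u = y v} = {u \<in> V. y u = 1}"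
    using v colour by auto
  then show ?thesis unfolding expect_flip [OF v(1)] pP_def nP_def nM_def by simp
qed

lemma outvote_nonneg: "0 \<le> p \<Longrightarrow> p \<le> 1 \<Longrightarrow> 0 \<le> r \<Longrightarrow> r \<le> 1 \<Longrightarrow> 0 \<le> outvote m p n r"
  unfolding outvote_def by (intro sum_nonneg mult_nonneg_nonneg binom_weight_nonneg) auto

lemma pM_nonneg: "0 \<le> pM" and pP_nonneg: "0 \<le> pP"
  unfolding pM_def pP_def using alpha0 beta0 beta_alpha alpha_half by (auto intro!: outvote_nonneg)

lemma V_split: "V = {v \<in> V. y v = 1} \<union> {v \<in> V. y v = -1}"
  "{v \<in> V. y v = 1} \<inter> {v \<in> V. y v = -1} = {}"
  using colour by auto

lemma sum_by_colour: "(\<Sum>v\<in>V. h v) = (\<Sum>v | v \<in> V \<and> y v = 1. h v) + (\<Sum>v | v \<in> V \<and> y v = -1. (h v :: real))"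
  by (subst V_split(1), subst sum.union_disjoint) (use finV V_split(2) in auto)

text \<open>
  The change of the advantage in the round. The factor \<open>2\<close> arises because a flip shrinks one class and
  enlarges the other.
\<close>

definition gain :: "(nat set \<Rightarrow> bool) \<Rightarrow> real" where
  "gain w = - 2 * (\<Sum>v\<in>V. real_of_int (y v) * flip v w)"

lemma expect_gain: "expect M gain = 2 * (real nM * pM - real nP * pP)"
proof -
  have "expect M gain = - 2 * (\<Sum>v\<in>V. real_of_int (y v) * expect M (flip v))"
    unfolding gain_def by (simp add: expect_sum [OF finite_support])
  also have "(\<Sum>v\<in>V. real_of_int (y v) * expect M (flip v)) = real nP * pP - real nM * pM"
    by (simp add: sum_by_colour expect_flip_plus expect_flip_minus nP_def nM_def)
  finally show ?thesis by (simp add: algebra_simps)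
qed

text \<open>
  The second claim is what makes the flips of the minority dominate in all variance estimates.
\<close>

lemma drift_gain:
  assumes "1 \<le> nM" "nM \<le> nP"
  shows "2 * real nM * pM * (1 - exp (- (\<alpha> - \<beta>) * real (nP - nM))) \<le> expect M gain"
    and "real nP * pP \<le> real nM * pM"
proof -
  let ?E = "exp ((\<alpha> - \<beta>) * real (nP - nM))"
  have "real nP * pP * ?E \<le> real nM * pM"
    unfolding pM_def pP_def
    by (rule outvote_ratio) (use assms beta0 beta_alpha alpha_half in auto)
  then have "real nP * pP * ?E * exp (- (\<alpha> - \<beta>) * real (nP - nM)) \<le> real nM * pM * exp (- (\<alpha> - \<beta>) * real (nP - nM))"
    by (rule mult_right_mono) simp
  then have le: "real nP * pP \<le> real nM * pM * exp (- (\<alpha> - \<beta>) * real (nP - nM))"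
  proof -
    have "?E * exp (- (\<alpha> - \<beta>) * real (nP - nM)) = 1"
      by (simp add: exp_add [symmetric] left_diff_distrib)
    with \<open>real nP * pP * ?E * exp (- (\<alpha> - \<beta>) * real (nP - nM)) \<le> _\<close> show ?thesis
      by (simp only: mult.assoc mult_1_right)
  qed
  then show "2 * real nM * pM * (1 - exp (- (\<alpha> - \<beta>) * real (nP - nM))) \<le> expect M gain"
    unfolding expect_gain by (simp add: algebra_simps)
  have "real nM * pM * exp (- (\<alpha> - \<beta>) * real (nP - nM)) \<le> real nM * pM * 1"
    using pM_nonneg beta_alpha by (intro mult_left_mono) (auto simp: mult_nonpos_nonneg)
  with le show "real nP * pP \<le> real nM * pM" by simp
qed

text \<open>
  The variance is of the order of the expected number of flips, apart from a term that is quadratic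
  in it and carries the small factor \<open>\<alpha>\<close>. Counting the edges instead of the flips would lose a
  factor \<open>ln N\<close> here, and with it the threshold \<open>sqrt (N / ln N)\<close> for the initial
  advantage.
\<close>

lemma variance_gain:
  "expect M (\<lambda>w. (gain w - expect M gain)\<^sup>2)
     \<le> 4 * (real nM * pM + real nP * pP + 2 * \<alpha> * ((real nM * pM)\<^sup>2 + (real nP * pP)\<^sup>2))"
proof -
  let ?m = "\<lambda>v. expect M (flip v)"
  let ?c = "\<lambda>u v. expect M (\<lambda>w. flip u w * flip v w) - ?m u * ?m v"
  let ?y = "\<lambda>v. real_of_int (y v)"
  have m0: "0 \<le> ?m v" for v by (simp add: flip_range)
  have "expect M gain = - 2 * (\<Sum>v\<in>V. ?y v * ?m v)"
    unfolding gain_def by (simp add: expect_sum [OF finite_support])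
  then have diff: "gain w - expect M gain = - 2 * (\<Sum>v\<in>V. ?y v * (flip v w - ?m v))" for w
    by (simp add: gain_def right_diff_distrib sum_subtractf)
  have "(gain w - expect M gain)\<^sup>2
    = 4 * (\<Sum>u\<in>V. \<Sum>v\<in>V. ?y u * ?y v * ((flip u w - ?m u) * (flip v w - ?m v)))" for w
  proof -
    define z where "z = (\<lambda>v. ?y v * (flip v w - ?m v))"
    have "(gain w - expect M gain)\<^sup>2 = 4 * (sum z V * sum z V)"
      unfolding diff z_def by (simp add: power2_eq_square)
    also have "sum z V * sum z V = (\<Sum>u\<in>V. \<Sum>v\<in>V. z u * z v)" by (rule sum_product)
    also have "\<dots> = (\<Sum>u\<in>V. \<Sum>v\<in>V. ?y u * ?y v * ((flip u w - ?m u) * (flip v w - ?m v)))"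
      unfolding z_def by (intro sum.cong refl) (simp only: mult_ac)
    finally show ?thesis .
  qed
  then have eq: "expect M (\<lambda>w. (gain w - expect M gain)\<^sup>2) = 4 * (\<Sum>u\<in>V. \<Sum>v\<in>V. ?y u * ?y v * ?c u v)"
    by (simp only: expect_sum [OF finite_support] integral_mult_right_zero expect_cov)
  have "(\<Sum>u\<in>V. \<Sum>v\<in>V. ?y u * ?y v * ?c u v)
     \<le> (\<Sum>u\<in>V. \<Sum>v\<in>V. (if u = v then ?m v else 0) + (if y u = y v then 2 * \<alpha> * (?m u * ?m v) else 0))"
  proof (intro sum_mono)
    fix u v assume uv: "u \<in> V" "v \<in> V"
    have nn: "0 \<le> 2 * \<alpha> * (?m u * ?m v)" using alpha0 m0 by simp
    consider "u = v" | "u \<noteq> v" "y u = y v" | "u \<noteq> v" "y u \<noteq> y v" by blast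
    then show "?y u * ?y v * ?c u v \<le> (if u = v then ?m v else 0) + (if y u = y v then 2 * \<alpha> * (?m u * ?m v) else 0)"
    proof cases
      case 1
      have "?y v * ?y v = 1" using colour [OF uv(2)] by auto
      moreover have "?c v v \<le> ?m v" using m0[of v] by (simp add: flip_sq)
      ultimately show ?thesis using 1 nn by simp
    next
      case 2
      have "?y v * ?y v = 1" using colour [OF uv(2)] by auto
      then show ?thesis using 2 cov_flip_same [OF uv 2] by simp
    next
      case 3
      have "?y u * ?y v = -1" using colour [OF uv(1)] colour [OF uv(2)] 3 by auto
      then show ?thesis using 3 cov_flip_diff [OF uv 3] by simp
    qed
  qed
  also have "\<dots> = (\<Sum>v\<in>V. ?m v) + 2 * \<alpha> * (\<Sum>u\<in>V. \<Sum>v\<in>V. if y u = y v then ?m u * ?m v else 0)"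
  proof -
    have 1: "(\<Sum>v\<in>V. if u = v then ?m v else 0) = ?m u" if "u \<in> V" for u
      using that unfolding sum.delta' [OF finV] by simp
    have 2: "(\<Sum>v\<in>V. if y u = y v then 2 * \<alpha> * (?m u * ?m v) else 0)
         = 2 * \<alpha> * (\<Sum>v\<in>V. if y u = y v then ?m u * ?m v else 0)" for u
      unfolding sum_distrib_left by (intro sum.cong refl) simp
    have "(\<Sum>u\<in>V. \<Sum>v\<in>V. if u = v then ?m v else 0) = (\<Sum>v\<in>V. ?m v)"
      by (rule sum.cong [OF refl 1])
    moreover have "(\<Sum>u\<in>V. 2 * \<alpha> * (\<Sum>v\<in>V. if y u = y v then ?m u * ?m v else 0))
       = 2 * \<alpha> * (\<Sum>u\<in>V. \<Sum>v\<in>V. if y u = y v then ?m u * ?m v else 0)"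
      by (rule sum_distrib_left [symmetric])
    ultimately show ?thesis by (simp only: sum.distrib 2)
  qed
  also have "(\<Sum>v\<in>V. ?m v) = real nM * pM + real nP * pP"
    by (simp add: sum_by_colour expect_flip_plus expect_flip_minus nP_def nM_def)
  also have "(\<Sum>u\<in>V. \<Sum>v\<in>V. if y u = y v then ?m u * ?m v else 0) = (real nM * pM)\<^sup>2 + (real nP * pP)\<^sup>2"
  proof -
    have "(\<Sum>v\<in>V. if y u = y v then ?m u * ?m v else 0)
       = (if y u = 1 then ?m u * (real nP * pP) else ?m u * (real nM * pM))" if "u \<in> V" for u
      using colour [OF that]
      by (auto simp: sum_by_colour expect_flip_plus expect_flip_minus nP_def nM_def)
    then have "(\<Sum>u\<in>V. \<Sum>v\<in>V. if y u = y v then ?m u * ?m v else 0)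
       = (\<Sum>u\<in>V. if y u = 1 then ?m u * (real nP * pP) else ?m u * (real nM * pM))"
      by (rule sum.cong [OF refl])
    also have "\<dots> = (real nM * pM)\<^sup>2 + (real nP * pP)\<^sup>2"
      unfolding sum_by_colour
      by (simp add: expect_flip_plus expect_flip_minus nP_def nM_def power2_eq_square)
    finally show ?thesis .
  qed
  finally show ?thesis unfolding eq by simp
qed

lemma expect_delete_edges:
  assumes "finite F" "F \<subseteq> pairs" "\<And>w. 0 \<le> f w"
  shows "(1 - \<alpha>) ^ card F * expect M (\<lambda>w. f (\<lambda>e. e \<notin> F \<and> w e)) \<le> expect M f"
  using assms(1,2)
proof (induction rule: finite_induct)
  case (insert e F)
  let ?g = "\<lambda>w. f (\<lambda>e. e \<notin> F \<and> w e)"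
  have a: "0 \<le> 1 - \<alpha>" using alpha_half by simp
  have e: "e \<in> pairs" using insert by simp
  have tr: "pmf (bernoulli_pmf (edge_p e)) True = edge_p e"
    using edge_p_range[of e] by simp
  have off: "(\<lambda>x. x \<notin> F \<and> (w(e := False)) x) = (\<lambda>x. x \<notin> insert e F \<and> w x)" for w
    by auto
  have pos: "0 \<le> expect M (\<lambda>w. ?g (w(e := b)))" for b
    by (rule Bochner_Integration.integral_nonneg) (rule assms)
  have "(1 - \<alpha>) * expect M (\<lambda>w. f (\<lambda>x. x \<notin> insert e F \<and> w x)) = (1 - \<alpha>) * expect M (\<lambda>w. ?g (w(e := False)))"
    by (simp only: off)
  also have "\<dots> \<le> (1 - edge_p e) * expect M (\<lambda>w. ?g (w(e := False)))"
    using edge_p_range[of e] pos[of False] by (intro mult_right_mono) auto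
  also have "\<dots> \<le> expect M ?g"
    unfolding expect_condition_edge [OF e, of ?g] tr using edge_p_range[of e] pos[of True] by simp
  finally have "(1 - \<alpha>) ^ card F * ((1 - \<alpha>) * expect M (\<lambda>w. f (\<lambda>x. x \<notin> insert e F \<and> w x)))
      \<le> (1 - \<alpha>) ^ card F * expect M ?g"
    using a by (intro mult_left_mono) auto
  also have "\<dots> \<le> expect M f" using insert by simp
  finally show ?case using insert.hyps by (simp add: mult_ac)
qed simp

text \<open>
  A tail bound for the number of flips in a set \<open>K\<close> of vertices of one colour with
  \<open>\<alpha> card K\<close> bounded. Conditionally on the edges inside \<open>K\<close> the flips are independent, and their
  conditional probabilities \<open>\<phi>\<close> are at most \<open>3 p\<close>, since a vertex of \<open>K\<close> has no neighbour in \<open>K\<close> with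
  probability at least \<open>1/3\<close>. This gives an exponential bound around the conditional mean \<open>T\<close>. The
  fluctuations of \<open>T\<close> are treated by Chebyshev's inequality: its variance is of order \<open>p\<^sup>2\<close> instead
  of \<open>p\<close>, and the additional factor \<open>p\<close> is what the exponential potential below consumes.
\<close>

lemma block_tail:
  assumes K: "K \<subseteq> V" "\<And>u v. u \<in> K \<Longrightarrow> v \<in> K \<Longrightarrow> y u = y v"
    and p: "\<And>v. v \<in> K \<Longrightarrow> expect M (flip v) = p"
    and small: "2 * \<alpha> * real (card K) \<le> 1"
    and \<sigma>: "\<sigma> = 1 \<or> \<sigma> = (-1::real)" and s: "0 \<le> s" "s \<le> 1" and \<tau>: "0 < \<tau>"
  shows "measure_pmf.prob M {w. \<sigma> * ((\<Sum>v\<in>K. flip v w) - real (card K) * p) \<ge> \<tau>}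
     \<le> exp (3 * s\<^sup>2 * (real (card K) * p) - s * (\<tau> / 2))
       + 4 * (9 * real (card K) * p\<^sup>2 + 2 * \<alpha> * (real (card K) * p)\<^sup>2) / \<tau>\<^sup>2"
proof (cases "K = {}")
  case True
  then show ?thesis using \<tau> by simp
next
  case False
  define n where "n = card K"
  have finK: "finite K" by (rule finite_subset [OF K(1) finV])
  have p0: "0 \<le> p" using False p flip_range by (metis Bochner_Integration.integral_nonneg ex_in_conv)
  define S where "S = {e. e \<subseteq> K}"
  define \<phi> where "\<phi> = (\<lambda>v x. expect M (\<lambda>z. flip v (mix S x z)))"
  have \<phi>0: "0 \<le> \<phi> v x" for v x by (simp add: \<phi>_def flip_range)
  have a: "0 \<le> \<alpha>" "1 / 2 \<le> 1 - \<alpha>" using alpha0 alpha_half by auto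
  have \<phi>_le: "\<phi> v x \<le> 3 * p" if v: "v \<in> K" for v x
  proof -
    define F where "F = (\<lambda>u. {u, v}) ` (K - {v})"
    have F: "finite F" "F \<subseteq> pairs" using finK K v by (auto simp: F_def pairs_def)
    have cF: "card F \<le> n" unfolding F_def n_def
      using card_image_le[of "K - {v}" "\<lambda>u. {u, v}"] finK card_Diff1_le[of K v] by (meson finite_Diff order_trans)
    have "\<phi> v x \<le> expect M (\<lambda>z. flip v (\<lambda>e. e \<notin> F \<and> z e))"
      unfolding \<phi>_def
    proof (rule expect_mono [OF finite_support])
      fix z
      show "flip v (mix S x z) \<le> flip v (\<lambda>e. e \<notin> F \<and> z e)"
      proof (rule flip_mono)
        fix u assume u: "u \<in> V" "u \<noteq> v" "y u = y v" "{u, v} \<notin> F \<and> z {u, v}"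
        then have "u \<notin> K" by (auto simp: F_def)
        then show "mix S x z {u, v}" using u by (simp add: mix_def S_def)
      next
        fix u assume u: "u \<in> V" "y u \<noteq> y v" "mix S x z {u, v}"
        then have "u \<notin> K" using K(2)[of u v] v by auto
        then show "{u, v} \<notin> F \<and> z {u, v}" using u v by (auto simp: mix_def S_def F_def doubleton_eq_iff)
      qed
    qed
    moreover have "(1 - \<alpha>) ^ card F * expect M (\<lambda>w. flip v (\<lambda>e. e \<notin> F \<and> w e)) \<le> p"
      using expect_delete_edges [OF F, of "flip v"] p [OF v] flip_range by simp
    moreover have "1 / 3 \<le> (1 - \<alpha>) ^ card F"
    proof -
      have "- \<alpha> - 2 * \<alpha>\<^sup>2 \<le> ln (1 - \<alpha>)"
        using ln_one_minus_pos_lower_bound[of \<alpha>] a alpha_half by simp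
      moreover have "2 * \<alpha>\<^sup>2 \<le> \<alpha>" using a alpha_half mult_left_mono[of \<alpha> "1/2" \<alpha>]
        by (simp add: power2_eq_square)
      ultimately have "- 2 * \<alpha> \<le> ln (1 - \<alpha>)" by simp
      then have "exp (- 2 * \<alpha>) \<le> 1 - \<alpha>" using a by (simp add: ln_ge_iff)
      then have "exp (- 2 * \<alpha>) ^ n \<le> (1 - \<alpha>) ^ n" by (intro power_mono) auto
      moreover have "exp (- 1) \<le> exp (- 2 * \<alpha>) ^ n"
        using small by (simp add: exp_of_nat_mult [symmetric] n_def mult_ac)
      moreover have "(1 - \<alpha>) ^ n \<le> (1 - \<alpha>) ^ card F" using a cF by (intro power_decreasing) auto
      moreover have "1 / 3 \<le> exp (- 1 :: real)"
        using exp_le by (simp add: exp_minus field_simps)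
      ultimately show ?thesis by linarith
    qed
    ultimately show ?thesis
      using mult_right_mono[of "1 / 3" "(1 - \<alpha>) ^ card F" "expect M (\<lambda>z. flip v (\<lambda>e. e \<notin> F \<and> z e))"]
      by (simp add: flip_range)
  qed
  have indep: "expect M (\<lambda>z. \<Prod>v\<in>L. h v (flip v (mix S x z))) = (\<Prod>v\<in>L. expect M (\<lambda>z. h v (flip v (mix S x z))))"
    if "L \<subseteq> K" for h :: "nat \<Rightarrow> real \<Rightarrow> real" and x L
  proof (rule expect_prod_disjoint [where S = "\<lambda>v. star v - S"])
    show "finite L" using that finK finite_subset by auto
    show "depends_on (\<lambda>z. h v (flip v (mix S x z))) (star v - S)" for v
      unfolding depends_on_def
      by (intro allI impI arg_cong[where f = "h v"] depends_onD [OF depends_on_flip]) (auto simp: mix_def)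
    show "(star u - S) \<inter> (star v - S) = {}" if "u \<in> L" "v \<in> L" "u \<noteq> v" for u v
      using that \<open>L \<subseteq> K\<close> by (auto simp: star_def S_def doubleton_eq_iff)
  qed
  have \<phi>mix: "\<phi> v (mix S x z) = \<phi> v x" for v x z
    unfolding \<phi>_def by (intro expect_cong arg_cong[where f = "flip v"]) (auto simp: mix_def)
  define U where "U = (\<lambda>w. \<Sum>v\<in>K. flip v w)"
  define T where "T = (\<lambda>w. \<Sum>v\<in>K. \<phi> v w)"
  have mgf: "expect M (\<lambda>w. exp (s * (\<sigma> * (U w - T w)))) \<le> exp (3 * s\<^sup>2 * (real n * p))"
  proof -
    define r where "r = s * \<sigma>"
    have r: "\<bar>r\<bar> \<le> 1" "r\<^sup>2 = s\<^sup>2" using s \<sigma> by (auto simp: r_def power_mult_distrib)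
    have "expect M (\<lambda>w. exp (r * (U w - T w)))
       = expect M (\<lambda>x. expect M (\<lambda>z. \<Prod>v\<in>K. exp (r * (flip v (mix S x z) - \<phi> v x))))"
    proof -
      have "exp (r * (U w - T w)) = (\<Prod>v\<in>K. exp (r * (flip v w - \<phi> v w)))" for w
        unfolding U_def T_def sum_subtractf [symmetric] sum_distrib_left exp_sum [OF finK] by (rule refl)
      then have "expect M (\<lambda>w. exp (r * (U w - T w))) = expect M (\<lambda>w. \<Prod>v\<in>K. exp (r * (flip v w - \<phi> v w)))"
        by simp
      also have "\<dots> = expect M (\<lambda>x. expect M (\<lambda>z. \<Prod>v\<in>K. exp (r * (flip v (mix S x z) - \<phi> v (mix S x z)))))"
        by (rule expect_resample)
      finally show ?thesis by (simp only: \<phi>mix)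
    qed
    also have "\<dots> \<le> expect M (\<lambda>x. exp (3 * s\<^sup>2 * (real n * p)))"
    proof (rule expect_mono [OF finite_support])
      fix x
      have one: "expect M (\<lambda>z. exp (r * (flip v (mix S x z) - \<phi> v x))) \<le> exp (3 * s\<^sup>2 * p)" if "v \<in> K" for v
      proof -
        have "expect M (\<lambda>z. exp (r * (flip v (mix S x z) - \<phi> v x)))
          = expect M (\<lambda>z. exp (- r * \<phi> v x) + (exp r - 1) * exp (- r * \<phi> v x) * flip v (mix S x z))"
        proof (rule expect_cong)
          fix z
          have "exp (r * (1 - \<phi> v x)) = exp r * exp (- r * \<phi> v x)"
            by (simp add: exp_add [symmetric] algebra_simps)
          then show "exp (r * (flip v (mix S x z) - \<phi> v x))
             = exp (- r * \<phi> v x) + (exp r - 1) * exp (- r * \<phi> v x) * flip v (mix S x z)"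
            by (cases "agreeing v (mix S x z) < disagreeing v (mix S x z)") (simp_all add: flip_def algebra_simps)
        qed
        also have "\<dots> = exp (- r * \<phi> v x) + (exp r - 1) * exp (- r * \<phi> v x) * \<phi> v x"
          by (subst expect_add [OF finite_support]) (simp add: \<phi>_def)
        also have "\<dots> = exp (- r * \<phi> v x) * (1 + (exp r - 1) * \<phi> v x)" by (simp add: algebra_simps)
        also have "\<dots> \<le> exp (- r * \<phi> v x) * exp ((exp r - 1) * \<phi> v x)"
          by (intro mult_left_mono exp_ge_add_one_self) auto
        also have "\<dots> = exp ((exp r - 1 - r) * \<phi> v x)" by (simp add: exp_add [symmetric] algebra_simps)
        also have "\<dots> \<le> exp (r\<^sup>2 * \<phi> v x)"
        proof -
          have "exp r \<le> 1 + r + r\<^sup>2" using r by (intro exp_le_quadratic) simp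
          then show ?thesis using \<phi>0[of v x] by (simp add: mult_right_mono)
        qed
        also have "\<dots> \<le> exp (3 * s\<^sup>2 * p)"
          using mult_left_mono [OF \<phi>_le [OF that, of x], of "s\<^sup>2"] r by simp
        finally show ?thesis .
      qed
      have "expect M (\<lambda>z. \<Prod>v\<in>K. exp (r * (flip v (mix S x z) - \<phi> v x)))
          = (\<Prod>v\<in>K. expect M (\<lambda>z. exp (r * (flip v (mix S x z) - \<phi> v x))))"
        using indep [of K "\<lambda>v t. exp (r * (t - \<phi> v x))" x] by simp
      also have "\<dots> \<le> (\<Prod>v\<in>K. exp (3 * s\<^sup>2 * p))"
        by (intro prod_mono) (use one in auto)
      also have "\<dots> = exp (3 * s\<^sup>2 * (real n * p))"
        by (simp add: n_def exp_of_nat_mult [symmetric] mult_ac)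
      finally show "expect M (\<lambda>z. \<Prod>v\<in>K. exp (r * (flip v (mix S x z) - \<phi> v x))) \<le> exp (3 * s\<^sup>2 * (real n * p))" .
    qed
    finally show ?thesis by (simp add: r_def mult_ac)
  qed
  have var: "expect M (\<lambda>w. (T w - real n * p)\<^sup>2) \<le> 9 * real n * p\<^sup>2 + 2 * \<alpha> * (real n * p)\<^sup>2"
  proof -
    have E\<phi>: "expect M (\<phi> v) = p" if "v \<in> K" for v
      using expect_resample [of "flip v" S] p [OF that] by (simp add: \<phi>_def)
    \<comment> \<open>conditional independence turns the covariances of \<open>\<phi>\<close> into those of the flips\<close>
    have E\<phi>\<phi>: "expect M (\<lambda>w. \<phi> u w * \<phi> v w) = expect M (\<lambda>w. flip u w * flip v w)"
      if "u \<in> K" "v \<in> K" "u \<noteq> v" for u v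
    proof -
      have "expect M (\<lambda>z. flip u (mix S x z) * flip v (mix S x z)) = \<phi> u x * \<phi> v x" for x
        using indep [of "{u, v}" "\<lambda>_ t. t" x] that by (simp add: \<phi>_def)
      then show ?thesis by (subst (2) expect_resample [of _ S]) simp
    qed
    have "(T w - real n * p)\<^sup>2 = (\<Sum>u\<in>K. \<Sum>v\<in>K. (\<phi> u w - p) * (\<phi> v w - p))" for w
    proof -
      have "T w - real n * p = (\<Sum>v\<in>K. \<phi> v w - p)" by (simp add: T_def n_def sum_subtractf)
      then show ?thesis by (simp only: power2_eq_square sum_product)
    qed
    then have eq: "expect M (\<lambda>w. (T w - real n * p)\<^sup>2) = (\<Sum>u\<in>K. \<Sum>v\<in>K. expect M (\<lambda>w. (\<phi> u w - p) * (\<phi> v w - p)))"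
      by (simp only: expect_sum [OF finite_support])
    have le: "(\<Sum>u\<in>K. \<Sum>v\<in>K. expect M (\<lambda>w. (\<phi> u w - p) * (\<phi> v w - p))) \<le> (\<Sum>u\<in>K. \<Sum>v\<in>K. (if u = v then 9 * p\<^sup>2 else 0) + 2 * \<alpha> * p\<^sup>2)"
    proof (intro sum_mono)
      fix u v assume uv: "u \<in> K" "v \<in> K"
      have c: "expect M (\<lambda>w. (\<phi> u w - p) * (\<phi> v w - p)) = expect M (\<lambda>w. \<phi> u w * \<phi> v w) - p * p"
        using expect_cov [of "\<phi> u" "\<phi> v"] unfolding E\<phi> [OF uv(1)] E\<phi> [OF uv(2)] .
      show "expect M (\<lambda>w. (\<phi> u w - p) * (\<phi> v w - p)) \<le> (if u = v then 9 * p\<^sup>2 else 0) + 2 * \<alpha> * p\<^sup>2"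
      proof (cases "u = v")
        case True
        have "expect M (\<lambda>w. \<phi> v w * \<phi> v w) \<le> expect M (\<lambda>w. (3 * p) * (3 * p))"
        proof (rule expect_mono [OF finite_support])
          fix w
          have "0 \<le> 3 * p" using p0 by simp
          then show "\<phi> v w * \<phi> v w \<le> (3 * p) * (3 * p)"
            by (rule mult_mono [OF \<phi>_le [OF uv(2)] \<phi>_le [OF uv(2)] _ \<phi>0])
        qed
        then have "expect M (\<lambda>w. \<phi> v w * \<phi> v w) \<le> 9 * p\<^sup>2" by (simp add: power2_eq_square)
        moreover have "0 \<le> 2 * \<alpha> * p\<^sup>2" "0 \<le> p * p" using a by auto
        ultimately have "expect M (\<lambda>w. \<phi> v w * \<phi> v w) - p * p \<le> 9 * p\<^sup>2 + 2 * \<alpha> * p\<^sup>2"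
          by linarith
        then show ?thesis unfolding c unfolding True by simp
      next
        case False
        have "expect M (\<lambda>w. flip u w * flip v w) - expect M (flip u) * expect M (flip v)
           \<le> 2 * \<alpha> * (expect M (flip u) * expect M (flip v))"
          by (rule cov_flip_same [OF subsetD [OF K(1) uv(1)] subsetD [OF K(1) uv(2)] False K(2) [OF uv]])
        then have "expect M (\<lambda>w. \<phi> u w * \<phi> v w) - p * p \<le> 2 * \<alpha> * (p * p)"
          unfolding E\<phi>\<phi> [OF uv False] p [OF uv(1)] p [OF uv(2)] .
        then show ?thesis unfolding c using False by (simp add: power2_eq_square)
      qed
    qed
    have "(\<Sum>u\<in>K. \<Sum>v\<in>K. (if u = v then 9 * p\<^sup>2 else 0) + 2 * \<alpha> * p\<^sup>2) = 9 * real n * p\<^sup>2 + 2 * \<alpha> * (real n * p)\<^sup>2"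
    proof -
      have "(\<Sum>v\<in>K. (if u = v then 9 * p\<^sup>2 else 0) + 2 * \<alpha> * p\<^sup>2) = 9 * p\<^sup>2 + real n * (2 * \<alpha> * p\<^sup>2)"
        if "u \<in> K" for u
        using that unfolding sum.distrib sum.delta' [OF finK] n_def by simp
      then have "(\<Sum>u\<in>K. \<Sum>v\<in>K. (if u = v then 9 * p\<^sup>2 else 0) + 2 * \<alpha> * p\<^sup>2)
         = (\<Sum>u\<in>K. 9 * p\<^sup>2 + real n * (2 * \<alpha> * p\<^sup>2))"
        by (rule sum.cong [OF refl])
      then show ?thesis unfolding n_def by (simp add: power2_eq_square algebra_simps)
    qed
    with eq le show ?thesis by linarith
  qed
  have c1: "measure_pmf.prob M {w. \<sigma> * (U w - real n * p) \<ge> \<tau>}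
     \<le> measure_pmf.prob M ({w. \<sigma> * (U w - T w) \<ge> \<tau> / 2} \<union> {w. \<bar>T w - real n * p\<bar> \<ge> \<tau> / 2})"
  proof (rule measure_pmf.finite_measure_mono)
    have "\<sigma> * (U w - T w) \<ge> \<tau> / 2" if "\<sigma> * (U w - real n * p) \<ge> \<tau>" "\<not> \<bar>T w - real n * p\<bar> \<ge> \<tau> / 2" for w
    proof -
      have t: "T w - real n * p < \<tau> / 2" "- (T w - real n * p) < \<tau> / 2"
        using that(2) by linarith+
      from \<sigma> show ?thesis
      proof
        assume "\<sigma> = 1"
        then show ?thesis using that(1) t by simp
      next
        assume "\<sigma> = -1"
        then show ?thesis using that(1) t by simp
      qed
    qed
    then show "{w. \<sigma> * (U w - real n * p) \<ge> \<tau>} \<subseteq> {w. \<sigma> * (U w - T w) \<ge> \<tau> / 2} \<union> {w. \<bar>T w - real n * p\<bar> \<ge> \<tau> / 2}"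
      by blast
  qed simp
  have c2: "measure_pmf.prob M ({w. \<sigma> * (U w - T w) \<ge> \<tau> / 2} \<union> {w. \<bar>T w - real n * p\<bar> \<ge> \<tau> / 2})
     \<le> measure_pmf.prob M {w. \<sigma> * (U w - T w) \<ge> \<tau> / 2} + measure_pmf.prob M {w. \<bar>T w - real n * p\<bar> \<ge> \<tau> / 2}"
    by (rule measure_Un_le) auto
  have "measure_pmf.prob M {w. \<sigma> * (U w - T w) \<ge> \<tau> / 2}
      \<le> expect M (\<lambda>w. exp (s * (\<sigma> * (U w - T w)))) * exp (- s * (\<tau> / 2))"
    by (rule prob_exp_markov [OF finite_support s(1)])
  moreover have "expect M (\<lambda>w. exp (s * (\<sigma> * (U w - T w)))) * exp (- s * (\<tau> / 2))
      \<le> exp (3 * s\<^sup>2 * (real n * p)) * exp (- s * (\<tau> / 2))"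
    by (rule mult_right_mono [OF mgf]) simp
  ultimately have c3: "measure_pmf.prob M {w. \<sigma> * (U w - T w) \<ge> \<tau> / 2}
      \<le> exp (3 * s\<^sup>2 * (real n * p) - s * (\<tau> / 2))"
    by (simp flip: exp_add)
  have "measure_pmf.prob M {w. \<bar>T w - real n * p\<bar> \<ge> \<tau> / 2}
      \<le> expect M (\<lambda>w. (T w - real n * p)\<^sup>2) / (\<tau> / 2)\<^sup>2"
    by (rule chebyshev_sum_sq [OF finite_support]) (use \<tau> in simp)
  moreover have "expect M (\<lambda>w. (T w - real n * p)\<^sup>2) / (\<tau> / 2)\<^sup>2
      \<le> (9 * real n * p\<^sup>2 + 2 * \<alpha> * (real n * p)\<^sup>2) / (\<tau> / 2)\<^sup>2"
    by (rule divide_right_mono [OF var]) simp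
  ultimately have c4: "measure_pmf.prob M {w. \<bar>T w - real n * p\<bar> \<ge> \<tau> / 2}
      \<le> 4 * (9 * real n * p\<^sup>2 + 2 * \<alpha> * (real n * p)\<^sup>2) / \<tau>\<^sup>2"
    by (simp add: power_divide mult.commute)
  show ?thesis
    using c1 c2 c3 c4 unfolding U_def n_def by linarith
qed

end

context coloured_graph
begin

text \<open>
  The colour classes are cut into residue classes modulo \<open>m\<close>, which are small enough for
  the block bound. The gain can only fall short by \<open>t\<close> if one of the \<open>2 m\<close> blocks deviates by
  \<open>t / (4 m)\<close>.
\<close>

lemma gain_tail:
  assumes m: "0 < (m::nat)" and blocks: "\<And>j. 2 * \<alpha> * real (card {v \<in> V. v mod m = j}) \<le> 1"
    and s: "0 \<le> s" "s \<le> 1" and t: "0 < t" and pPM: "pP \<le> pM"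
  shows "measure_pmf.prob M {w. gain w - expect M gain \<le> - t}
     \<le> 2 * real m * (exp (3 * s\<^sup>2 * (real (card V) * pM) - s * (t / (8 * real m)))
          + 64 * real m ^ 2 * (9 * real (card V) * pM\<^sup>2 + 2 * \<alpha> * (real (card V) * pM)\<^sup>2) / t\<^sup>2)"
proof -
  define K where "K = (\<lambda>c j. {v \<in> V. y v = c \<and> v mod m = j})"
  define pc where "pc = (\<lambda>c::int. if c = 1 then pP else pM)"
  define \<tau> where "\<tau> = t / (4 * real m)"
  have \<tau>: "0 < \<tau>" using t m by (simp add: \<tau>_def)
  define bound where "bound = exp (3 * s\<^sup>2 * (real (card V) * pM) - s * (\<tau> / 2))
       + 4 * (9 * real (card V) * pM\<^sup>2 + 2 * \<alpha> * (real (card V) * pM)\<^sup>2) / \<tau>\<^sup>2"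
  define X where "X = (\<lambda>c j w. (\<Sum>v\<in>K c j. flip v w) - real (card (K c j)) * pc c)"
  define B where "B = (\<lambda>c j. {w. real_of_int c * X c j w \<ge> \<tau>})"
  have EK: "expect M (flip v) = pc c" if "v \<in> K c j" "c \<in> {1, -1}" for v c j
    using that by (auto simp: K_def pc_def expect_flip_plus expect_flip_minus)
  have cardK: "card (K c j) \<le> card V" "2 * \<alpha> * real (card (K c j)) \<le> 1" for c j
  proof -
    show "card (K c j) \<le> card V" unfolding K_def by (intro card_mono finV) auto
    have "card (K c j) \<le> card {v \<in> V. v mod m = j}"
      unfolding K_def by (intro card_mono) (use finV in auto)
    then have "2 * \<alpha> * real (card (K c j)) \<le> 2 * \<alpha> * real (card {v \<in> V. v mod m = j})"
      using alpha0 by (intro mult_left_mono) auto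
    with blocks[of j] show "2 * \<alpha> * real (card (K c j)) \<le> 1" by linarith
  qed
  have pc: "0 \<le> pc c" "pc c \<le> pM" for c using pPM pP_nonneg pM_nonneg by (auto simp: pc_def)
  have one: "measure_pmf.prob M (B c j) \<le> bound" if c: "c \<in> {1, -1}" for c j
  proof -
    have np: "real (card (K c j)) * pc c \<le> real (card V) * pM"
      using cardK pc by (intro mult_mono) auto
    have np0: "0 \<le> real (card (K c j)) * pc c" using pc by simp
    have "measure_pmf.prob M (B c j)
      \<le> exp (3 * s\<^sup>2 * (real (card (K c j)) * pc c) - s * (\<tau> / 2))
       + 4 * (9 * real (card (K c j)) * (pc c)\<^sup>2 + 2 * \<alpha> * (real (card (K c j)) * pc c)\<^sup>2) / \<tau>\<^sup>2"
      unfolding B_def X_def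
    proof (rule block_tail)
      show "K c j \<subseteq> V" "\<And>u v. u \<in> K c j \<Longrightarrow> v \<in> K c j \<Longrightarrow> y u = y v" by (auto simp: K_def)
      show "real_of_int c = 1 \<or> real_of_int c = -1" using c by auto
    qed (use c EK cardK s \<tau> in auto)
    also have "\<dots> \<le> bound"
      unfolding bound_def
    proof (intro add_mono divide_right_mono mult_left_mono)
      show "exp (3 * s\<^sup>2 * (real (card (K c j)) * pc c) - s * (\<tau> / 2))
        \<le> exp (3 * s\<^sup>2 * (real (card V) * pM) - s * (\<tau> / 2))"
        using mult_left_mono [OF np, of "3 * s\<^sup>2"] by simp
      show "9 * real (card (K c j)) * (pc c)\<^sup>2 \<le> 9 * real (card V) * pM\<^sup>2"
        using cardK pc by (intro mult_mono power_mono) auto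
      show "(real (card (K c j)) * pc c)\<^sup>2 \<le> (real (card V) * pM)\<^sup>2"
        using np np0 by (intro power_mono)
    qed (use alpha0 in auto)
    finally show ?thesis .
  qed
  have gain_X: "gain w - expect M gain = 2 * (\<Sum>j<m. X (-1) j w) - 2 * (\<Sum>j<m. X 1 j w)" for w
  proof -
    have fl: "(\<Sum>v\<in>V. real_of_int (y v) * h v) = (\<Sum>j<m. \<Sum>v\<in>K 1 j. h v) - (\<Sum>j<m. \<Sum>v\<in>K (-1) j. h v)" for h :: "nat \<Rightarrow> real"
    proof -
      have part: "(\<Sum>v | v \<in> V \<and> y v = c. h v) = (\<Sum>j<m. \<Sum>v\<in>K c j. h v)" for c
      proof -
        have "{v. v \<in> V \<and> y v = c} = (\<Union>j<m. K c j)" using m by (auto simp: K_def)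
        then show ?thesis
          using sum.UNION_disjoint [of "{..<m}" "K c" h] finV by (auto simp: K_def)
      qed
      show ?thesis by (simp add: sum_by_colour part [symmetric] sum_negf)
    qed
    have "gain w - expect M gain = - 2 * (\<Sum>v\<in>V. real_of_int (y v) * (flip v w - expect M (flip v)))"
    proof -
      have "expect M gain = - 2 * (\<Sum>v\<in>V. real_of_int (y v) * expect M (flip v))"
        unfolding gain_def by (simp add: expect_sum [OF finite_support])
      then show ?thesis by (simp add: gain_def right_diff_distrib sum_subtractf)
    qed
    moreover have "(\<Sum>v\<in>K c j. flip v w - expect M (flip v)) = X c j w" if "c \<in> {1, -1}" for c j
      using EK that by (simp add: X_def sum_subtractf)
    ultimately show ?thesis by (simp add: fl)
  qed
  have sub: "{w. gain w - expect M gain \<le> - t} \<subseteq> (\<Union>j<m. B (-1) j) \<union> (\<Union>j<m. B 1 j)"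
  proof (rule subsetI, rule ccontr)
    fix w assume w: "w \<in> {w. gain w - expect M gain \<le> - t}" "w \<notin> (\<Union>j<m. B (-1) j) \<union> (\<Union>j<m. B 1 j)"
    then have lo: "- \<tau> < X (-1) j w" "X 1 j w < \<tau>" if "j < m" for j
    proof -
      have "- X (-1) j w < \<tau>" "X 1 j w < \<tau>" using w(2) that by (auto simp: B_def not_le)
      then show "- \<tau> < X (-1) j w" "X 1 j w < \<tau>" by linarith+
    qed
    have "(\<Sum>j<m. - \<tau>) < (\<Sum>j<m. X (-1) j w)" by (rule sum_strict_mono) (use lo m in auto)
    moreover have "(\<Sum>j<m. X 1 j w) < (\<Sum>j<m. \<tau>)" by (rule sum_strict_mono) (use lo m in auto)
    moreover have "real m * \<tau> = t / 4" using m by (simp add: \<tau>_def)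
    ultimately have "gain w - expect M gain > - t" unfolding gain_X by simp
    with w show False by simp
  qed
  have "measure_pmf.prob M {w. gain w - expect M gain \<le> - t}
      \<le> measure_pmf.prob M ((\<Union>j<m. B (-1) j) \<union> (\<Union>j<m. B 1 j))"
    by (rule measure_pmf.finite_measure_mono [OF sub]) simp
  moreover have "measure_pmf.prob M ((\<Union>j<m. B (-1) j) \<union> (\<Union>j<m. B 1 j))
      \<le> measure_pmf.prob M (\<Union>j<m. B (-1) j) + measure_pmf.prob M (\<Union>j<m. B 1 j)"
    by (rule measure_Un_le) auto
  moreover
  have "measure_pmf.prob M (\<Union>j<m. B c j) \<le> real m * bound" if "c \<in> {1, -1}" for c
  proof -
    have "measure_pmf.prob M (\<Union>j<m. B c j) \<le> (\<Sum>j<m. measure_pmf.prob M (B c j))"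
      by (rule measure_UNION_le) auto
    moreover have "(\<Sum>j<m. measure_pmf.prob M (B c j)) \<le> (\<Sum>j<m. bound)"
      by (rule sum_mono) (use one that in auto)
    ultimately show ?thesis by simp
  qed
  note c = this
  have "measure_pmf.prob M (\<Union>j<m. B (-1) j) \<le> real m * bound"
    "measure_pmf.prob M (\<Union>j<m. B 1 j) \<le> real m * bound"
    by (rule c, simp)+
  ultimately have "measure_pmf.prob M {w. gain w - expect M gain \<le> - t} \<le> 2 * real m * bound"
    by linarith
  also have "bound = exp (3 * s\<^sup>2 * (real (card V) * pM) - s * (t / (8 * real m)))
          + 64 * real m ^ 2 * (9 * real (card V) * pM\<^sup>2 + 2 * \<alpha> * (real (card V) * pM)\<^sup>2) / t\<^sup>2"
    using t m by (simp add: bound_def \<tau>_def power_divide power_mult_distrib)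
  finally show ?thesis .
qed

end

section \<open>Potentials\<close>

lemma inverse_second_order:
  fixes T d :: real
  assumes "T \<noteq> 0" "T + d \<noteq> 0"
  shows "1 / (T + d) = 1 / T - d / T\<^sup>2 + d\<^sup>2 / (T\<^sup>2 * (T + d))"
proof -
  have "1 / T - d / T\<^sup>2 + d\<^sup>2 / (T\<^sup>2 * (T + d)) = ((T - d) * (T + d) + d\<^sup>2) / (T\<^sup>2 * (T + d))"
    using assms by (simp add: add_divide_distrib diff_divide_distrib left_diff_distrib power2_eq_square)
  also have "(T - d) * (T + d) + d\<^sup>2 = T\<^sup>2" by (simp add: algebra_simps power2_eq_square)
  finally show ?thesis using assms by simp
qed

text \<open>
  The reciprocal of the advantage, floored at \<open>L\<close>, decreases on average by half of the relative
  drift as soon as the variance is at most a small multiple of \<open>L\<close> times the drift. The random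
  gain is first replaced by the lower bound \<open>m\<close> of its mean plus the centred part: the potential is
  monotone, so this is allowed, and it covers rounds with a drift much larger than \<open>m\<close>.
\<close>

lemma reciprocal_potential:
  fixes G :: "'a \<Rightarrow> real"
  assumes fin: "finite (set_pmf M)" and L: "0 < L" "L \<le> T"
    and m: "m \<le> expect M G" "0 < m" "m \<le> T / 16"
    and V: "expect M (\<lambda>x. (G x - expect M G)\<^sup>2) \<le> V" "V \<le> L * m / 40"
  shows "expect M (\<lambda>x. 1 / max (T + G x) L) \<le> 1 / T * (1 - m / (2 * T))"
proof -
  define Z where "Z = (\<lambda>x. G x - expect M G)"
  have T: "0 < T" using L by simp
  have EZ: "expect M Z = 0" unfolding Z_def by (simp add: expect_diff [OF fin])
  have EZ2: "expect M (\<lambda>x. (Z x)\<^sup>2) \<le> V" using V by (simp add: Z_def)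
  have point: "1 / max (T + G x) L \<le> (1 / T - m / T\<^sup>2 + 2 * m\<^sup>2 / T ^ 3)
      + (4 * m / T ^ 3 - 1 / T\<^sup>2) * Z x + (2 / T ^ 3 + 4 / (L * T\<^sup>2)) * (Z x)\<^sup>2" for x
  proof -
    define d where "d = m + Z x"
    \<comment> \<open>a second order Taylor bound in \<open>d\<close>, plus a Chebyshev term for \<open>d < - T / 2\<close>\<close>
    have rhs: "(1 / T - m / T\<^sup>2 + 2 * m\<^sup>2 / T ^ 3)
      + (4 * m / T ^ 3 - 1 / T\<^sup>2) * Z x + (2 / T ^ 3 + 4 / (L * T\<^sup>2)) * (Z x)\<^sup>2
      = 1 / T - d / T\<^sup>2 + 2 * d\<^sup>2 / T ^ 3 + 4 * (Z x)\<^sup>2 / (L * T\<^sup>2)"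
      using T L unfolding d_def by (simp add: field_simps power2_eq_square power3_eq_cube)
    have dG: "T + d \<le> T + G x" using m by (simp add: d_def Z_def)
    show ?thesis
    proof (cases "- T / 2 \<le> d")
      case True
      then have Td: "0 < T + d" using T by simp
      have "1 / max (T + G x) L \<le> 1 / (T + d)" using Td dG by (intro divide_left_mono) auto
      also have "1 / (T + d) \<le> 1 / T - d / T\<^sup>2 + 2 * d\<^sup>2 / T ^ 3"
      proof -
        have "1 / (T + d) = 1 / T - d / T\<^sup>2 + d\<^sup>2 / (T\<^sup>2 * (T + d))"
          using T Td by (intro inverse_second_order) auto
        also have "d\<^sup>2 / (T\<^sup>2 * (T + d)) \<le> d\<^sup>2 / (T\<^sup>2 * (T / 2))"
          using True T Td by (intro divide_left_mono mult_left_mono) auto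
        finally show ?thesis by (simp add: power2_eq_square power3_eq_cube mult_ac)
      qed
      also have "\<dots> \<le> 1 / T - d / T\<^sup>2 + 2 * d\<^sup>2 / T ^ 3 + 4 * (Z x)\<^sup>2 / (L * T\<^sup>2)"
        using L T by simp
      finally show ?thesis unfolding rhs .
    next
      case False
      then have "T / 2 \<le> - Z x" "d < 0" using m T by (auto simp: d_def)
      then have "(T / 2)\<^sup>2 \<le> (- Z x)\<^sup>2" using T by (intro power_mono) auto
      then have "T\<^sup>2 \<le> 4 * (Z x)\<^sup>2" by (simp add: power_divide)
      then have "1 / L \<le> 4 * (Z x)\<^sup>2 / (L * T\<^sup>2)" using L T by (simp add: field_simps)
      moreover have "1 / max (T + G x) L \<le> 1 / L" using L by (intro divide_left_mono) auto
      moreover have "0 \<le> 1 / T - d / T\<^sup>2 + 2 * d\<^sup>2 / T ^ 3"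
      proof -
        have "d / T\<^sup>2 \<le> 0" "0 \<le> 1 / T" "0 \<le> 2 * d\<^sup>2 / T ^ 3"
          using T \<open>d < 0\<close> by (auto simp: divide_nonpos_nonneg)
        then show ?thesis by linarith
      qed
      ultimately show ?thesis unfolding rhs by linarith
    qed
  qed
  let ?A = "1 / T - m / T\<^sup>2 + 2 * m\<^sup>2 / T ^ 3" and ?B = "4 * m / T ^ 3 - 1 / T\<^sup>2"
    and ?C = "2 / T ^ 3 + 4 / (L * T\<^sup>2)"
  have "expect M (\<lambda>x. 1 / max (T + G x) L) \<le> expect M (\<lambda>x. ?A + ?B * Z x + ?C * (Z x)\<^sup>2)"
    by (rule expect_mono [OF fin]) (rule point)
  also have "\<dots> = ?A + ?C * expect M (\<lambda>x. (Z x)\<^sup>2)"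
    by (simp only: expect_add [OF fin] integral_mult_right_zero EZ expect_const)
  also have "\<dots> \<le> ?A + ?C * (L * m / 40)"
    using EZ2 V L T by (intro add_left_mono mult_left_mono) auto
  also have "\<dots> \<le> 1 / T * (1 - m / (2 * T))"
  proof -
    have "m\<^sup>2 \<le> m * (T / 16)" using m by (simp add: power2_eq_square)
    then have 1: "2 * m\<^sup>2 / T ^ 3 \<le> (1 / 8) * (m / T\<^sup>2)"
      using T by (simp add: field_simps power2_eq_square power3_eq_cube)
    have "L * m \<le> T * m" using L m by simp
    then have 2: "2 / T ^ 3 * (L * m / 40) \<le> (1 / 20) * (m / T\<^sup>2)"
      using T by (simp add: field_simps power2_eq_square power3_eq_cube)
    have 3: "4 / (L * T\<^sup>2) * (L * m / 40) = (1 / 10) * (m / T\<^sup>2)" using L by simp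
    have 4: "0 \<le> m / T\<^sup>2" using m by simp
    have 5: "1 / T * (1 - m / (2 * T)) = 1 / T - (1 / 2) * (m / T\<^sup>2)"
      using T by (simp add: field_simps power2_eq_square)
    have sum: "t - x + A + (B + C) \<le> t - (1 / 2) * x"
      if "A \<le> (1 / 8) * x" "B \<le> (1 / 20) * x" "C = (1 / 10) * x" "0 \<le> x" for A B C x t :: real
      using that by linarith
    show ?thesis unfolding 5 distrib_right by (rule sum [OF 1 2 3 4])
  qed
  finally show ?thesis .
qed

text \<open>
  A potential that falls from \<open>1\<close> at the floor \<open>L\<close> to \<open>exp (- K / 2)\<close> at \<open>2 L\<close> and is a
  supermartingale when \<open>K\<close> is at most of the order of \<open>T\<close> times drift over variance. It is bounded
  below by \<open>exp (- K)\<close>, so an event on which the Taylor expansion fails costs at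
  most a factor \<open>exp K\<close>, and a polynomially small probability \<open>\<rho>\<close> of such an event suffices.
\<close>

lemma exponential_potential:
  fixes G :: "'a \<Rightarrow> real"
  assumes fin: "finite (set_pmf M)" and L: "0 < L" "L \<le> T" and K: "1 \<le> K"
    and m: "m \<le> expect M G" "0 < m" "24 * K * m \<le> T"
    and V: "expect M (\<lambda>x. (G x - expect M G)\<^sup>2) \<le> V" "24 * K * V \<le> T * m"
    and \<rho>: "measure_pmf.prob M {x. G x - expect M G \<le> - T / (4 * K)} \<le> \<rho>"
      "exp K * \<rho> \<le> K * L * m / (4 * T\<^sup>2)"
  shows "expect M (\<lambda>x. exp (K * (L / max (T + G x) L - 1))) \<le> exp (K * (L / T - 1))"
proof -
  define Z where "Z = (\<lambda>x. G x - expect M G)"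
  have T: "0 < T" using L by simp
  have EZ: "expect M Z = 0" unfolding Z_def by (simp add: expect_diff [OF fin])
  have EZ2: "expect M (\<lambda>x. (Z x)\<^sup>2) \<le> V" using V by (simp add: Z_def)
  let ?c = "6 * K\<^sup>2 * L / T ^ 3" and ?h = "K * L / T\<^sup>2"
  have c0: "0 \<le> ?c" "0 \<le> ?h" using K L T by auto
  let ?q = "\<lambda>d. 1 - ?h * d + ?c * d\<^sup>2"
  have point: "exp (K * (L / max (T + G x) L - 1))
     \<le> exp (K * (L / T - 1)) * (?q (m + Z x) + exp K * of_bool (Z x \<le> - T / (4 * K)))" for x
  proof -
    define d where "d = m + Z x"
    have dG: "T + d \<le> T + G x" using m by (simp add: d_def Z_def)
    have q0: "0 \<le> ?q d" if "d \<le> 0"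
    proof -
      have "?h * d \<le> 0" by (rule mult_nonneg_nonpos [OF c0(2) that])
      moreover have "0 \<le> ?c * d\<^sup>2" by (rule mult_nonneg_nonneg [OF c0(1)]) simp
      ultimately show ?thesis by linarith
    qed
    show ?thesis
    proof (cases "- T / (4 * K) \<le> d")
      case True
      have "T / (4 * K) \<le> T / 2" using K T by (intro divide_left_mono) auto
      then have Td: "T / 2 \<le> T + d" using True by simp
      then have Td0: "0 < T + d" using T by simp
      define x' where "x' = K * L * (1 / (T + d) - 1 / T)"
      have x1: "x' \<le> 1"
      proof (cases "0 \<le> d")
        case True
        then have "1 / (T + d) \<le> 1 / T" using T by (intro divide_left_mono) auto
        then have "x' \<le> 0" unfolding x'_def using K L by (intro mult_nonneg_nonpos) auto
        then show ?thesis by simp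
      next
        case False
        have "1 / (T + d) - 1 / T = - d / (T * (T + d))" using T Td0 by (simp add: field_simps)
        also have "\<dots> \<le> (T / (4 * K)) / (T * (T / 2))"
          using True False T Td Td0 by (intro frac_le mult_left_mono) auto
        also have "\<dots> = 1 / (2 * K * T)" using T K by (simp add: field_simps)
        finally have "x' \<le> K * L * (1 / (2 * K * T))"
          unfolding x'_def using K L by (intro mult_left_mono) auto
        also have "\<dots> \<le> 1" using K L T by (simp add: field_simps)
        finally show ?thesis .
      qed
      have "exp x' \<le> 1 + x' + x'\<^sup>2" by (rule exp_le_quadratic [OF x1])
      also have "\<dots> \<le> ?q d"
      proof -
        have e: "1 / (T + d) - 1 / T = - d / T\<^sup>2 + d\<^sup>2 / (T\<^sup>2 * (T + d))"
          using T Td0 inverse_second_order[of T d] by simp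
        have "d\<^sup>2 / (T\<^sup>2 * (T + d)) \<le> d\<^sup>2 / (T\<^sup>2 * (T / 2))"
          using T Td Td0 by (intro divide_left_mono mult_left_mono) auto
        then have "1 / (T + d) - 1 / T \<le> - d / T\<^sup>2 + 2 * d\<^sup>2 / T ^ 3"
          unfolding e by (simp add: power2_eq_square power3_eq_cube mult_ac)
        then have "x' \<le> K * L * (- d / T\<^sup>2 + 2 * d\<^sup>2 / T ^ 3)"
          unfolding x'_def using K L by (intro mult_left_mono) auto
        then have l1: "x' \<le> - (?h * d) + 2 * K * L / T ^ 3 * d\<^sup>2" by (simp add: algebra_simps)
        have "x'\<^sup>2 = (K * L)\<^sup>2 * d\<^sup>2 / (T * (T + d))\<^sup>2"
          unfolding x'_def using T Td0 by (simp add: field_simps power2_eq_square)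
        also have "\<dots> \<le> (K * L)\<^sup>2 * d\<^sup>2 / (T * (T / 2))\<^sup>2"
          using T Td Td0 by (intro divide_left_mono power_mono mult_left_mono) auto
        also have "\<dots> = 4 * K\<^sup>2 * L / T ^ 3 * d\<^sup>2 * (L / T)"
          using T by (simp add: field_simps power2_eq_square power3_eq_cube)
        also have "\<dots> \<le> 4 * K\<^sup>2 * L / T ^ 3 * d\<^sup>2 * 1"
          using L T K by (intro mult_left_mono) auto
        finally have l2: "x'\<^sup>2 \<le> 4 * K\<^sup>2 * L / T ^ 3 * d\<^sup>2" by simp
        have l3: "2 * K * L / T ^ 3 * d\<^sup>2 \<le> 2 * K\<^sup>2 * L / T ^ 3 * d\<^sup>2"
          using K L T by (intro mult_right_mono divide_right_mono) (auto simp: power2_eq_square)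
        have l4: "?c * d\<^sup>2 = 2 * K\<^sup>2 * L / T ^ 3 * d\<^sup>2 + 4 * K\<^sup>2 * L / T ^ 3 * d\<^sup>2"
          by (simp add: field_simps)
        have sum: "1 + x' + x2 \<le> 1 - h + c"
          if "x' \<le> - h + A" "x2 \<le> B" "A \<le> A'" "c = A' + B" for h x2 A A' B c :: real
          using that by linarith
        show ?thesis by (rule sum [OF l1 l2 l3 l4])
      qed
      finally have ex: "exp x' \<le> ?q d" .
      have "L / max (T + G x) L \<le> L / (T + d)"
        using L Td0 dG by (intro divide_left_mono) auto
      then have "K * (L / max (T + G x) L - 1) \<le> K * (L / T - 1) + x'"
        using K mult_left_mono[of "L / max (T + G x) L" "L / (T + d)" K] by (simp add: x'_def algebra_simps)
      then have "exp (K * (L / max (T + G x) L - 1)) \<le> exp (K * (L / T - 1)) * exp x'"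
        by (simp flip: exp_add)
      also have "\<dots> \<le> exp (K * (L / T - 1)) * (?q d + exp K * of_bool (Z x \<le> - T / (4 * K)))"
        using ex by (intro mult_left_mono) (auto intro: add_increasing2)
      finally show ?thesis by (simp add: d_def)
    next
      case False
      then have Z: "Z x \<le> - T / (4 * K)" "d \<le> 0" using m T K
        by (auto simp: d_def not_le intro: order_trans[of _ "- T / (4 * K)"] divide_nonpos_pos less_imp_le)
      have "L / max (T + G x) L \<le> 1" using L by (simp add: pos_divide_le_eq less_max_iff_disj)
      then have "K * (L / max (T + G x) L - 1) \<le> 0" using K by (intro mult_nonneg_nonpos) auto
      then have "exp (K * (L / max (T + G x) L - 1)) \<le> 1" by simp
      also have "1 \<le> exp (K * (L / T - 1)) * exp K"
        using K L T by (simp add: exp_add [symmetric] algebra_simps)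
      also have "\<dots> \<le> exp (K * (L / T - 1)) * (?q d + exp K * of_bool (Z x \<le> - T / (4 * K)))"
        using q0 Z by (intro mult_left_mono) auto
      finally show ?thesis by (simp add: d_def)
    qed
  qed
  let ?e = "exp (K * (L / T - 1))"
  let ?p = "measure_pmf.prob M {x. Z x \<le> - T / (4 * K)}"
  have "expect M (\<lambda>x. exp (K * (L / max (T + G x) L - 1)))
     \<le> expect M (\<lambda>x. ?e * ((1 - ?h * m + ?c * m\<^sup>2) + (2 * ?c * m - ?h) * Z x + ?c * (Z x)\<^sup>2
           + exp K * of_bool (Z x \<le> - T / (4 * K))))"
  proof (rule expect_mono [OF fin])
    fix x
    have "?q (m + Z x) = (1 - ?h * m + ?c * m\<^sup>2) + (2 * ?c * m - ?h) * Z x + ?c * (Z x)\<^sup>2"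
      by algebra
    note q = this
    show "exp (K * (L / max (T + G x) L - 1)) \<le> ?e * ((1 - ?h * m + ?c * m\<^sup>2)
        + (2 * ?c * m - ?h) * Z x + ?c * (Z x)\<^sup>2 + exp K * of_bool (Z x \<le> - T / (4 * K)))"
      using point[of x] unfolding q .
  qed
  also have "\<dots> = ?e * ((1 - ?h * m + ?c * m\<^sup>2) + ?c * expect M (\<lambda>x. (Z x)\<^sup>2) + exp K * ?p)"
    by (simp only: expect_add [OF fin] integral_mult_right_zero EZ expect_const prob_eq_expect) simp
  also have "\<dots> \<le> ?e * 1"
  proof (rule mult_left_mono)
    have hm: "?h * m = K * L * m / T\<^sup>2" by simp
    have "24 * K * m * (K * L * m / T ^ 3) \<le> T * (K * L * m / T ^ 3)"
      using m K L T by (intro mult_right_mono) auto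
    then have 1: "?c * m\<^sup>2 \<le> ?h * m / 4"
      using T by (simp add: field_simps power2_eq_square power3_eq_cube)
    have "?c * expect M (\<lambda>x. (Z x)\<^sup>2) \<le> ?c * V" by (rule mult_left_mono [OF EZ2 c0(1)])
    moreover have "24 * K * V * (K * L / T ^ 3) \<le> T * m * (K * L / T ^ 3)"
      using V K L T by (intro mult_right_mono) auto
    then have "?c * V \<le> ?h * m / 4"
      using T by (simp add: field_simps power2_eq_square power3_eq_cube)
    ultimately have 2: "?c * expect M (\<lambda>x. (Z x)\<^sup>2) \<le> ?h * m / 4" by linarith
    have "exp K * ?p \<le> exp K * \<rho>" using \<rho> by (intro mult_left_mono) (auto simp: Z_def)
    also have "\<dots> \<le> ?h * m / 4" using \<rho> by simp
    finally have 3: "exp K * ?p \<le> ?h * m / 4" .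
    have 4: "0 \<le> ?h * m" by (rule mult_nonneg_nonneg [OF c0(2)]) (use m in simp)
    show "(1 - ?h * m + ?c * m\<^sup>2) + ?c * expect M (\<lambda>x. (Z x)\<^sup>2) + exp K * ?p \<le> 1"
    proof -
      have "1 - x + A + B + C \<le> 1" if "A \<le> x / 4" "B \<le> x / 4" "C \<le> x / 4" "0 \<le> x" for A B C x :: real
        using that by linarith
      then show ?thesis using 1 2 3 4 by blast
    qed
  qed simp
  finally show ?thesis by simp
qed

section \<open>The round as a random graph\<close>

lemma coloured_graph_vertices:
  assumes "is_configuration N y" "0 \<le> b" "b \<le> a" "1 \<le> N" "edge_prob a N \<le> 1 / 2"
  shows "coloured_graph (vertices N) y (edge_prob a N) (edge_prob b N)"
proof
  have "0 \<le> ln (real N) / real N" using assms by simp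
  then have "b * (ln (real N) / real N) \<le> a * (ln (real N) / real N)" "0 \<le> b * (ln (real N) / real N)"
    using assms mult_right_mono[of b a "ln (real N) / real N"] by auto
  then show "edge_prob b N \<le> edge_prob a N" "0 \<le> edge_prob b N" by (auto simp: edge_prob_def)
qed (use assms in \<open>auto simp: is_configuration_def vertices_def\<close>)

context
  fixes a b :: real and N :: nat and y :: configuration
  assumes cfg: "is_configuration N y"
    and cg: "coloured_graph (vertices N) y (edge_prob a N) (edge_prob b N)"
begin

interpretation coloured_graph "vertices N" y "edge_prob a N" "edge_prob b N" by (rule cg)

lemma random_graph_eq: "random_graph_pmf a b N y = map_pmf (\<lambda>w. {e \<in> vertex_pairs N. w e}) M"
proof -
  have "pairs = vertex_pairs N" by (simp add: pairs_def vertex_pairs_def)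
  then show ?thesis
    unfolding random_graph_pmf_def M_def unfolding edge_p_def [abs_def] by simp
qed

lemma nP_eq: "nP = card (blue N y)" and nM_eq: "nM = card (red N y)"
  by (simp_all add: nP_def nM_def blue_def red_def)

lemma majority_update_flip:
  assumes v: "v \<in> vertices N"
  shows "real_of_int (majority_update N {e \<in> vertex_pairs N. w e} y v) = real_of_int (y v) * (1 - 2 * flip v w)"
proof -
  let ?G = "{e \<in> vertex_pairs N. w e}"
  have nb: "{u \<in> vertices N. u \<noteq> v \<and> y u = c \<and> w {u, v}} = {u \<in> vertices N. {u, v} \<in> ?G \<and> y u = c}" for c
  proof -
    have "{u, v} \<in> vertex_pairs N \<longleftrightarrow> u \<noteq> v" if "u \<in> vertices N" for u
      using that v by (auto simp: vertex_pairs_def doubleton_eq_iff)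
    then show ?thesis by auto
  qed
  have cN: "neighbors N ?G v \<inter> blue N y = {u \<in> vertices N. {u, v} \<in> ?G \<and> y u = 1}"
    "neighbors N ?G v \<inter> red N y = {u \<in> vertices N. {u, v} \<in> ?G \<and> y u = -1}"
    by (auto simp: neighbors_def blue_def red_def)
  from cfg v consider "y v = 1" | "y v = -1" by (auto simp: is_configuration_def)
  then show ?thesis
  proof cases
    case 1
    have "{u \<in> vertices N. y u \<noteq> y v \<and> w {u, v}} = {u \<in> vertices N. u \<noteq> v \<and> y u = -1 \<and> w {u, v}}"
      using cfg 1 by (auto simp: is_configuration_def)
    then have "agreeing v w = card (neighbors N ?G v \<inter> blue N y)"
      "disagreeing v w = card (neighbors N ?G v \<inter> red N y)"
      unfolding agreeing_def disagreeing_def cN by (simp_all add: 1 nb)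
    then show ?thesis using 1 by (auto simp: majority_update_def Let_def flip_def)
  next
    case 2
    have "{u \<in> vertices N. y u \<noteq> y v \<and> w {u, v}} = {u \<in> vertices N. u \<noteq> v \<and> y u = 1 \<and> w {u, v}}"
      using cfg 2 by (auto simp: is_configuration_def)
    then have "agreeing v w = card (neighbors N ?G v \<inter> red N y)"
      "disagreeing v w = card (neighbors N ?G v \<inter> blue N y)"
      unfolding agreeing_def disagreeing_def cN by (simp_all add: 2 nb)
    then show ?thesis using 2 by (auto simp: majority_update_def Let_def flip_def)
  qed
qed

end

lemma advantage_eq_sum:
  assumes "is_configuration N y"
  shows "advantage N y = (\<Sum>v\<in>vertices N. real_of_int (y v))"
proof -
  have V: "vertices N = blue N y \<union> red N y" "blue N y \<inter> red N y = {}" "finite (blue N y)" "finite (red N y)"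
    using assms by (auto simp: blue_def red_def is_configuration_def vertices_def)
  have "(\<Sum>v\<in>vertices N. real_of_int (y v)) = (\<Sum>v\<in>blue N y. real_of_int (y v)) + (\<Sum>v\<in>red N y. real_of_int (y v))"
    unfolding V(1) using V by (intro sum.union_disjoint) auto
  moreover have "(\<Sum>v\<in>blue N y. real_of_int (y v)) = (\<Sum>v\<in>blue N y. 1)"
    by (rule sum.cong) (auto simp: blue_def)
  moreover have "(\<Sum>v\<in>red N y. real_of_int (y v)) = (\<Sum>v\<in>red N y. -1)"
    by (rule sum.cong) (auto simp: red_def)
  ultimately show ?thesis by (simp add: advantage_def)
qed

text \<open>
  Potentials that are functions of the advantage see a round only through the law of
  \<^const>\<open>coloured_graph.gain\<close>.
\<close>

lemma expect_advantage_step: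
  assumes cfg: "is_configuration N y"
    and cg: "coloured_graph (vertices N) y (edge_prob a N) (edge_prob b N)"
  shows "expect (random_graph_pmf a b N y) (\<lambda>G. F (advantage N (majority_update N G y)))
    = expect (finite_product.M (coloured_graph.pairs (vertices N)) (\<lambda>e. bernoulli_pmf (coloured_graph.edge_p y (edge_prob a N) (edge_prob b N) e)))
        (\<lambda>w. F (advantage N y + coloured_graph.gain (vertices N) y w))"
proof -
  interpret coloured_graph "vertices N" y "edge_prob a N" "edge_prob b N" by (rule cg)
  have "advantage N (majority_update N {e \<in> vertex_pairs N. w e} y) = advantage N y + gain w" for w
  proof -
    have "advantage N (majority_update N {e \<in> vertex_pairs N. w e} y)
      = (\<Sum>v\<in>vertices N. real_of_int (y v) * (1 - 2 * flip v w))"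
      unfolding advantage_eq_sum [OF majority_update_is_configuration [OF cfg]]
      by (rule sum.cong [OF refl]) (rule majority_update_flip [OF cfg cg])
    then show ?thesis
      by (simp add: advantage_eq_sum [OF cfg] gain_def sum_subtractf right_diff_distrib sum_distrib_left sum_negf mult_ac)
  qed
  then show ?thesis by (simp add: random_graph_eq [OF cfg cg])
qed

section \<open>One round away from extinction\<close>

lemma binom_weight_Suc:
  "binom_weight (Suc m) p (Suc i) = p * binom_weight m p i + (1 - p) * binom_weight m p (Suc i)"
proof -
  have eq: "real (m choose Suc i) * (1 - p) ^ (m - i) = real (m choose Suc i) * ((1 - p) * (1 - p) ^ (m - Suc i))"
  proof (cases "i < m")
    case True
    then have "m - i = Suc (m - Suc i)" by simp
    then show ?thesis by simp
  qed (simp add: binomial_eq_0)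
  have "binom_weight (Suc m) p (Suc i)
     = real (m choose i) * p ^ Suc i * (1 - p) ^ (m - i) + p ^ Suc i * (real (m choose Suc i) * (1 - p) ^ (m - i))"
    by (simp add: binom_weight_def algebra_simps)
  then show ?thesis unfolding eq by (simp add: binom_weight_def mult_ac)
qed

lemma binom_weight_0: "binom_weight (Suc m) p 0 = (1 - p) * binom_weight m p 0"
  by (simp add: binom_weight_def)

text \<open>
  Passing from \<open>m\<close> to \<open>m + 1\<close> trials adds an independent Bernoulli variable to the first count.
\<close>

lemma outvote_mono:
  assumes p: "0 \<le> p" "p \<le> 1" and r: "0 \<le> r" "r \<le> 1" and "m \<le> m'"
  shows "outvote m p n r \<le> outvote m' p n r"
  using \<open>m \<le> m'\<close>
proof (induction rule: dec_induct)
  case (step m)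
  have S: "(\<Sum>i\<le>m. f i * binom_weight m p i) \<le> (\<Sum>i\<le>Suc m. f i * binom_weight (Suc m) p i)"
    if f: "\<And>i. f i \<le> f (Suc i)" for f :: "nat \<Rightarrow> real"
  proof -
    have z: "binom_weight m p (Suc m) = 0" by (simp add: binom_weight_def)
    have "(\<Sum>i\<le>Suc m. f i * binom_weight (Suc m) p i)
       = (1 - p) * (f 0 * binom_weight m p 0) + (\<Sum>i\<le>m. p * (f (Suc i) * binom_weight m p i) + (1 - p) * (f (Suc i) * binom_weight m p (Suc i)))"
      by (subst sum.atMost_Suc_shift) (simp add: binom_weight_Suc binom_weight_0 algebra_simps)
    also have "\<dots> = p * (\<Sum>i\<le>m. f (Suc i) * binom_weight m p i)
       + (1 - p) * (f 0 * binom_weight m p 0 + (\<Sum>i\<le>m. f (Suc i) * binom_weight m p (Suc i)))"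
      by (simp add: sum.distrib sum_distrib_left distrib_left)
    also have "f 0 * binom_weight m p 0 + (\<Sum>i\<le>m. f (Suc i) * binom_weight m p (Suc i))
       = (\<Sum>i\<le>Suc m. f i * binom_weight m p i)"
      by (rule sum.atMost_Suc_shift [symmetric])
    also have "\<dots> = (\<Sum>i\<le>m. f i * binom_weight m p i)" by (simp add: z)
    finally have eq: "(\<Sum>i\<le>Suc m. f i * binom_weight (Suc m) p i)
      = p * (\<Sum>i\<le>m. f (Suc i) * binom_weight m p i) + (1 - p) * (\<Sum>i\<le>m. f i * binom_weight m p i)" .
    have "(\<Sum>i\<le>m. f i * binom_weight m p i) \<le> (\<Sum>i\<le>m. f (Suc i) * binom_weight m p i)"
      using f p by (intro sum_mono mult_right_mono binom_weight_nonneg) auto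
    then have "p * (\<Sum>i\<le>m. f i * binom_weight m p i) \<le> p * (\<Sum>i\<le>m. f (Suc i) * binom_weight m p i)"
      using p by (intro mult_left_mono) auto
    then show ?thesis unfolding eq by (simp add: algebra_simps)
  qed
  have swap: "outvote m p n r = (\<Sum>j\<le>n. binom_weight n r j * (\<Sum>i\<le>m. of_bool (j < i) * binom_weight m p i))" for m
    unfolding outvote_def by (subst sum.swap) (simp only: sum_distrib_left mult_ac)
  have "outvote m p n r \<le> outvote (Suc m) p n r"
    unfolding swap
    by (intro sum_mono mult_left_mono S binom_weight_nonneg r) (auto simp: of_bool_def)
  with step.IH show ?case by simp
qed simp

lemma outvote_le_1:
  assumes p: "0 \<le> p" "p \<le> 1" and r: "0 \<le> r" "r \<le> 1"
  shows "outvote m p n r \<le> 1"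
proof -
  let ?w = "\<lambda>i j. binom_weight m p i * binom_weight n r j"
  have "outvote m p n r \<le> (\<Sum>i\<le>m. \<Sum>j\<le>n. ?w i j)"
    unfolding outvote_def using p r
    by (intro sum_mono mult_left_le_one_le mult_nonneg_nonneg binom_weight_nonneg) auto
  also have "\<dots> = (\<Sum>i\<le>m. binom_weight m p i) * (\<Sum>j\<le>n. binom_weight n r j)"
    by (rule sum_product [symmetric])
  also have "\<dots> = 1" using sum_binom_weight[of m p 1] sum_binom_weight[of n r 1] by simp
  finally show ?thesis .
qed

lemma card_blue_red:
  assumes "is_configuration N y"
  shows "card (blue N y) + card (red N y) = N"
proof -
  have "vertices N = blue N y \<union> red N y" "blue N y \<inter> red N y = {}" "finite (blue N y)" "finite (red N y)"
    using assms by (auto simp: blue_def red_def is_configuration_def vertices_def)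
  then have "card (vertices N) = card (blue N y) + card (red N y)" by (simp add: card_Un_disjoint)
  then show ?thesis by (simp add: vertices_def)
qed

definition red_flip_prob :: "real \<Rightarrow> real \<Rightarrow> nat \<Rightarrow> configuration \<Rightarrow> real" where
  "red_flip_prob a b N y = outvote (card (blue N y)) (edge_prob b N) (card (red N y) - 1) (edge_prob a N)"

text \<open>
  A round in which blue is ahead and the red vertices are still a positive fraction of all vertices.
\<close>

locale round =
  fixes a b :: real and N :: nat and y :: configuration and \<delta> :: real
  assumes ab: "0 \<le> b" "b < a" and N1: "1 \<le> N" and a_half: "edge_prob a N \<le> 1 / 2"
    and cfg: "is_configuration N y"
    and lnN: "1 \<le> (a - b) * ln (real N)" "1 \<le> ln (real N)"
    and adv: "0 \<le> advantage N y" and R: "\<delta> * real N < real (card (red N y))" and \<delta>: "0 < \<delta>" "\<delta> \<le> 1 / 16"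
begin

lemma cg: "coloured_graph (vertices N) y (edge_prob a N) (edge_prob b N)"
  by (rule coloured_graph_vertices) (use cfg ab N1 a_half in auto)

sublocale coloured_graph "vertices N" y "edge_prob a N" "edge_prob b N" by (rule cg)

abbreviation "p \<equiv> red_flip_prob a b N y"
abbreviation "\<Delta> \<equiv> advantage N y"
abbreviation "\<l> \<equiv> ln (real N)"

lemma N0: "0 < real N" using N1 by simp

lemma nM_red: "nM = card (red N y)" and nP_blue: "nP = card (blue N y)"
  by (simp_all add: nP_def nM_def blue_def red_def)

lemma pM_eq: "pM = p"
  by (simp add: pM_def red_flip_prob_def nM_red nP_blue)

lemma p_range: "0 \<le> p" "p \<le> 1"
  using pM_nonneg outvote_le_1[of "edge_prob b N" "edge_prob a N"] alpha0 beta0 beta_alpha alpha_half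
  by (auto simp: pM_eq red_flip_prob_def)

lemma sizes: "1 \<le> nM" "nM \<le> nP" "real (nP - nM) = \<Delta>" "real nM \<le> real N" "\<Delta> \<le> real N" "\<delta> * real N < real nM"
proof -
  have "0 < real (card (red N y))" using R \<delta> N0 by (smt (verit) mult_nonneg_nonneg)
  then show "1 \<le> nM" by (simp add: nM_red)
  show le: "nM \<le> nP" using adv by (simp add: nM_red nP_blue advantage_def)
  then show "real (nP - nM) = \<Delta>" by (simp add: nM_red nP_blue advantage_def of_nat_diff)
  show "real nM \<le> real N" "\<Delta> \<le> real N"
    using card_blue_red [OF cfg] by (simp_all add: nM_red advantage_def)
  show "\<delta> * real N < real nM" using R by (simp add: nM_red)
qed

lemma pP_le_pM: "pP \<le> pM"
proof -
  have "real nP * pP \<le> real nM * pM" by (rule drift_gain(2)) (use sizes in auto)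
  also have "\<dots> \<le> real nP * pM" using sizes pM_nonneg by (intro mult_right_mono) auto
  finally show ?thesis using sizes by simp
qed

lemma drift:
  assumes u: "u \<le> (a - b) * \<l> * \<Delta> / real N" "0 \<le> u" "u \<le> 1"
  shows "\<delta> * real N * p * u \<le> expect M gain"
proof -
  let ?u = "(a - b) * \<l> * \<Delta> / real N"
  have e: "(edge_prob a N - edge_prob b N) * real (nP - nM) = ?u"
    using N0 by (simp add: edge_prob_def sizes field_simps)
  \<comment> \<open>on \<open>[0, 1]\<close> the relative excess \<open>1 - exp (- u)\<close> of the red flips is at least \<open>u / 2\<close>\<close>
  have "exp (- ?u) \<le> exp (- u)" using u by simp
  also have "\<dots> \<le> 1 - u / 2"
  proof -
    have "exp (- u) \<le> 1 / (1 + u)"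
      using exp_ge_add_one_self[of u] u by (simp add: exp_minus field_simps)
    also have "\<dots> \<le> 1 - u / 2"
    proof -
      have "1 \<le> (1 - u / 2) * (1 + u)"
        using u mult_left_mono[of u 1 u] by (simp add: algebra_simps)
      then show ?thesis using u by (simp add: pos_divide_le_eq)
    qed
    finally show ?thesis .
  qed
  finally have "u / 2 \<le> 1 - exp (- ?u)" by simp
  then have "2 * real nM * pM * (u / 2) \<le> 2 * real nM * pM * (1 - exp (- ?u))"
    using pM_nonneg by (intro mult_left_mono) auto
  also have "\<dots> \<le> expect M gain"
    using drift_gain(1) [OF sizes(1,2)] unfolding minus_mult_left [symmetric] e by simp
  finally have "real nM * (pM * u) \<le> expect M gain" by simp
  moreover have "\<delta> * real N * (pM * u) \<le> real nM * (pM * u)"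
    using sizes pM_nonneg u by (intro mult_right_mono) auto
  ultimately show ?thesis by (simp add: pM_eq mult_ac)
qed

lemma variance: "expect M (\<lambda>w. (gain w - expect M gain)\<^sup>2) \<le> 8 * (real N * p) * (1 + 2 * a * \<l> * p)"
proof -
  have q: "real nP * pP \<le> real nM * pM" by (rule drift_gain(2)) (use sizes in auto)
  have q0: "0 \<le> real nP * pP" "0 \<le> real nM * pM" using pP_nonneg pM_nonneg by auto
  have Np: "real nM * pM \<le> real N * p" using sizes p_range by (simp add: pM_eq mult_right_mono)
  have sq: "(real nP * pP)\<^sup>2 \<le> (real N * p)\<^sup>2" "(real nM * pM)\<^sup>2 \<le> (real N * p)\<^sup>2"
    using q q0 Np by (auto intro!: power_mono)
  have "real nM * pM + real nP * pP + 2 * edge_prob a N * ((real nM * pM)\<^sup>2 + (real nP * pP)\<^sup>2)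
     \<le> real N * p + real N * p + 2 * edge_prob a N * ((real N * p)\<^sup>2 + (real N * p)\<^sup>2)"
    using q q0 Np sq alpha0 by (intro add_mono mult_left_mono) auto
  also have "\<dots> = 2 * (real N * p) * (1 + 2 * a * \<l> * p)"
    using N0 by (simp add: edge_prob_def field_simps power2_eq_square)
  finally have "4 * (real nM * pM + real nP * pP + 2 * edge_prob a N * ((real nM * pM)\<^sup>2 + (real nP * pP)\<^sup>2))
     \<le> 4 * (2 * (real N * p) * (1 + 2 * a * \<l> * p))"
    by (rule mult_left_mono) simp
  also have "\<dots> = 8 * (real N * p) * (1 + 2 * a * \<l> * p)" by simp
  finally show ?thesis by (rule order_trans [OF variance_gain])
qed

lemma expect_step: "expect (random_graph_pmf a b N y) (\<lambda>G. F (advantage N (majority_update N G y)))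
    = expect M (\<lambda>w. F (\<Delta> + gain w))"
  by (rule expect_advantage_step [OF cfg cg])

text \<open>
  The shifted reciprocal of the advantage decreases on average as soon as its floor exceeds the
  order \<open>sqrt (N ln N)\<close>, whether flips are rare or not.
\<close>

lemma reciprocal_step_large:
  assumes s: "0 \<le> s" and L: "0 < L" "L \<le> \<Delta> - s" and p0: "0 < p0" "p0 \<le> p"
    and big: "320 * (1 + 2 * a) * \<l> * real N \<le> \<delta> * L\<^sup>2"
  shows "expect (random_graph_pmf a b N y) (\<lambda>G. 1 / max (advantage N (majority_update N G y) - s) L)
     \<le> (1 - \<delta> * p0 / 2) * (1 / (\<Delta> - s))"
proof -
  let ?T = "\<Delta> - s"
  have T: "0 < ?T" using L by simp
  have pp: "0 < p" using p0 by simp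
  have "expect M (\<lambda>w. 1 / max (?T + gain w) L) \<le> 1 / ?T * (1 - \<delta> * p * ?T / (2 * ?T))"
  proof (rule reciprocal_potential [OF finite_support L])
    have "\<delta> * real N * p * (\<Delta> / real N) \<le> expect M gain"
    proof (rule drift)
      have "1 * \<Delta> / real N \<le> (a - b) * \<l> * \<Delta> / real N"
        using lnN adv by (intro divide_right_mono mult_right_mono) auto
      then show "\<Delta> / real N \<le> (a - b) * \<l> * \<Delta> / real N" by simp
    qed (use sizes adv N0 in auto)
    moreover have "\<delta> * p * ?T \<le> \<delta> * p * \<Delta>" using s \<delta> p_range by (intro mult_left_mono) auto
    ultimately show "\<delta> * p * ?T \<le> expect M gain" using N0 by simp
    show "0 < \<delta> * p * ?T" using \<delta> pp T by simp
    have "\<delta> * p \<le> (1 / 16) * 1" using \<delta> p_range by (intro mult_mono) auto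
    from mult_right_mono [OF this, of ?T] show "\<delta> * p * ?T \<le> ?T / 16" using T by simp
    show "expect M (\<lambda>w. (gain w - expect M gain)\<^sup>2) \<le> 8 * (real N * p) * (1 + 2 * a * \<l> * p)" by (rule variance)
    have "1 + 2 * a * \<l> * p \<le> (1 + 2 * a) * \<l>"
    proof -
      have "2 * a * \<l> * p \<le> 2 * a * \<l> * 1" using ab lnN p_range by (intro mult_left_mono) auto
      then show ?thesis using lnN by (simp add: algebra_simps)
    qed
    then have "8 * (real N * p) * (1 + 2 * a * \<l> * p) \<le> 8 * (real N * p) * ((1 + 2 * a) * \<l>)"
      using p_range by (intro mult_left_mono) auto
    also have "\<dots> = (320 * (1 + 2 * a) * \<l> * real N) * p / 40" by simp
    also have "\<dots> \<le> (\<delta> * L\<^sup>2) * p / 40" using big p_range by (intro divide_right_mono mult_right_mono) auto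
    also have "\<dots> \<le> L * (\<delta> * p * ?T) / 40"
    proof -
      have "L * L * (\<delta> * p) \<le> L * ?T * (\<delta> * p)" using L \<delta> pp by (intro mult_right_mono mult_left_mono) auto
      then show ?thesis by (simp add: power2_eq_square mult_ac)
    qed
    finally show "8 * (real N * p) * (1 + 2 * a * \<l> * p) \<le> L * (\<delta> * p * ?T) / 40" .
  qed
  also have "\<dots> = (1 - \<delta> * p / 2) * (1 / ?T)"
  proof -
    have "\<delta> * p * t / (2 * t) = \<delta> * p / 2" if "0 < t" for t using that by simp
    from this [OF T] have "\<delta> * p * ?T / (2 * ?T) = \<delta> * p / 2" .
    then show ?thesis by (simp only: mult.commute)
  qed
  also have "\<dots> \<le> (1 - \<delta> * p0 / 2) * (1 / ?T)" using p0 \<delta> T by (intro mult_right_mono) auto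
  finally show ?thesis
    using expect_step [of "\<lambda>x. 1 / max (x - s) L"] by (simp add: algebra_simps)
qed

lemma small_drift:
  assumes "(a - b) * \<l> * \<Delta> \<le> real N"
  shows "\<delta> * (a - b) * \<l> * p * \<Delta> \<le> expect M gain"
proof -
  have "\<delta> * real N * p * ((a - b) * \<l> * \<Delta> / real N) \<le> expect M gain"
    by (rule drift) (use assms N0 ab lnN adv in \<open>auto simp: pos_divide_le_eq\<close>)
  then show ?thesis using N0 by (simp add: mult_ac)
qed

lemma small_variance:
  assumes "\<l> * p \<le> 1"
  shows "8 * (real N * p) * (1 + 2 * a * \<l> * p) \<le> 8 * (1 + 2 * a) * real N * p"
proof -
  have "2 * a * (\<l> * p) \<le> 2 * a * 1" using assms ab by (intro mult_left_mono) auto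
  then have "8 * (real N * p) * (1 + 2 * a * \<l> * p) \<le> 8 * (real N * p) * (1 + 2 * a)"
    using p_range by (intro mult_left_mono) (auto simp: mult_ac)
  also have "\<dots> = 8 * (1 + 2 * a) * real N * p" by (simp only: mult_ac)
  finally show ?thesis .
qed

text \<open>
  While flips are rare and the advantage is below \<open>N / ln N\<close>, the drift carries an extra factor
  \<open>ln N\<close>, so a floor of order \<open>sqrt (N / ln N)\<close> is enough.
\<close>

lemma reciprocal_step_small:
  assumes L: "0 < L" "L \<le> \<Delta>" and p0: "0 < p0" "p0 \<le> p"
    and u: "(a - b) * \<l> * \<Delta> \<le> real N" and pl: "\<l> * p \<le> 1" "(a - b) * \<l> * p \<le> 1"
    and big: "320 * (1 + 2 * a) * real N \<le> \<delta> * (a - b) * \<l> * L\<^sup>2"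
  shows "expect (random_graph_pmf a b N y) (\<lambda>G. 1 / max (advantage N (majority_update N G y)) L)
     \<le> (1 - \<delta> * p0 / 2) * (1 / \<Delta>)"
proof -
  let ?c = "\<delta> * (a - b) * \<l> * p"
  have T: "0 < \<Delta>" using L by simp
  have pp: "0 < p" using p0 by simp
  have "expect M (\<lambda>w. 1 / max (\<Delta> + gain w) L) \<le> 1 / \<Delta> * (1 - ?c * \<Delta> / (2 * \<Delta>))"
  proof (rule reciprocal_potential [OF finite_support L])
    show "?c * \<Delta> \<le> expect M gain" by (rule small_drift [OF u])
    show "0 < ?c * \<Delta>" using \<delta> ab lnN pp T by simp
    have "\<delta> * ((a - b) * \<l> * p) \<le> (1 / 16) * 1" using \<delta> pl p_range ab lnN by (intro mult_mono) auto
    from mult_right_mono [OF this, of \<Delta>] show "?c * \<Delta> \<le> \<Delta> / 16" using T by (simp add: mult_ac)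
    show "expect M (\<lambda>w. (gain w - expect M gain)\<^sup>2) \<le> 8 * (1 + 2 * a) * real N * p"
      using variance small_variance [OF pl(1)] by linarith
    have "8 * (1 + 2 * a) * real N * p = (320 * (1 + 2 * a) * real N) * p / 40" by simp
    also have "\<dots> \<le> (\<delta> * (a - b) * \<l> * L\<^sup>2) * p / 40" using big p_range by (intro divide_right_mono mult_right_mono) auto
    also have "\<dots> \<le> L * (?c * \<Delta>) / 40"
    proof -
      have "L * L * ?c \<le> L * \<Delta> * ?c" using L \<delta> pp ab lnN by (intro mult_right_mono mult_left_mono) auto
      then show ?thesis by (simp add: power2_eq_square mult_ac)
    qed
    finally show "8 * (1 + 2 * a) * real N * p \<le> L * (?c * \<Delta>) / 40" .
  qed
  also have "\<dots> = (1 - ?c / 2) * (1 / \<Delta>)" using T by (simp add: field_simps)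
  also have "\<dots> \<le> (1 - \<delta> * p0 / 2) * (1 / \<Delta>)"
  proof -
    have "1 * p0 \<le> ((a - b) * \<l>) * p" using p0 lnN by (intro mult_mono) auto
    then have "\<delta> * p0 \<le> \<delta> * (((a - b) * \<l>) * p)" using \<delta> by (intro mult_left_mono) auto
    then show ?thesis using T by (intro mult_right_mono) (auto simp: mult_ac)
  qed
  finally show ?thesis
    using expect_step [of "\<lambda>x. 1 / max x L"] by simp
qed

text \<open>
  The number \<open>m\<close> of blocks and the parameter \<open>s\<close> of the exponential moment stay free here; they are
  chosen together with the asymptotics.
\<close>

lemma exponential_step:
  assumes L: "0 < L" "L \<le> \<Delta>" and p: "0 < p" and K: "1 \<le> K"
    and u: "(a - b) * \<l> * \<Delta> \<le> real N" and pl: "\<l> * p \<le> 1" "24 * K * ((a - b) * \<l> * p) \<le> 1"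
    and KL: "192 * (1 + 2 * a) * real N * K \<le> \<delta> * (a - b) * \<l> * L\<^sup>2"
    and m: "0 < (m::nat)" "\<And>j. 2 * edge_prob a N * real (card {v \<in> vertices N. v mod m = j}) \<le> 1"
    and s: "0 \<le> s" "s \<le> 1"
    and tail: "exp K * (2 * real m * (exp (3 * s\<^sup>2 * (real N * p) - s * (\<Delta> / (32 * K * real m)))
          + 64 * real m ^ 2 * (9 * real N * p\<^sup>2 + 2 * edge_prob a N * (real N * p)\<^sup>2) / (\<Delta> / (4 * K))\<^sup>2))
        \<le> \<delta> * p * L / (4 * \<Delta>)"
  shows "expect (random_graph_pmf a b N y) (\<lambda>G. exp (K * (L / max (advantage N (majority_update N G y)) L - 1)))
     \<le> exp (K * (L / \<Delta> - 1))"
proof -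
  let ?c = "\<delta> * (a - b) * \<l> * p"
  have T: "0 < \<Delta>" using L by simp
  have t0: "0 < \<Delta> / (4 * K)" using T K by simp
  let ?\<rho> = "2 * real m * (exp (3 * s\<^sup>2 * (real N * p) - s * (\<Delta> / (32 * K * real m)))
          + 64 * real m ^ 2 * (9 * real N * p\<^sup>2 + 2 * edge_prob a N * (real N * p)\<^sup>2) / (\<Delta> / (4 * K))\<^sup>2)"
  have "expect M (\<lambda>w. exp (K * (L / max (\<Delta> + gain w) L - 1))) \<le> exp (K * (L / \<Delta> - 1))"
  proof (rule exponential_potential [OF finite_support L K, where \<rho> = ?\<rho>])
    show "?c * \<Delta> \<le> expect M gain" by (rule small_drift [OF u])
    show "0 < ?c * \<Delta>" using \<delta> ab lnN p T by simp
    have "\<delta> * (24 * K * ((a - b) * \<l> * p)) \<le> 1 * 1" using \<delta> pl p K ab lnN by (intro mult_mono) auto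
    from mult_right_mono [OF this, of \<Delta>] show "24 * K * (?c * \<Delta>) \<le> \<Delta>" using T by (simp add: mult_ac)
    show "expect M (\<lambda>w. (gain w - expect M gain)\<^sup>2) \<le> 8 * (1 + 2 * a) * real N * p"
      using variance small_variance [OF pl(1)] by linarith
    have "24 * K * (8 * (1 + 2 * a) * real N * p) = (192 * (1 + 2 * a) * real N * K) * p" by simp
    also have "\<dots> \<le> (\<delta> * (a - b) * \<l> * L\<^sup>2) * p" using KL p by (intro mult_right_mono) auto
    also have "\<dots> \<le> (\<delta> * (a - b) * \<l> * \<Delta>\<^sup>2) * p"
      using L \<delta> ab lnN p by (intro mult_right_mono mult_left_mono power_mono) auto
    also have "\<dots> = \<Delta> * (?c * \<Delta>)" by (simp add: power2_eq_square)
    finally show "24 * K * (8 * (1 + 2 * a) * real N * p) \<le> \<Delta> * (?c * \<Delta>)" .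
    have "measure_pmf.prob M {w. gain w - expect M gain \<le> - (\<Delta> / (4 * K))}
      \<le> 2 * real m * (exp (3 * s\<^sup>2 * (real (card (vertices N)) * pM) - s * ((\<Delta> / (4 * K)) / (8 * real m)))
          + 64 * real m ^ 2 * (9 * real (card (vertices N)) * pM\<^sup>2 + 2 * edge_prob a N * (real (card (vertices N)) * pM)\<^sup>2) / (\<Delta> / (4 * K))\<^sup>2)"
      by (rule gain_tail [OF m s t0 pP_le_pM])
    moreover have "real (card (vertices N)) = real N" by (simp add: vertices_def)
    moreover have "\<Delta> / (4 * K) / (8 * real m) = \<Delta> / (32 * K * real m)" by simp
    ultimately have "measure_pmf.prob M {w. gain w - expect M gain \<le> - (\<Delta> / (4 * K))} \<le> ?\<rho>"
      unfolding pM_eq by (simp only:)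
    then show "measure_pmf.prob M {w. gain w - expect M gain \<le> - \<Delta> / (4 * K)} \<le> ?\<rho>"
      by (simp only: minus_divide_left)
    have "\<delta> * p * L / (4 * \<Delta>) * 1 \<le> \<delta> * p * L / (4 * \<Delta>) * (K * ((a - b) * \<l>))"
    proof (rule mult_left_mono)
      have "1 * 1 \<le> K * ((a - b) * \<l>)" using K lnN by (intro mult_mono) auto
      then show "1 \<le> K * ((a - b) * \<l>)" by simp
    qed (use \<delta> p L T in auto)
    also have "\<dots> = K * L * (?c * \<Delta>) / (4 * \<Delta>\<^sup>2)" using T by (simp add: field_simps power2_eq_square)
    finally show "exp K * ?\<rho> \<le> K * L * (?c * \<Delta>) / (4 * \<Delta>\<^sup>2)" using tail by linarith
  qed
  then show ?thesis
    using expect_step [of "\<lambda>x. exp (K * (L / max x L - 1))"] by simp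
qed

end

section \<open>The last round\<close>

text \<open>
  A union bound over the vertices: a red vertex has to stay red or a blue one has to turn red.
\<close>

lemma survival_last_round:
  assumes cfg: "is_configuration N y" and cg: "coloured_graph (vertices N) y (edge_prob a N) (edge_prob b N)"
  shows "survival a b N (Suc 0) y \<le>
    real (card (red N y)) * (1 - outvote (card (blue N y)) (edge_prob b N) (card (red N y) - 1) (edge_prob a N))
    + real (card (blue N y)) * outvote (card (red N y)) (edge_prob b N) (card (blue N y) - 1) (edge_prob a N)"
proof -
  interpret coloured_graph "vertices N" y "edge_prob a N" "edge_prob b N" by (rule cg)
  let ?y' = "\<lambda>w. majority_update N {e \<in> vertex_pairs N. w e} y"
  have "survival a b N (Suc 0) y = expect M (\<lambda>w. of_bool (red N (?y' w) \<noteq> {}))"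
    by (simp add: survival_Suc survival_0 random_graph_eq [OF cfg cg])
  also have "\<dots> \<le> expect M (\<lambda>w. \<Sum>v\<in>vertices N. if y v = 1 then flip v w else 1 - flip v w)"
  proof (rule expect_mono [OF finite_support])
    fix w
    let ?h = "\<lambda>v. if y v = 1 then flip v w else 1 - flip v w"
    have h0: "0 \<le> ?h v" for v by (simp add: flip_range)
    show "of_bool (red N (?y' w) \<noteq> {}) \<le> (\<Sum>v\<in>vertices N. ?h v)"
    proof (cases "red N (?y' w) = {}")
      case False
      then obtain v where v: "v \<in> vertices N" "?y' w v = -1" by (auto simp: red_def)
      have "real_of_int (y v) * (1 - 2 * flip v w) = -1"
        using majority_update_flip [OF cfg cg v(1), of w] v(2) by simp
      then have "?h v = 1" using colour [OF v(1)] by auto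
      then have "1 \<le> (\<Sum>v\<in>vertices N. ?h v)"
        using member_le_sum [of v "vertices N" ?h] v h0 finV by simp
      then show ?thesis using False by simp
    qed (simp add: sum_nonneg h0)
  qed
  also have "\<dots> = (\<Sum>v\<in>vertices N. expect M (\<lambda>w. if y v = 1 then flip v w else 1 - flip v w))"
    by (rule expect_sum [OF finite_support])
  also have "\<dots> = (\<Sum>v\<in>vertices N. if y v = 1 then expect M (flip v) else 1 - expect M (flip v))"
    by (intro sum.cong refl) (simp add: expect_diff [OF finite_support])
  also have "\<dots> = real nP * pP + real nM * (1 - pM)"
    unfolding sum_by_colour by (simp add: expect_flip_plus expect_flip_minus nP_def nM_def)
  finally show ?thesis
    by (simp add: pM_def pP_def nP_eq [OF cfg cg] nM_eq [OF cfg cg])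
qed

section \<open>Flip probabilities for large populations\<close>

text \<open>
  If the mean number of blue neighbours of a red vertex exceeds that of red neighbours, the
  one-term lower bound is not sharp. The number of blue vertices is then reduced to the number \<open>m\<close>
  for which both means agree up to one vertex; by monotonicity the flip probability only decreases,
  and the exponent is \<open>0\<close> there. In the other case the exponent is a continuous
  function of the red fraction, which exceeds \<open>R0 / N\<close> by at most \<open>N powr (-1/4)\<close>.
\<close>

lemma red_flip_prob_lower:
  fixes a b \<delta> \<epsilon> :: real
  assumes b: "0 < b" "b < a" and \<delta>: "0 < \<delta>" and \<epsilon>: "0 < \<epsilon>"
  shows "\<forall>\<^sub>F N::nat in sequentially. \<forall>R R0. \<delta> * real N < real R \<longrightarrow> 2 * R \<le> N \<longrightarrow> R0 \<le> N \<longrightarrow>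
     real R \<le> real R0 + real N powr (3 / 4) \<longrightarrow>
     real N powr (- (rate_I (a * real R0 / real N) (b * real (N - R0) / real N) + \<epsilon> / 2))
       \<le> outvote (N - R) (edge_prob b N) (R - 1) (edge_prob a N)"
proof -
  have a: "0 < a" using b by simp
  have ev1: "\<forall>\<^sub>F N::nat in sequentially. a * ln (real N) / real N \<le> 1 / 2" using a by real_asymp
  have ev2: "\<forall>\<^sub>F N::nat in sequentially. (a * ln (real N))\<^sup>2 / real N \<le> 1" using a by real_asymp
  have ev3: "\<forall>\<^sub>F N::nat in sequentially. 2 * (a * ln (real N) + 1)\<^sup>2 \<le> \<delta> * real N - 1" using a \<delta> by real_asymp
  have ev4: "\<forall>\<^sub>F N::nat in sequentially. real N powr (- (\<epsilon> / 4))
      \<le> exp (- 8) / 4 * (b * ln (real N) * \<delta> / 2) / (a * ln (real N) + 1) ^ 3"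
    using a b \<delta> \<epsilon> by real_asymp
  have ev5: "\<forall>\<^sub>F N::nat in sequentially. 4 * sqrt a * sqrt (a * real N powr (- 1 / 4)) + 4 * (a * real N powr (- 1 / 4)) \<le> \<epsilon> / 4"
    using a \<epsilon> by real_asymp
  have ev6: "\<forall>\<^sub>F N::nat in sequentially. 1 / 2 \<le> \<epsilon> / 4 * ln (real N)" using \<epsilon> by real_asymp
  have ev7: "\<forall>\<^sub>F N::nat in sequentially. 2 \<le> \<delta> * real N" using \<delta> by real_asymp
  have ev8: "\<forall>\<^sub>F N::nat in sequentially. 2 \<le> real N" by real_asymp
  show ?thesis
    using ev1 ev2 ev3 ev4 ev5 ev6 ev7 ev8
  proof eventually_elim
    case (elim N)
    note e = elim
    define l where "l = ln (real N)"
    have N: "0 < real N" using e by simp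
    have l0: "0 < l" using e unfolding l_def by (intro ln_gt_zero) auto
    define \<alpha> where "\<alpha> = edge_prob a N"
    define \<beta> where "\<beta> = edge_prob b N"
    have al: "\<alpha> = a * l / N" "\<beta> = b * l / N" by (simp_all add: \<alpha>_def \<beta>_def edge_prob_def l_def)
    have al0: "0 < \<alpha>" "0 < \<beta>" using a b l0 N by (auto simp: al)
    have ba: "\<beta> \<le> \<alpha>" unfolding al using b l0 N by (intro divide_right_mono mult_right_mono) auto
    have ah: "\<alpha> \<le> 1 / 2" using e(1) by (simp add: al l_def)
    have Na2: "real N * \<alpha>\<^sup>2 \<le> 1" using e(2) N by (simp add: al l_def power2_eq_square field_simps)
    show ?case
    proof (intro allI impI)
      fix R R0 :: nat
      assume R: "\<delta> * real N < real R" "2 * R \<le> N" and R0: "R0 \<le> N" "real R \<le> real R0 + real N powr (3 / 4)"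
      define n where "n = R - 1"
      have R1: "2 < real R" using R e(7) by linarith
      then have n: "real n = real R - 1" by (simp add: n_def of_nat_diff)
      define \<nu> where "\<nu> = real n * \<alpha>"
      define m where "m = min (N - R) (nat \<lfloor>\<nu> / \<beta>\<rfloor>)"
      have nn: "real n \<le> \<nu> / \<beta>"
        using al0 ba mult_left_mono[of \<beta> \<alpha> "real n"] by (simp add: \<nu>_def pos_le_divide_eq)
      have "n \<le> nat \<lfloor>\<nu> / \<beta>\<rfloor>" using nn by (simp add: le_nat_floor)
      moreover have "n \<le> N - R" using R(2) by (simp add: n_def)
      ultimately have nm: "n \<le> m" by (simp add: m_def)
      define \<mu> where "\<mu> = real m * \<beta>"
      have \<nu>\<beta>: "0 \<le> \<nu> / \<beta>" using al0 by (simp add: \<nu>_def)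
      have "real m \<le> \<nu> / \<beta>"
      proof -
        have "real m \<le> real (nat \<lfloor>\<nu> / \<beta>\<rfloor>)" by (simp add: m_def)
        also have "\<dots> \<le> \<nu> / \<beta>" using \<nu>\<beta> by simp
        finally show ?thesis .
      qed
      then have \<mu>\<nu>: "\<mu> \<le> \<nu>" using al0 by (simp add: \<mu>_def pos_le_divide_eq)
      have n0: "0 < real n" using n R1 by simp
      then have m0: "0 < real m" using nm by simp
      have \<mu>0: "0 < \<mu>" using m0 al0 by (simp add: \<mu>_def)
      then have \<nu>0: "0 < \<nu>" using \<mu>\<nu> by simp
      define w where "w = sqrt (\<mu> * \<nu>)"
      have "w \<le> sqrt (\<nu> * \<nu>)" unfolding w_def using \<mu>\<nu> \<nu>0 by (intro real_sqrt_le_mono mult_right_mono) auto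
      then have w\<nu>: "w \<le> \<nu>" using \<nu>0 by simp
      have nN: "real n \<le> real N" using R(2) by (simp add: n_def)
      have "\<nu> \<le> a * l"
      proof -
        have "real n * \<alpha> \<le> real N * \<alpha>" using nN al0 by (intro mult_right_mono) auto
        then show ?thesis using N by (simp add: \<nu>_def al)
      qed
      then have wl: "0 \<le> w" "w \<le> a * l" using w\<nu> \<mu>0 \<nu>0 by (auto simp: w_def)
      have "2 * (w + 1)\<^sup>2 \<le> 2 * (a * l + 1)\<^sup>2" using wl by (intro mult_left_mono power_mono) auto
      also have "\<dots> \<le> real n" using e(3) R(1) n by (simp add: l_def)
      finally have wn: "2 * (w + 1)\<^sup>2 \<le> real n" .
      have mN: "real m \<le> real N" by (simp add: m_def)
      have lower: "outvote m \<beta> n \<alpha> \<ge> exp (- 8) / 4 * \<mu> / (w + 1) ^ 3 * exp (- (sqrt \<mu> - sqrt \<nu>)\<^sup>2)"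
      proof (rule outvote_ge)
        have "real m * \<beta>\<^sup>2 \<le> real N * \<alpha>\<^sup>2" using mN al0 ba by (intro mult_mono power_mono) auto
        then show "real m * \<beta>\<^sup>2 \<le> 1" using Na2 by simp
        have "real n * \<alpha>\<^sup>2 \<le> real N * \<alpha>\<^sup>2" using nN by (intro mult_right_mono) auto
        then show "real n * \<alpha>\<^sup>2 \<le> 1" using Na2 by simp
        show "2 * (w + 1)\<^sup>2 \<le> real m" using wn nm by linarith
      qed (use al0 ba ah \<mu>_def \<nu>_def \<mu>0 \<nu>0 w_def wn in auto)
      have pre: "real N powr (- (\<epsilon> / 4)) \<le> exp (- 8) / 4 * \<mu> / (w + 1) ^ 3"
      proof -
        have "b * l * \<delta> / 2 \<le> \<mu>"
        proof -
          have "\<delta> * real N / 2 \<le> real m" using R(1) e(7) n nm by linarith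
          then have "\<delta> * real N / 2 * \<beta> \<le> \<mu>" unfolding \<mu>_def using al0 by (intro mult_right_mono) auto
          then show ?thesis using N by (simp add: al mult_ac)
        qed
        then have num: "exp (- 8) / 4 * (b * l * \<delta> / 2) \<le> exp (- 8) / 4 * \<mu>"
          by (rule mult_left_mono) simp
        have num0: "0 \<le> exp (- 8) / 4 * \<mu>" using \<mu>0 by simp
        have den: "(w + 1) ^ 3 \<le> (a * l + 1) ^ 3" "0 < (w + 1) ^ 3"
          using wl by (auto intro!: power_mono)
        have "exp (- 8) / 4 * (b * l * \<delta> / 2) / (a * l + 1) ^ 3 \<le> exp (- 8) / 4 * \<mu> / (w + 1) ^ 3"
          by (rule frac_le [OF num0 num den(2,1)])
        then show ?thesis using e(4) by (simp add: l_def)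
      qed
      define I where "I = rate_I (a * real R0 / real N) (b * real (N - R0) / real N)"
      have I0: "0 \<le> I" by (simp add: I_def rate_I_def)
      have main: "(sqrt \<mu> - sqrt \<nu>)\<^sup>2 \<le> (I + \<epsilon> / 4) * l"
      proof (cases "m = N - R")
        case False
        then have "m = nat \<lfloor>\<nu> / \<beta>\<rfloor>" by (auto simp: m_def)
        then have "\<nu> / \<beta> \<le> real m + 1" using \<nu>\<beta> by linarith
        then have "\<nu> \<le> \<mu> + \<beta>" using al0 by (simp add: \<mu>_def pos_divide_le_eq algebra_simps)
        then have "sqrt \<nu> \<le> sqrt (\<mu> + \<beta>)" by simp
        also have "\<dots> \<le> sqrt \<mu> + sqrt \<beta>" using \<mu>0 al0 by (intro sqrt_add_le_add_sqrt) auto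
        finally have "sqrt \<nu> - sqrt \<mu> \<le> sqrt \<beta>" by simp
        moreover have "0 \<le> sqrt \<nu> - sqrt \<mu>" using \<mu>\<nu> by simp
        ultimately have "(sqrt \<nu> - sqrt \<mu>)\<^sup>2 \<le> (sqrt \<beta>)\<^sup>2" by (intro power_mono)
        also have "\<dots> = \<beta>" using al0 by simp
        also have "\<beta> \<le> \<epsilon> / 4 * l" unfolding l_def using ba ah e(6) by linarith
        also have "\<dots> \<le> (I + \<epsilon> / 4) * l" using I0 l0 by (intro mult_right_mono) auto
        finally show ?thesis by (simp add: power2_commute)
      next
        case True
        define x0 where "x0 = a * real R0 / real N"
        define y0 where "y0 = b * real (N - R0) / real N"
        define x where "x = a * real n / real N"
        define z where "z = b * real m / real N"
        define g where "g = a * real N powr (- 1 / 4)"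
        have nonneg: "0 \<le> x0" "0 \<le> y0" "0 \<le> x" "0 \<le> z" "0 \<le> g"
          using a b N by (auto simp: x0_def y0_def x_def z_def g_def)
        have gN: "a * real N powr (3 / 4) / real N = g"
        proof -
          have "real N powr (3 / 4) / real N = real N powr (3 / 4) / real N powr 1" using N by simp
          also have "\<dots> = real N powr (3 / 4 - 1)" by (rule powr_diff [symmetric])
          also have "\<dots> = real N powr (- 1 / 4)" by simp
          finally have "real N powr (3 / 4) / real N = real N powr (- 1 / 4)" .
          then show ?thesis unfolding g_def times_divide_eq_right [symmetric] by (rule arg_cong)
        qed
        have "x \<le> x0 + g"
        proof -
          have "real n \<le> real R0 + real N powr (3 / 4)" using R0(2) n by simp
          then have "a * real n / real N \<le> a * (real R0 + real N powr (3 / 4)) / real N"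
            using a N by (intro divide_right_mono mult_left_mono) auto
          also have "\<dots> = x0 + g" unfolding gN [symmetric] x0_def by (simp add: distrib_left add_divide_distrib)
          finally show ?thesis by (simp only: x_def)
        qed
        then have sx: "sqrt x \<le> sqrt x0 + sqrt g"
          by (rule order_trans [OF real_sqrt_le_mono sqrt_add_le_add_sqrt [OF nonneg(1) nonneg(5)]])
        have "y0 \<le> z + g"
        proof -
          have "real (N - R0) \<le> real m + real N powr (3 / 4)"
            using R0 R(2) True by (simp add: of_nat_diff)
          then have "b * real (N - R0) / real N \<le> b * (real m + real N powr (3 / 4)) / real N"
            using b N by (intro divide_right_mono mult_left_mono) auto
          also have "\<dots> = z + b * real N powr (3 / 4) / real N"
            by (simp add: z_def distrib_left add_divide_distrib)
          finally have "y0 \<le> z + b * real N powr (3 / 4) / real N" by (simp only: y0_def)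
          moreover have "b * real N powr (3 / 4) / real N \<le> a * real N powr (3 / 4) / real N"
            using b N by (intro divide_right_mono mult_right_mono) auto
          ultimately show ?thesis unfolding gN by linarith
        qed
        then have sy: "sqrt y0 \<le> sqrt z + sqrt g"
          by (rule order_trans [OF real_sqrt_le_mono sqrt_add_le_add_sqrt [OF nonneg(4) nonneg(5)]])
        define D where "D = max (sqrt x0 - sqrt y0) 0"
        have D: "0 \<le> D" "D\<^sup>2 = I" by (auto simp: D_def I_def rate_I_def x0_def y0_def)
        have "x0 \<le> a" using R0 a N by (simp add: x0_def pos_divide_le_eq)
        then have "sqrt x0 \<le> sqrt a" by simp
        moreover have "0 \<le> sqrt y0" "0 \<le> sqrt a" using nonneg a by auto
        ultimately have Da: "D \<le> sqrt a" unfolding D_def by linarith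
        have \<nu>x: "\<nu> = x * l" "\<mu> = z * l" by (simp_all add: \<nu>_def \<mu>_def x_def z_def al)
        have "z \<le> x" using \<mu>\<nu> l0 by (simp add: \<nu>x)
        then have dd: "0 \<le> sqrt x - sqrt z" by simp
        have "sqrt x - sqrt z \<le> D + 2 * sqrt g" using sx sy unfolding D_def by linarith
        then have "(sqrt x - sqrt z)\<^sup>2 \<le> (D + 2 * sqrt g)\<^sup>2" using dd by (intro power_mono)
        also have "\<dots> = I + 4 * D * sqrt g + 4 * g"
          using D nonneg by (simp add: power2_sum power_mult_distrib)
        also have "\<dots> \<le> I + 4 * sqrt a * sqrt g + 4 * g"
          using Da nonneg by (intro add_mono mult_right_mono) auto
        also have "\<dots> \<le> I + \<epsilon> / 4" using e(5) by (simp add: g_def)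
        finally have "(sqrt x - sqrt z)\<^sup>2 * l \<le> (I + \<epsilon> / 4) * l" using l0 by (intro mult_right_mono) auto
        moreover have "(sqrt \<mu> - sqrt \<nu>)\<^sup>2 = (sqrt x - sqrt z)\<^sup>2 * l"
        proof -
          have "sqrt \<mu> - sqrt \<nu> = (sqrt z - sqrt x) * sqrt l"
            by (simp add: \<nu>x real_sqrt_mult left_diff_distrib)
          then show ?thesis using l0 by (simp add: power_mult_distrib power2_commute)
        qed
        ultimately show ?thesis by simp
      qed
      have "real N powr (- (I + \<epsilon> / 2)) = real N powr (- (\<epsilon> / 4)) * exp (- ((I + \<epsilon> / 4) * l))"
        using N by (simp add: powr_def l_def exp_add [symmetric] algebra_simps)
      also have "\<dots> \<le> exp (- 8) / 4 * \<mu> / (w + 1) ^ 3 * exp (- (sqrt \<mu> - sqrt \<nu>)\<^sup>2)"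
        by (rule mult_mono [OF pre]) (use main order_trans [OF powr_ge_zero pre] in auto)
      also have "\<dots> \<le> outvote m \<beta> n \<alpha>" by (rule lower)
      also have "\<dots> \<le> outvote (N - R) \<beta> n \<alpha>"
        by (rule outvote_mono) (use al0 ba ah m_def in auto)
      finally show "real N powr (- (rate_I (a * real R0 / real N) (b * real (N - R0) / real N) + \<epsilon> / 2))
        \<le> outvote (N - R) (edge_prob b N) (R - 1) (edge_prob a N)"
        by (simp add: I_def n_def \<alpha>_def \<beta>_def)
    qed
  qed
qed

text \<open>
  Near balance the two means are \<open>a ln N / 2\<close> and \<open>b ln N / 2\<close>. The Chernoff bound with the optimal
  \<open>s = sqrt (a / b)\<close> gives the exponent \<open>(sqrt a - sqrt b)\<^sup>2 / 2\<close>; half of it absorbs the error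
  terms.
\<close>

lemma red_flip_prob_upper:
  fixes a b \<zeta> \<eta> :: real
  assumes b: "0 < b" "b < a" and \<zeta>: "0 < \<zeta>" "\<zeta> \<le> 1 / 8"
    and \<eta>: "\<eta> \<le> (sqrt a - sqrt b)\<^sup>2 / 4"
  shows "\<forall>\<^sub>F N::nat in sequentially. \<forall>R. real N / 2 - real N powr (1 / 2 + \<zeta>) \<le> real R \<longrightarrow> 2 * R \<le> N \<longrightarrow>
     outvote (N - R) (edge_prob b N) (R - 1) (edge_prob a N) \<le> real N powr (- \<eta>)"
proof -
  have a: "0 < a" using b by simp
  define s where "s = sqrt (a / b)"
  have s1: "1 < s" using b a by (simp add: s_def)
  define \<theta> where "\<theta> = (sqrt a - sqrt b)\<^sup>2 / 4"
  have \<theta>: "0 < \<theta>" "\<eta> \<le> \<theta>" using b \<eta> by (auto simp: \<theta>_def)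
  define c where "c = b * (s - 1) + a"
  have c: "0 < c" using b a s1 by (simp add: c_def add_pos_pos)
  have ev1: "\<forall>\<^sub>F N::nat in sequentially. c * (real N powr (1 / 2 + \<zeta>) + 1) / real N \<le> \<theta>"
    using c \<zeta> \<theta> by real_asymp
  have ev2: "\<forall>\<^sub>F N::nat in sequentially. a * ln (real N) / real N \<le> 1 / 2" using a by real_asymp
  have ev3: "\<forall>\<^sub>F N::nat in sequentially. 2 \<le> real N" by real_asymp
  show ?thesis
    using ev1 ev2 ev3
  proof eventually_elim
    case (elim N)
    define l where "l = ln (real N)"
    define g where "g = real N powr (1 / 2 + \<zeta>)"
    have N: "0 < real N" using elim by simp
    have l0: "0 < l" using elim unfolding l_def by (intro ln_gt_zero) auto
    have al: "edge_prob a N = a * l / N" "edge_prob b N = b * l / N" by (simp_all add: edge_prob_def l_def)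
    have ba: "edge_prob b N \<le> edge_prob a N" unfolding al using b l0 N by (intro divide_right_mono mult_right_mono) auto
    have pr: "0 \<le> edge_prob b N" "edge_prob a N \<le> 1 / 2" using elim b l0 N by (auto simp: al l_def)
    show ?case
    proof (intro allI impI)
      fix R assume R: "real N / 2 - real N powr (1 / 2 + \<zeta>) \<le> real R" "2 * R \<le> N"
      have "outvote (N - R) (edge_prob b N) (R - 1) (edge_prob a N)
        \<le> exp (edge_prob b N * real (N - R) * (s - 1) - edge_prob a N * real (R - 1) * (1 - 1 / s))"
        by (rule outvote_le_exp) (use pr ba s1 in auto)
      also have "\<dots> \<le> exp (- (\<eta> * l))"
      proof -
        have bs: "b * s = sqrt (a * b)" "a / s = sqrt (a * b)"
        proof -
          show "b * s = sqrt (a * b)" using a b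
            by (simp add: s_def real_sqrt_divide real_sqrt_mult field_simps)
          show "a / s = sqrt (a * b)" using a b
            by (simp add: s_def real_sqrt_divide real_sqrt_mult field_simps)
        qed
        have "(sqrt a - sqrt b)\<^sup>2 = a + b - 2 * sqrt (a * b)"
          using a b by (simp add: power2_diff real_sqrt_mult)
        then have \<theta>4: "4 * \<theta> = a + b - 2 * sqrt (a * b)" by (simp add: \<theta>_def)
        have 1: "real (N - R) \<le> real N / 2 + g" "real N / 2 - g - 1 \<le> real (R - 1)"
          using R by (auto simp: g_def)
        have "b * real (N - R) * (s - 1) - a * real (R - 1) * (1 - 1 / s)
          \<le> b * (real N / 2 + g) * (s - 1) - a * (real N / 2 - g - 1) * (1 - 1 / s)"
          using 1 a b s1 by (intro diff_mono mult_right_mono mult_left_mono) auto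
        also have "\<dots> = real N / 2 * (b * s - b - (a - a / s)) + g * (b * (s - 1)) + (g + 1) * (a * (1 - 1 / s))"
          by (simp add: algebra_simps add_divide_distrib diff_divide_distrib)
        also have "\<dots> \<le> real N / 2 * (b * s - b - (a - a / s)) + (g + 1) * (b * (s - 1)) + (g + 1) * (a * 1)"
          using a b s1 by (intro add_mono mult_right_mono mult_left_mono) (auto simp: g_def)
        also have "\<dots> = - (2 * \<theta> * real N) + c * (g + 1)"
        proof -
          have "b * s - b - (a - a / s) = - (4 * \<theta>)" unfolding bs \<theta>4 by simp
          then show ?thesis by (simp only: c_def) (simp add: algebra_simps)
        qed
        finally have "b * real (N - R) * (s - 1) - a * real (R - 1) * (1 - 1 / s) \<le> - (2 * \<theta> * real N) + c * (g + 1)" .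
        moreover have "c * (g + 1) \<le> \<theta> * real N" using elim(1) N by (simp add: g_def pos_divide_le_eq)
        ultimately have "b * real (N - R) * (s - 1) - a * real (R - 1) * (1 - 1 / s) \<le> - (\<theta> * real N)" by linarith
        then have "l / real N * (b * real (N - R) * (s - 1) - a * real (R - 1) * (1 - 1 / s)) \<le> l / real N * (- (\<theta> * real N))"
          using l0 N by (intro mult_left_mono) auto
        moreover have "\<eta> * l \<le> \<theta> * l" using \<theta> l0 by (intro mult_right_mono) auto
        moreover have "l / real N * (- (\<theta> * real N)) = - (\<theta> * l)" using N by simp
        moreover have "edge_prob b N * real (N - R) * (s - 1) - edge_prob a N * real (R - 1) * (1 - 1 / s)
          = l / real N * (b * real (N - R) * (s - 1) - a * real (R - 1) * (1 - 1 / s))"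
          unfolding al right_diff_distrib [of "l / real N"] by (simp only: times_divide_eq_left times_divide_eq_right mult_ac)
        ultimately show ?thesis by simp
      qed
      also have "\<dots> = real N powr (- \<eta>)" using N by (simp add: powr_def l_def)
      finally show "outvote (N - R) (edge_prob b N) (R - 1) (edge_prob a N) \<le> real N powr (- \<eta>)" .
    qed
  qed
qed

text \<open>
  With few red vertices a red one stays red with probability about \<open>N powr (- b)\<close> and a blue one turns
  red with probability about \<open>N powr (- a)\<close>. Both exponents exceed \<open>1\<close>, so one round
  removes all red vertices.
\<close>

lemma survival_few_red:
  fixes a b :: real
  assumes b: "1 < b" "b < a"
  obtains \<delta> \<xi> :: real where "0 < \<delta>" "\<delta> \<le> 1 / 16" "0 < \<xi>"
    "\<forall>\<^sub>F N::nat in sequentially. \<forall>y m. is_configuration N y \<longrightarrow> real (card (red N y)) \<le> \<delta> * real N \<longrightarrow>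
       survival a b N (Suc m) y \<le> real N powr (- \<xi>)"
proof -
  \<comment> \<open>\<open>b (1 - 1 / s)\<close> exceeds \<open>1\<close> by \<open>3 (b - 1) / 4\<close>, of which \<open>\<delta>\<close> takes one third\<close>
  define s where "s = 4 * b / (b - 1)"
  define \<xi> where "\<xi> = (b - 1) / 2"
  define \<delta> where "\<delta> = min (1 / 16) ((b - 1) / (4 * (b + a * s)))"
  have s1: "1 < s" using b by (simp add: s_def pos_less_divide_eq)
  have den: "0 < b + a * s" using b s1 by (simp add: add_pos_pos)
  have \<delta>: "0 < \<delta>" "\<delta> \<le> 1 / 16"
    unfolding \<delta>_def using b den by (simp, intro min.cobounded1)
  have \<xi>: "0 < \<xi>" using b by (simp add: \<xi>_def)
  have "\<delta> \<le> (b - 1) / (4 * (b + a * s))" by (simp add: \<delta>_def)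
  then have \<delta>s: "\<delta> * (b + a * s) \<le> (b - 1) / 4" using den by (simp add: pos_le_divide_eq mult_ac)
  have exponent: "a * \<delta> * (s - 1) - b * (1 - \<delta>) * (1 - 1 / s) \<le> - (1 + \<xi>)"
  proof -
    have "b / s = (b - 1) / 4" using b by (simp add: s_def)
    moreover have "b * (1 - \<delta>) * (1 - 1 / s) = (1 - \<delta>) * (b - b / s)"
      by (simp add: algebra_simps diff_divide_distrib)
    ultimately have "b * (1 - \<delta>) * (1 - 1 / s) = (1 - \<delta>) * (b - (b - 1) / 4)"
      by (simp only:)
    also have "\<dots> \<ge> b - (b - 1) / 4 - \<delta> * b"
    proof -
      have "\<delta> * (b - (b - 1) / 4) \<le> \<delta> * b" using \<delta> b by (intro mult_left_mono) auto
      then show "b - (b - 1) / 4 - \<delta> * b \<le> (1 - \<delta>) * (b - (b - 1) / 4)"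
        unfolding left_diff_distrib [of 1] mult_1 by (rule diff_left_mono)
    qed
    finally have "b - (b - 1) / 4 - \<delta> * b \<le> b * (1 - \<delta>) * (1 - 1 / s)" .
    moreover have "a * \<delta> * (s - 1) \<le> \<delta> * (a * s)" using \<delta> b by (simp add: algebra_simps)
    moreover have "\<delta> * b + \<delta> * (a * s) \<le> (b - 1) / 4" using \<delta>s by (simp only: distrib_left)
    moreover have "P - Y \<le> - (1 + (b - 1) / 2)"
      if "b - (b - 1) / 4 - d \<le> Y" "P \<le> Q" "d + Q \<le> (b - 1) / 4" for P Q Y d :: real
      using that by argo
    ultimately show ?thesis unfolding \<xi>_def by blast
  qed
  have ev2: "\<forall>\<^sub>F N::nat in sequentially. a * ln (real N) / real N \<le> 1 / 2" using b by real_asymp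
  have ev3: "\<forall>\<^sub>F N::nat in sequentially. 2 \<le> real N" by real_asymp
  have ev4: "\<forall>\<^sub>F N::nat in sequentially. a \<le> (a - b) * (real N / 2)" using b by real_asymp
  have "\<forall>\<^sub>F N::nat in sequentially. \<forall>y m. is_configuration N y \<longrightarrow> real (card (red N y)) \<le> \<delta> * real N \<longrightarrow>
       survival a b N (Suc m) y \<le> real N powr (- \<xi>)"
    using ev2 ev3 ev4
  proof eventually_elim
    case (elim N)
    define l where "l = ln (real N)"
    have N: "0 < real N" using elim by simp
    have l0: "0 < l" using elim unfolding l_def by (intro ln_gt_zero) auto
    have al: "edge_prob a N = a * l / N" "edge_prob b N = b * l / N" by (simp_all add: edge_prob_def l_def)
    have ba: "edge_prob b N \<le> edge_prob a N" unfolding al using b l0 N by (intro divide_right_mono mult_right_mono) auto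
    have pr: "0 \<le> edge_prob b N" "edge_prob a N \<le> 1 / 2" using elim b l0 N by (auto simp: al l_def)
    show ?case
    proof (intro allI impI)
      fix y m assume cfg: "is_configuration N y" and R: "real (card (red N y)) \<le> \<delta> * real N"
      define r where "r = card (red N y)"
      define B where "B = card (blue N y)"
      have Br: "B + r = N" using card_blue_red [OF cfg] by (simp add: B_def r_def)
      have rN: "real r \<le> \<delta> * real N" using R by (simp add: r_def)
      have BN: "(1 - \<delta>) * real N \<le> real B" using rN Br by (simp add: algebra_simps flip: of_nat_add)
      have Bhalf: "real N / 2 \<le> real B"
      proof -
        have "1 / 2 * real N \<le> (1 - \<delta>) * real N" using \<delta> by (intro mult_right_mono) auto
        with BN show ?thesis by (simp only: times_divide_eq_left mult_1)
      qed
      have B1: "1 \<le> real B" using Bhalf elim by simp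
      have cg: "coloured_graph (vertices N) y (edge_prob a N) (edge_prob b N)"
        by (rule coloured_graph_vertices) (use cfg b elim pr in auto)
      have le: "E \<le> real N powr (- (1 + \<xi>))"
        if E: "E \<le> exp (X * (s - 1) - Y * (1 - 1 / s))" and X: "X \<le> l * (a * \<delta>)" and Y: "l * (b * (1 - \<delta>)) \<le> Y" for E X Y
      proof -
        have "X * (s - 1) - Y * (1 - 1 / s) \<le> l * (a * \<delta>) * (s - 1) - l * (b * (1 - \<delta>)) * (1 - 1 / s)"
          using X Y s1 by (intro diff_mono mult_right_mono) auto
        also have "\<dots> = l * (a * \<delta> * (s - 1) - b * (1 - \<delta>) * (1 - 1 / s))" by (simp add: algebra_simps)
        also have "\<dots> \<le> l * (- (1 + \<xi>))" using exponent l0 by (intro mult_left_mono) auto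
        finally have "E \<le> exp (l * (- (1 + \<xi>)))" using E by (meson exp_le_cancel_iff order_trans)
        then show ?thesis using N by (simp add: powr_def l_def mult.commute)
      qed
      have stay: "1 - outvote B (edge_prob b N) (r - 1) (edge_prob a N) \<le> real N powr (- (1 + \<xi>))"
      proof (rule le)
        show "1 - outvote B (edge_prob b N) (r - 1) (edge_prob a N)
          \<le> exp (edge_prob a N * real (r - 1) * (s - 1) - edge_prob b N * real B * (1 - 1 / s))"
          by (rule one_minus_outvote_le_exp) (use pr ba s1 in auto)
        have "real (r - 1) \<le> \<delta> * real N" using rN by simp
        then have "a * l / real N * real (r - 1) \<le> a * l / real N * (\<delta> * real N)"
          using b l0 N by (intro mult_left_mono) auto
        then show "edge_prob a N * real (r - 1) \<le> l * (a * \<delta>)" using N by (simp add: al mult_ac)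
        have "b * l / real N * ((1 - \<delta>) * real N) \<le> b * l / real N * real B"
          using b l0 N BN by (intro mult_left_mono) auto
        then show "l * (b * (1 - \<delta>)) \<le> edge_prob b N * real B" using N by (simp add: al mult_ac)
      qed
      have turn: "outvote r (edge_prob b N) (B - 1) (edge_prob a N) \<le> real N powr (- (1 + \<xi>))"
      proof (rule le)
        show "outvote r (edge_prob b N) (B - 1) (edge_prob a N)
          \<le> exp (edge_prob b N * real r * (s - 1) - edge_prob a N * real (B - 1) * (1 - 1 / s))"
          by (rule outvote_le_exp) (use pr ba s1 in auto)
        have "b * l / real N * real r \<le> a * l / real N * (\<delta> * real N)"
          using b l0 N rN by (intro mult_mono divide_right_mono mult_right_mono) auto
        then show "edge_prob b N * real r \<le> l * (a * \<delta>)" using N by (simp add: al mult_ac)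
        have "b * real B \<le> a * real (B - 1)"
        proof -
          have "(a - b) * (real N / 2) \<le> (a - b) * real B" using b Bhalf by (intro mult_left_mono) auto
          then have "a \<le> (a - b) * real B" using elim(3) by (rule order_trans [rotated])
          then have "b * real B \<le> a * (real B - 1)" by (simp add: algebra_simps)
          then show ?thesis using B1 by (simp add: of_nat_diff)
        qed
        moreover have "b * ((1 - \<delta>) * real N) \<le> b * real B" using b BN by (intro mult_left_mono) auto
        ultimately have "l / real N * (b * ((1 - \<delta>) * real N)) \<le> l / real N * (a * real (B - 1))"
          using l0 N by (intro mult_left_mono) auto
        then show "l * (b * (1 - \<delta>)) \<le> edge_prob a N * real (B - 1)" using N by (simp add: al mult_ac)
      qed
      have "survival a b N (Suc m) y \<le> survival a b N (Suc 0) y"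
        by (rule survival_antimono [OF cfg]) simp
      also have "\<dots> \<le> real r * (1 - outvote B (edge_prob b N) (r - 1) (edge_prob a N))
          + real B * outvote r (edge_prob b N) (B - 1) (edge_prob a N)"
        unfolding r_def B_def by (rule survival_last_round [OF cfg cg])
      also have "\<dots> \<le> real r * real N powr (- (1 + \<xi>)) + real B * real N powr (- (1 + \<xi>))"
        using stay turn by (intro add_mono mult_left_mono) auto
      also have "\<dots> = real N * real N powr (- (1 + \<xi>))"
        using Br by (simp add: distrib_right [symmetric] flip: of_nat_add)
      also have "\<dots> = real N powr (- \<xi>)"
      proof -
        have "real N * real N powr (- (1 + \<xi>)) = real N powr 1 * real N powr (- (1 + \<xi>))" using N by simp
        also have "\<dots> = real N powr (1 + - (1 + \<xi>))" by (rule powr_add [symmetric])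
        finally show ?thesis by simp
      qed
      finally show "survival a b N (Suc m) y \<le> real N powr (- \<xi>)" .
    qed
  qed
  with \<delta> \<xi> show ?thesis by (rule that)
qed

lemma card_residue_class_le:
  assumes "0 < m"
  shows "real (card {v \<in> {1..N}. v mod m = j}) \<le> real N / real m + 1"
proof -
  have inj: "inj_on (\<lambda>v. v div m) {v \<in> {1..N}. v mod m = j}"
  proof (rule inj_onI)
    fix u v assume "u \<in> {v \<in> {1..N}. v mod m = j}" "v \<in> {v \<in> {1..N}. v mod m = j}" "u div m = v div m"
    then show "u = v" using div_mult_mod_eq[of u m] div_mult_mod_eq[of v m] by simp
  qed
  have "card {v \<in> {1..N}. v mod m = j} = card ((\<lambda>v. v div m) ` {v \<in> {1..N}. v mod m = j})"
    by (rule card_image [OF inj, symmetric])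
  also have "\<dots> \<le> card {0..N div m}"
    by (rule card_mono) (auto intro: div_le_mono)
  finally have "card {v \<in> {1..N}. v mod m = j} \<le> N div m + 1" by simp
  then have "real (card {v \<in> {1..N}. v mod m = j}) \<le> real (N div m) + 1" by linarith
  moreover have "real (N div m) \<le> real N / real m" by (rule of_nat_div_le_of_nat)
  ultimately show ?thesis by linarith
qed

section \<open>The three phases\<close>

text \<open>
  The assumptions that involve \<open>N\<close> hold for all large \<open>N\<close> if the parameters are
  chosen suitably. The exponent \<open>\<eta>\<close> bounds the flip
  probability of a red vertex near balance by \<open>N powr (- \<eta>)\<close>, and small multiples of it separate the
  scales: the first phase ends at the advantage \<open>N powr (1/2 + \<eta>/8)\<close>, and the second one fails
  when the advantage, possibly after a shift, falls below \<open>N powr (1/2 + \<eta>/16)\<close>.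
\<close>

locale large_population =
  fixes a b \<delta> \<xi>0 \<eta> \<epsilon> :: real and N :: nat
  assumes b: "1 < b" "b < a" and \<delta>: "0 < \<delta>" "\<delta> \<le> 1 / 16" and \<eta>: "0 < \<eta>" "\<eta> \<le> 1" and \<epsilon>: "0 < \<epsilon>"
    and N1: "1 \<le> N" and lnN: "1 \<le> ln (real N)" "1 \<le> (a - b) * ln (real N)" "1 \<le> \<eta> / 8 * ln (real N)"
    and a_half: "edge_prob a N \<le> 1 / 2"
    and few_red: "\<And>y m. is_configuration N y \<Longrightarrow> real (card (red N y)) \<le> \<delta> * real N \<Longrightarrow>
       survival a b N (Suc m) y \<le> real N powr (- \<xi>0)"
    and lower: "\<And>R R0. \<delta> * real N < real R \<Longrightarrow> 2 * R \<le> N \<Longrightarrow> R0 \<le> N \<Longrightarrow>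
       real R \<le> real R0 + real N powr (3 / 4) \<Longrightarrow>
       real N powr (- (rate_I (a * real R0 / real N) (b * real (N - R0) / real N) + \<epsilon> / 2))
         \<le> outvote (N - R) (edge_prob b N) (R - 1) (edge_prob a N)"
    and upper: "\<And>R. real N / 2 - real N powr (1 / 2 + \<eta> / 8) \<le> real R \<Longrightarrow> 2 * R \<le> N \<Longrightarrow>
       outvote (N - R) (edge_prob b N) (R - 1) (edge_prob a N) \<le> real N powr (- \<eta>)"
    and large_floor: "320 * (1 + 2 * a) * ln (real N) * real N \<le> \<delta> * (real N powr (1 / 2 + \<eta> / 16))\<^sup>2"
    and early: "(a - b) * ln (real N) * real N powr (1 / 2 + \<eta> / 8) \<le> real N"
    and rare: "24 * (1 + (a - b)) * (ln (real N))\<^sup>2 * real N powr (- \<eta>) \<le> 1"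
    and blocks: "4 * a * ln (real N) \<le> real N"
    and tail1: "real N powr (\<eta> / 8) * (2 * (4 * a * ln (real N) + 2))
        * exp (3 - real N powr (\<eta> / 4) / (64 * (ln (real N))\<^sup>2 * (4 * a * ln (real N) + 2)))
      \<le> \<delta> * real N powr (- (a + \<epsilon>)) * real N powr (- (\<eta> / 8)) / (16 * ln (real N))"
    and tail2: "real N powr (\<eta> / 8) * (2 * (4 * a * ln (real N) + 2))
        * (4096 * (4 * a * ln (real N) + 2)\<^sup>2 * (9 + 2 * a * ln (real N)) * ln (real N) ^ 3 * real N powr (- \<eta>))
      \<le> \<delta> * real N powr (- (\<eta> / 8)) / (16 * ln (real N))"
begin

abbreviation "\<l> \<equiv> ln (real N)"

lemma N0: "0 < real N" using N1 by simp

lemma Ngt1: "1 < real N"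
proof -
  have "real N \<noteq> 1" using lnN by auto
  then show ?thesis using N1 by linarith
qed

lemma le_ln: "K \<le> \<eta> / 8 * \<l> \<Longrightarrow> K \<le> \<l>"
proof -
  have "\<eta> / 8 * \<l> \<le> 1 * \<l>" by (rule mult_right_mono) (use \<eta> lnN in auto)
  then show "K \<le> \<eta> / 8 * \<l> \<Longrightarrow> K \<le> \<l>" by simp
qed

lemma red_le_half:
  assumes "is_configuration N y" "0 \<le> advantage N y"
  shows "2 * card (red N y) \<le> N" "real (card (red N y)) = (real N - advantage N y) / 2"
    "card (blue N y) = N - card (red N y)" "advantage N y \<le> real N"
  using card_blue_red [OF assms(1)] assms(2) by (auto simp: advantage_def)

text \<open>
  A lower bound for the flip probability of a red vertex that is valid in all active configurations:
  its exponent belongs to the initial configuration, and \<open>\<epsilon> / 2\<close> absorbs the losses.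
\<close>

definition rate :: "configuration \<Rightarrow> real" where
  "rate y0 = real N powr (- (exponent0 a b N y0 + \<epsilon> / 2))"

lemma exponent0_range:
  assumes "is_configuration N y0"
  shows "0 \<le> exponent0 a b N y0" "exponent0 a b N y0 \<le> a"
proof -
  let ?x = "a * real (card (red N y0)) / real N" and ?y = "b * real (card (blue N y0)) / real N"
  show "0 \<le> exponent0 a b N y0" by (simp add: exponent0_def rate_I_def)
  have "card (red N y0) \<le> N" using card_blue_red [OF assms] by simp
  then have x: "?x \<le> a" using b N0 by (simp add: pos_divide_le_eq)
  have nn: "0 \<le> ?x" "0 \<le> ?y" using b by auto
  then have "max (sqrt ?x - sqrt ?y) 0 \<le> sqrt ?x" by simp
  then have "(max (sqrt ?x - sqrt ?y) 0)\<^sup>2 \<le> (sqrt ?x)\<^sup>2" by (intro power_mono) auto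
  then show "exponent0 a b N y0 \<le> a" using x nn by (simp add: exponent0_def rate_I_def)
qed

lemma rate_range:
  assumes "is_configuration N y0"
  shows "0 < rate y0" "rate y0 \<le> 1" "real N powr (- (a + \<epsilon>)) \<le> rate y0"
proof -
  note r = exponent0_range [OF assms]
  show "0 < rate y0" using N0 by (simp add: rate_def)
  have "rate y0 \<le> real N powr 0" unfolding rate_def using r \<epsilon> Ngt1 by (intro powr_mono) auto
  then show "rate y0 \<le> 1" using N0 by simp
  show "real N powr (- (a + \<epsilon>)) \<le> rate y0" unfolding rate_def using r \<epsilon> Ngt1 by (intro powr_mono) auto
qed

lemma rate_le_red_flip_prob:
  assumes y: "is_configuration N y" "0 \<le> advantage N y" "\<delta> * real N < real (card (red N y))"
    and y0: "is_configuration N y0" and close: "advantage N y0 - advantage N y \<le> 2 * real N powr (3 / 4)"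
  shows "rate y0 \<le> red_flip_prob a b N y"
proof -
  have R0: "card (red N y0) \<le> N" "card (blue N y0) = N - card (red N y0)"
    using card_blue_red [OF y0] by auto
  have "real (card (red N y0)) = (real N - advantage N y0) / 2"
    using card_blue_red [OF y0] by (simp add: advantage_def)
  then have "real (card (red N y)) \<le> real (card (red N y0)) + real N powr (3 / 4)"
    using close red_le_half(2) [OF y(1,2)] by simp
  from lower [OF y(3) red_le_half(1) [OF y(1,2)] R0(1) this] show ?thesis
    by (simp add: rate_def exponent0_def red_flip_prob_def R0(2) red_le_half(3) [OF y(1,2)])
qed

lemma red_flip_prob_rare:
  assumes y: "is_configuration N y" "0 \<le> advantage N y" and small: "advantage N y \<le> real N powr (1 / 2 + \<eta> / 8)"
  shows "red_flip_prob a b N y \<le> real N powr (- \<eta>)"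
proof -
  define P where "P = real N powr (1 / 2 + \<eta> / 8)"
  have "0 \<le> P" "advantage N y \<le> P" using small by (simp_all add: P_def)
  then have "real N / 2 - P \<le> real (card (red N y))"
    unfolding red_le_half(2) [OF y] by (simp add: diff_divide_distrib)
  then have "real N / 2 - real N powr (1 / 2 + \<eta> / 8) \<le> real (card (red N y))"
    by (simp only: P_def)
  from upper [OF this red_le_half(1) [OF y]] show ?thesis
    by (simp add: red_flip_prob_def red_le_half(3) [OF y])
qed

lemma round:
  assumes "is_configuration N y" "0 \<le> advantage N y" "\<delta> * real N < real (card (red N y))"
  shows "round a b N y \<delta>"
  by standard (use assms b \<delta> N1 a_half lnN in auto)

text \<open>
  The second phase, from an advantage of slightly more than \<open>sqrt N\<close> to few red vertices. The same
  function, up to scaling, bounds the probability of failure and runs the clock. The shift \<open>s\<close> keeps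
  the advantage from falling far below its initial value; otherwise the flip probability could drop
  below the rate prescribed by the initial configuration.
\<close>

lemma survival_phase_2:
  assumes y0: "is_configuration N y0" and s: "0 \<le> s" "advantage N y0 - real N powr (3 / 4) \<le> s"
    and y: "is_configuration N y"
  defines "L \<equiv> real N powr (1 / 2 + \<eta> / 16)"
  shows "survival a b N (1 + n) y \<le> real N powr (- \<xi>0) + L / max (advantage N y - s) L
     + (1 - \<delta> * rate y0 / 2) ^ n * (real N / max (advantage N y - s) L)"
proof -
  have L: "0 < L" using N0 by (simp add: L_def)
  let ?h = "\<lambda>y. 1 / max (advantage N y - s) L"
  have h0: "0 \<le> ?h y" for y using L by simp
  have dr: "0 \<le> \<delta> * rate y0 / 2" "\<delta> * rate y0 / 2 \<le> 1"
  proof -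
    show "0 \<le> \<delta> * rate y0 / 2" using rate_range [OF y0] \<delta> by simp
    have "\<delta> * rate y0 \<le> 1 * 1" using rate_range [OF y0] \<delta> by (intro mult_mono) auto
    then show "\<delta> * rate y0 / 2 \<le> 1" by simp
  qed
  have "survival a b N (1 + n) y \<le> real N powr (- \<xi>0) + L * ?h y + (1 - \<delta> * rate y0 / 2) ^ n * (real N * ?h y)"
  proof (rule survival_le_potentials [where A = "\<lambda>y. real (card (red N y)) \<le> \<delta> * real N"
        and f = "\<lambda>y. L * ?h y" and g = "\<lambda>y. real N * ?h y"])
    show "0 \<le> L * ?h y" "0 \<le> real N * ?h y" for y using L by auto
    show "survival a b N (1 + m) y \<le> real N powr (- \<xi>0)"
      if "is_configuration N y" "real (card (red N y)) \<le> \<delta> * real N" for y m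
      using few_red [OF that] by simp
    fix y assume c: "is_configuration N y" and R: "\<not> real (card (red N y)) \<le> \<delta> * real N" and f1: "L * ?h y < 1"
    have "L < max (advantage N y - s) L" using f1 L by (simp add: pos_divide_less_eq)
    then have X: "L \<le> advantage N y - s" by simp
    then have adv: "0 \<le> advantage N y" "0 < advantage N y - s" using s L by auto
    have R': "\<delta> * real N < real (card (red N y))" using R by simp
    interpret r: round a b N y \<delta> by (rule round [OF c adv(1) R'])
    have close: "advantage N y0 - advantage N y \<le> 2 * real N powr (3 / 4)"
    proof -
      have "0 \<le> real N powr (3 / 4)" by simp
      then show ?thesis using s(2) X L by linarith
    qed
    have "expect (random_graph_pmf a b N y) (\<lambda>G. ?h (majority_update N G y))
      \<le> (1 - \<delta> * rate y0 / 2) * (1 / (advantage N y - s))"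
    proof (rule r.reciprocal_step_large [OF s(1) L X])
      show "0 < rate y0" by (rule rate_range [OF y0])
      show "rate y0 \<le> red_flip_prob a b N y" by (rule rate_le_red_flip_prob [OF c adv(1) R' y0 close])
      show "320 * (1 + 2 * a) * \<l> * real N \<le> \<delta> * L\<^sup>2" unfolding L_def by (rule large_floor)
    qed
    also have "1 / (advantage N y - s) = ?h y" using X by (simp add: max_absorb1)
    finally have h: "expect (random_graph_pmf a b N y) (\<lambda>G. ?h (majority_update N G y)) \<le> (1 - \<delta> * rate y0 / 2) * ?h y" .
    have h1: "(1 - \<delta> * rate y0 / 2) * ?h y \<le> 1 * ?h y" by (rule mult_right_mono [OF _ h0]) (use dr in simp)
    have "1 \<le> real N * ?h y"
      using X adv s red_le_half(4) [OF c adv(1)] by (simp add: max_absorb1)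
    moreover have "expect (random_graph_pmf a b N y) (\<lambda>G. L * ?h (majority_update N G y)) \<le> L * ?h y"
      unfolding integral_mult_right_zero by (rule mult_left_mono) (use h h1 L in linarith)+
    moreover have "expect (random_graph_pmf a b N y) (\<lambda>G. real N * ?h (majority_update N G y))
      \<le> (1 - \<delta> * rate y0 / 2) * (real N * ?h y)"
      unfolding integral_mult_right_zero mult.left_commute [of "1 - \<delta> * rate y0 / 2" "real N"]
      by (rule mult_left_mono [OF h]) simp
    ultimately show "1 \<le> real N * ?h y
      \<and> expect (random_graph_pmf a b N y) (\<lambda>G. L * ?h (majority_update N G y)) \<le> L * ?h y
      \<and> expect (random_graph_pmf a b N y) (\<lambda>G. real N * ?h (majority_update N G y))
        \<le> (1 - \<delta> * rate y0 / 2) * (real N * ?h y)" by blast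
  qed (use dr y in auto)
  then show ?thesis by simp
qed

text \<open>
  The margin between the two powers of \<open>N\<close> makes the failure probability of the second phase
  polynomially small.
\<close>

lemma survival_after_phase_1:
  assumes y0: "is_configuration N y0" and s: "0 \<le> s" "advantage N y0 - real N powr (3 / 4) \<le> s"
    and y: "is_configuration N y" and X: "real N powr (1 / 2 + \<eta> / 8) \<le> advantage N y - s"
  shows "survival a b N (1 + n) y \<le> real N powr (- \<xi>0) + real N powr (- (\<eta> / 16))
     + (1 - \<delta> * rate y0 / 2) ^ n * real N"
proof -
  define L where "L = real N powr (1 / 2 + \<eta> / 16)"
  define U where "U = real N powr (1 / 2 + \<eta> / 8)"
  have LU: "0 < L" "L \<le> U" "1 \<le> U"
  proof -
    show "0 < L" using N0 by (simp add: L_def)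
    show "L \<le> U" unfolding L_def U_def using Ngt1 \<eta> by (intro powr_mono) auto
    have "real N powr 0 \<le> U" unfolding U_def using Ngt1 \<eta> by (intro powr_mono) auto
    then show "1 \<le> U" using N0 by simp
  qed
  let ?X = "advantage N y - s"
  have X': "U \<le> ?X" using X by (simp add: U_def)
  then have m: "max ?X L = ?X" using LU by simp
  have "\<delta> * rate y0 \<le> 1 * 1" using rate_range [OF y0] \<delta> by (intro mult_mono) auto
  then have q: "0 \<le> (1 - \<delta> * rate y0 / 2) ^ n" by (intro zero_le_power) simp
  have "L / ?X \<le> L / U" using LU X' by (intro divide_left_mono) auto
  also have "\<dots> = real N powr (- (\<eta> / 16))"
    unfolding L_def U_def using N0 by (simp add: powr_diff [symmetric])
  finally have 1: "L / ?X \<le> real N powr (- (\<eta> / 16))" .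
  have "real N / ?X \<le> real N / 1" using LU X' by (intro divide_left_mono) auto
  then have "(1 - \<delta> * rate y0 / 2) ^ n * (real N / ?X) \<le> (1 - \<delta> * rate y0 / 2) ^ n * real N"
    using q by (intro mult_left_mono) auto
  then show ?thesis
    using survival_phase_2 [OF y0 s y, of n] 1 unfolding L_def [symmetric] m by linarith
qed

text \<open>
  The lower tail in the exponential potential is negligible. The exponential part is
  superpolynomially small by the choice of \<open>s\<close>. The Chebyshev part is \<open>p\<^sup>2\<close> up to
  logarithms; one factor \<open>p \<le> N powr (- \<eta>)\<close> pays for \<open>exp K \<le> N powr (\<eta>/8)\<close> and for
  \<open>T / L\<close>, which is at most \<open>N powr (\<eta>/8)\<close> up to logarithms.
\<close>

lemma tail_bound:
  assumes K: "1 \<le> K" "K \<le> \<eta> / 8 * \<l>" and p: "real N powr (- (a + \<epsilon>)) \<le> p" "p \<le> real N powr (- \<eta>)"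
    and L: "real N \<le> 4 * \<l> * L\<^sup>2" "0 < L" and T: "L \<le> T" "T \<le> real N powr (1 / 2 + \<eta> / 8)"
    and m: "0 < m" "m \<le> 4 * a * \<l> + 2" and s: "s = real N powr (- 1 / 2 + \<eta> / 4)"
  shows "exp K * (2 * m * (exp (3 * s\<^sup>2 * (real N * p) - s * (T / (32 * K * m)))
          + 64 * m ^ 2 * (9 * real N * p\<^sup>2 + 2 * edge_prob a N * (real N * p)\<^sup>2) / (T / (4 * K))\<^sup>2))
        \<le> \<delta> * p * L / (4 * T)"
proof -
  define M where "M = 4 * a * \<l> + 2"
  have l: "1 \<le> \<l>" by (rule lnN)
  have a0: "0 < a" using b by simp
  have M: "0 < M" "m \<le> M" using m a0 l by (auto simp: M_def add_nonneg_pos)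
  have p0: "0 < p" using p(1) N0 by (smt (verit) powr_gt_zero)
  have T0: "0 < T" using L T by simp
  have Kl: "K \<le> \<l>" by (rule le_ln [OF K(2)])
  have eK: "exp K \<le> real N powr (\<eta> / 8)" using K N0 by (simp add: powr_def)
  have sqrtN: "sqrt (real N) \<le> 2 * \<l> * L"
  proof -
    have "real N \<le> 4 * \<l> * L\<^sup>2" by (rule L)
    also have "\<dots> \<le> 4 * (\<l> * \<l>) * L\<^sup>2" using l by (intro mult_right_mono mult_left_mono) auto
    also have "\<dots> = (2 * \<l> * L)\<^sup>2" by (simp add: power2_eq_square)
    finally show ?thesis using l L by (intro real_le_lsqrt) auto
  qed
  have Nhalf: "sqrt (real N) = real N powr (1 / 2)" using N0 by (simp add: powr_half_sqrt)
  have LT: "real N powr (- (\<eta> / 8)) / (2 * \<l>) \<le> L / T"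
  proof -
    have "real N powr (- (\<eta> / 8)) * real N powr (1 / 2 + \<eta> / 8) = real N powr (1 / 2)"
      by (simp add: powr_add [symmetric])
    then have "real N powr (- (\<eta> / 8)) * T \<le> real N powr (1 / 2)"
      using mult_left_mono [OF T(2), of "real N powr (- (\<eta> / 8))"] by simp
    also have "\<dots> \<le> L * (2 * \<l>)" using sqrtN Nhalf by (simp add: mult_ac)
    finally show ?thesis using T0 l by (simp add: divide_le_eq pos_le_divide_eq mult_ac)
  qed
  define G where "G = \<delta> * real N powr (- (\<eta> / 8)) / (16 * \<l>)"
  have G: "2 * (G * p) \<le> \<delta> * p * L / (4 * T)"
  proof -
    have "2 * (G * p) = \<delta> * p / 4 * (real N powr (- (\<eta> / 8)) / (2 * \<l>))" by (simp add: G_def)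
    also have "\<dots> \<le> \<delta> * p / 4 * (L / T)" using LT \<delta> p0 by (intro mult_left_mono) auto
    finally show ?thesis by simp
  qed
  define E1 where "E1 = exp (3 * s\<^sup>2 * (real N * p) - s * (T / (32 * K * m)))"
  define E2 where "E2 = 64 * m ^ 2 * (9 * real N * p\<^sup>2 + 2 * edge_prob a N * (real N * p)\<^sup>2) / (T / (4 * K))\<^sup>2"
  have E1: "E1 \<le> exp (3 - real N powr (\<eta> / 4) / (64 * \<l>\<^sup>2 * M))"
  proof -
    have "s\<^sup>2 * (real N * p) \<le> s\<^sup>2 * (real N * real N powr (- \<eta>))" using p N0 by (intro mult_left_mono) auto
    also have "\<dots> = real N powr ((- 1 / 2 + \<eta> / 4) + (- 1 / 2 + \<eta> / 4) + (1 + - \<eta>))"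
      using N0 by (simp only: s power2_eq_square powr_add powr_one mult_ac)
    also have "\<dots> \<le> real N powr 0" using Ngt1 \<eta> by (intro powr_mono) auto
    finally have x1: "s\<^sup>2 * (real N * p) \<le> 1" using N0 by simp
    have "real N powr (\<eta> / 4) = s * real N powr (1 / 2)"
      by (simp add: s powr_add [symmetric])
    also have "\<dots> \<le> s * (2 * \<l> * T)"
    proof (rule mult_left_mono)
      have "2 * \<l> * L \<le> 2 * \<l> * T" using T l by (intro mult_left_mono) auto
      then show "real N powr (1 / 2) \<le> 2 * \<l> * T" using sqrtN Nhalf by simp
    qed (simp add: s)
    finally have "real N powr (\<eta> / 4) / (64 * \<l>\<^sup>2 * M) \<le> s * (2 * \<l> * T) / (64 * \<l>\<^sup>2 * M)"
      using l M by (intro divide_right_mono) auto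
    also have "\<dots> = s * T / (32 * \<l> * M)" using l M by (simp add: field_simps power2_eq_square)
    also have "\<dots> \<le> s * T / (32 * K * m)"
      using l M m K Kl T0 by (intro divide_left_mono mult_mono mult_pos_pos) (auto simp: s)
    finally have x2: "real N powr (\<eta> / 4) / (64 * \<l>\<^sup>2 * M) \<le> s * (T / (32 * K * m))" by simp
    show ?thesis unfolding E1_def using x1 x2 by simp
  qed
  have E2: "E2 \<le> 4096 * M\<^sup>2 * (9 + 2 * a * \<l>) * \<l> ^ 3 * real N powr (- \<eta>) * p"
  proof -
    have e: "9 * real N * p\<^sup>2 + 2 * edge_prob a N * (real N * p)\<^sup>2 = real N * (9 + 2 * a * \<l>) * p\<^sup>2"
      using N0 by (simp add: edge_prob_def field_simps power2_eq_square)
    have "E2 = 1024 * (m\<^sup>2 * (9 + 2 * a * \<l>)) * K\<^sup>2 * p\<^sup>2 * (real N / T\<^sup>2)"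
      unfolding E2_def e using T0 K by (simp add: field_simps power2_eq_square)
    also have "\<dots> \<le> 1024 * (M\<^sup>2 * (9 + 2 * a * \<l>)) * \<l>\<^sup>2 * (real N powr (- \<eta>) * p) * (4 * \<l>)"
    proof (intro mult_mono)
      show "m\<^sup>2 \<le> M\<^sup>2" using m M by (intro power_mono) auto
      show "K\<^sup>2 \<le> \<l>\<^sup>2" using K Kl by (intro power_mono) auto
      show "p\<^sup>2 \<le> real N powr (- \<eta>) * p" using p p0 by (simp add: power2_eq_square)
      have "real N \<le> 4 * \<l> * T\<^sup>2"
      proof -
        have "4 * \<l> * L\<^sup>2 \<le> 4 * \<l> * T\<^sup>2" using L T l by (intro mult_left_mono power_mono) auto
        then show ?thesis using L by linarith
      qed
      then show "real N / T\<^sup>2 \<le> 4 * \<l>" using T0 by (simp add: pos_divide_le_eq)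
    qed (use a0 l K p0 in auto)
    also have "\<dots> = 4096 * M\<^sup>2 * (9 + 2 * a * \<l>) * \<l> ^ 3 * real N powr (- \<eta>) * p"
      by (simp add: power2_eq_square power3_eq_cube)
    finally show ?thesis .
  qed
  have pre: "exp K * (2 * m) \<le> real N powr (\<eta> / 8) * (2 * M)"
    using eK M m by (intro mult_mono) auto
  have pre0: "0 \<le> exp K * (2 * m)" using m by simp
  have "exp K * (2 * m) * E1 \<le> real N powr (\<eta> / 8) * (2 * M) * exp (3 - real N powr (\<eta> / 4) / (64 * \<l>\<^sup>2 * M))"
    by (rule mult_mono [OF pre E1]) (use M in \<open>auto simp: E1_def\<close>)
  also have "\<dots> \<le> \<delta> * real N powr (- (a + \<epsilon>)) * real N powr (- (\<eta> / 8)) / (16 * \<l>)"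
    unfolding M_def by (rule tail1)
  also have "\<dots> = G * real N powr (- (a + \<epsilon>))" by (simp add: G_def)
  also have "\<dots> \<le> G * p" using p \<delta> l by (intro mult_left_mono) (auto simp: G_def)
  finally have t1: "exp K * (2 * m) * E1 \<le> G * p" .
  have "0 \<le> E2"
    unfolding E2_def using a0 l by (auto intro!: divide_nonneg_nonneg mult_nonneg_nonneg add_nonneg_nonneg simp: edge_prob_def)
  then have "exp K * (2 * m) * E2 \<le> real N powr (\<eta> / 8) * (2 * M)
      * (4096 * M\<^sup>2 * (9 + 2 * a * \<l>) * \<l> ^ 3 * real N powr (- \<eta>) * p)"
    by (intro mult_mono [OF pre E2]) (use M in auto)
  also have "\<dots> = real N powr (\<eta> / 8) * (2 * M)
      * (4096 * M\<^sup>2 * (9 + 2 * a * \<l>) * \<l> ^ 3 * real N powr (- \<eta>)) * p" by simp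
  also have "\<dots> \<le> G * p"
    using tail2 p0 unfolding M_def [symmetric] G_def [symmetric] by (intro mult_right_mono) auto
  finally have t2: "exp K * (2 * m) * E2 \<le> G * p" .
  have "exp K * (2 * m * (E1 + E2)) = exp K * (2 * m) * E1 + exp K * (2 * m) * E2"
    by (simp add: algebra_simps)
  then show ?thesis unfolding E1_def [symmetric] E2_def [symmetric] using t1 t2 G by linarith
qed

text \<open>
  The first phase, where the advantage is too small for second moments alone to give the claimed
  failure probability. Failing means that the advantage drops to half of its initial value.
  The exponential potential bounds the probability of this by \<open>exp (- K / 2)\<close>, while the reciprocal of
  the advantage runs the clock.
\<close>

lemma survival_phase_1:
  assumes y0: "is_configuration N y0" and adv0: "0 < advantage N y0" "advantage N y0 < real N powr (1 / 2 + \<eta> / 8)"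
    and big: "real N \<le> (advantage N y0)\<^sup>2 * \<l>" "1280 * (1 + 2 * a) * real N \<le> \<delta> * (a - b) * ((advantage N y0)\<^sup>2 * \<l>)"
    and K: "1 \<le> K" "K \<le> \<eta> / 8 * \<l>" "768 * (1 + 2 * a) * real N * K \<le> \<delta> * (a - b) * ((advantage N y0)\<^sup>2 * \<l>)"
  shows "survival a b N (1 + n + n') y0 \<le>
    (real N powr (- \<xi>0) + real N powr (- (\<eta> / 16)) + (1 - \<delta> * rate y0 / 2) ^ n * real N)
    + exp (- K / 2) + (1 - \<delta> * rate y0 / 2) ^ n' * real N"
proof -
  define L where "L = advantage N y0 / 2"
  have L: "0 < L" using adv0 by (simp add: L_def)
  have a0: "0 < a" using b by simp
  have l: "1 \<le> \<l>" by (rule lnN)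
  have LL: "(advantage N y0)\<^sup>2 * \<l> = 4 * \<l> * L\<^sup>2" by (simp add: L_def power2_eq_square)
  define q where "q = \<delta> * rate y0 / 2"
  have q: "0 \<le> q" "q \<le> 1"
  proof -
    show "0 \<le> q" using rate_range [OF y0] \<delta> by (simp add: q_def)
    have "\<delta> * rate y0 \<le> 1 * 1" using rate_range [OF y0] \<delta> by (intro mult_mono) auto
    then show "q \<le> 1" by (simp add: q_def)
  qed
  define e0 where "e0 = real N powr (- \<xi>0) + real N powr (- (\<eta> / 16)) + (1 - q) ^ n * real N"
  have qn: "0 \<le> (1 - q) ^ n * real N" "0 \<le> (1 - q) ^ n'" using q by auto
  have e0: "real N powr (- \<xi>0) \<le> e0" "0 \<le> e0" using qn by (auto simp: e0_def intro: add_nonneg_nonneg)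
  have N34: "real N powr (1 / 2 + \<eta> / 8) \<le> real N powr (3 / 4)"
    using Ngt1 \<eta> by (intro powr_mono) auto
  have s0: "advantage N y0 - real N powr (3 / 4) \<le> 0" using adv0 N34 by simp
  let ?f = "\<lambda>y. exp (K * (L / max (advantage N y) L - 1))"
  let ?h = "\<lambda>y. 1 / max (advantage N y) L"
  have h0: "0 \<le> ?h y" for y using L by simp
  have "survival a b N ((1 + n) + n') y0 \<le> e0 + ?f y0 + (1 - q) ^ n' * (real N * ?h y0)"
  proof (rule survival_le_potentials [where g = "\<lambda>y. real N * ?h y"
        and A = "\<lambda>y. real (card (red N y)) \<le> \<delta> * real N \<or> real N powr (1 / 2 + \<eta> / 8) \<le> advantage N y"])
    show "0 \<le> ?f y" "0 \<le> real N * ?h y" for y using L by auto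
    show "survival a b N (1 + n + m) y \<le> e0"
      if c: "is_configuration N y" and A: "real (card (red N y)) \<le> \<delta> * real N \<or> real N powr (1 / 2 + \<eta> / 8) \<le> advantage N y" for y m
      using A
    proof
      assume "real (card (red N y)) \<le> \<delta> * real N"
      from few_red [OF c this, of "n + m"] e0 show ?thesis by simp
    next
      assume "real N powr (1 / 2 + \<eta> / 8) \<le> advantage N y"
      then have "survival a b N (1 + n) y \<le> e0"
        using survival_after_phase_1 [OF y0 order_refl s0 c, of n] by (simp add: e0_def q_def)
      moreover have "survival a b N (1 + n + m) y \<le> survival a b N (1 + n) y"
        by (rule survival_antimono [OF c]) simp
      ultimately show ?thesis by linarith
    qed
    fix y assume c: "is_configuration N y"
      and A: "\<not> (real (card (red N y)) \<le> \<delta> * real N \<or> real N powr (1 / 2 + \<eta> / 8) \<le> advantage N y)"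
      and f1: "?f y < 1"
    have R: "\<delta> * real N < real (card (red N y))" and small: "advantage N y \<le> real N powr (1 / 2 + \<eta> / 8)" using A by auto
    have X: "L < advantage N y"
    proof (rule ccontr)
      assume "\<not> L < advantage N y"
      then have "max (advantage N y) L = L" by simp
      then show False using f1 L by simp
    qed
    then have adv: "0 \<le> advantage N y" "0 < advantage N y" "L \<le> advantage N y" using L by auto
    have mx: "max (advantage N y) L = advantage N y" using adv by simp
    interpret r: round a b N y \<delta> by (rule round [OF c adv(1) R])
    have "advantage N y0 - advantage N y \<le> 2 * real N powr (3 / 4)"
      using adv0 N34 adv powr_ge_zero[of "real N" "3 / 4"] by linarith
    then have low: "rate y0 \<le> red_flip_prob a b N y" by (rule rate_le_red_flip_prob [OF c adv(1) R y0])
    have rare_y: "red_flip_prob a b N y \<le> real N powr (- \<eta>)" by (rule red_flip_prob_rare [OF c adv(1) small])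
    let ?p = "red_flip_prob a b N y"
    have p0: "0 < ?p" using low rate_range [OF y0] by linarith
    have u: "(a - b) * \<l> * advantage N y \<le> real N"
    proof -
      have "(a - b) * \<l> * advantage N y \<le> (a - b) * \<l> * real N powr (1 / 2 + \<eta> / 8)"
        using small b l by (intro mult_left_mono) auto
      then show ?thesis using early by linarith
    qed
    have pl: "c * \<l> * ?p \<le> 1" if "0 \<le> c" "c \<le> 24 * (1 + (a - b)) * \<l>" for c
    proof -
      have "c * \<l> * ?p \<le> (24 * (1 + (a - b)) * \<l>) * \<l> * real N powr (- \<eta>)"
        using that l b rare_y p0 by (intro mult_mono) auto
      then show ?thesis using rare by (simp add: power2_eq_square mult_ac)
    qed
    have bl: "1 * 1 \<le> (1 + (a - b)) * \<l>" using b l by (intro mult_mono) auto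
    have le24: "x \<le> 24 * Y" if "x * 1 \<le> Y" "1 * 1 \<le> Y" for x Y :: real
      using that by linarith
    have bl24: "1 \<le> 24 * (1 + (a - b)) * \<l>" unfolding mult.assoc by (rule le24 [OF bl bl])
    have pl1: "\<l> * ?p \<le> 1" using pl [OF zero_le_one bl24] by (simp only: mult_1)
    have pl2: "(a - b) * \<l> * ?p \<le> 1"
    proof (rule pl)
      have "(a - b) * 1 \<le> (1 + (a - b)) * \<l>" using b l by (intro mult_mono) auto
      then show "a - b \<le> 24 * (1 + (a - b)) * \<l>" unfolding mult.assoc using bl le24 by blast
    qed (use b in simp)
    have pl3: "24 * K * ((a - b) * \<l> * ?p) \<le> 1"
    proof -
      have "K \<le> \<l>" by (rule le_ln [OF K(2)])
      then have "(a - b) * K \<le> (1 + (a - b)) * \<l>" using b K by (intro mult_mono) auto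
      then have "24 * ((a - b) * K) \<le> 24 * ((1 + (a - b)) * \<l>)" by (rule mult_left_mono) simp
      then have "24 * ((a - b) * K) \<le> 24 * (1 + (a - b)) * \<l>" by (simp only: mult.assoc)
      then have "24 * ((a - b) * K) * \<l> * ?p \<le> 1" by (rule pl [rotated]) (use K b in simp)
      then show ?thesis by (simp only: mult_ac)
    qed
    have h: "expect (random_graph_pmf a b N y) (\<lambda>G. ?h (majority_update N G y)) \<le> (1 - q) * ?h y"
      unfolding mx q_def
    proof (rule r.reciprocal_step_small [OF L adv(3) _ low u pl1 pl2])
      show "0 < rate y0" by (rule rate_range [OF y0])
      show "320 * (1 + 2 * a) * real N \<le> \<delta> * (a - b) * \<l> * L\<^sup>2"
      proof -
        have "4 * (320 * (1 + 2 * a) * real N) = 1280 * (1 + 2 * a) * real N" by simp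
        also note big(2)
        also have "\<delta> * (a - b) * ((advantage N y0)\<^sup>2 * \<l>) = 4 * (\<delta> * (a - b) * \<l> * L\<^sup>2)"
          unfolding LL by (simp only: mult_ac)
        finally show ?thesis by (simp only: mult_le_cancel_left_pos zero_less_numeral)
      qed
    qed
    \<comment> \<open>so that a block has about \<open>N / (4 a ln N)\<close> vertices and \<open>2 \<alpha>\<close> times its size is at most \<open>1\<close>\<close>
    define m where "m = nat \<lceil>4 * a * \<l>\<rceil> + 1"
    have al0: "0 < 4 * a * \<l>" using a0 l by simp
    have m: "0 < m" "4 * a * \<l> \<le> real m" "real m \<le> 4 * a * \<l> + 2"
      using al0 unfolding m_def by linarith+
    define s where "s = real N powr (- 1 / 2 + \<eta> / 4)"
    have s: "0 \<le> s" "s \<le> 1"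
    proof -
      have "s \<le> real N powr 0" unfolding s_def using Ngt1 \<eta> by (intro powr_mono) auto
      then show "s \<le> 1" using N0 by simp
    qed (simp add: s_def)
    have f: "expect (random_graph_pmf a b N y) (\<lambda>G. ?f (majority_update N G y)) \<le> ?f y"
      unfolding mx
    proof (rule r.exponential_step [OF L adv(3) p0 K(1) u pl1 pl3 _ m(1) _ s])
      show "192 * (1 + 2 * a) * real N * K \<le> \<delta> * (a - b) * \<l> * L\<^sup>2"
      proof -
        have "4 * (192 * (1 + 2 * a) * real N * K) = 768 * (1 + 2 * a) * real N * K" by simp
        also note K(3)
        also have "\<delta> * (a - b) * ((advantage N y0)\<^sup>2 * \<l>) = 4 * (\<delta> * (a - b) * \<l> * L\<^sup>2)"
          unfolding LL by (simp only: mult_ac)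
        finally show ?thesis by (simp only: mult_le_cancel_left_pos zero_less_numeral)
      qed
      show "2 * edge_prob a N * real (card {v \<in> vertices N. v mod m = j}) \<le> 1" for j
      proof -
        have "2 * edge_prob a N * real (card {v \<in> vertices N. v mod m = j}) \<le> 2 * edge_prob a N * (real N / real m + 1)"
          unfolding vertices_def using r.alpha0 card_residue_class_le [OF m(1)] by (intro mult_left_mono) auto
        also have "\<dots> = 2 * a * \<l> / real m + 2 * a * \<l> / real N"
          using N0 m(1) by (simp add: edge_prob_def field_simps)
        also have "\<dots> \<le> 1 / 2 + 1 / 2"
          using m blocks N0 by (intro add_mono) (auto simp: pos_divide_le_eq)
        finally show ?thesis by simp
      qed
      show "exp K * (2 * real m * (exp (3 * s\<^sup>2 * (real N * ?p) - s * (advantage N y / (32 * K * real m)))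
          + 64 * real m ^ 2 * (9 * real N * ?p\<^sup>2 + 2 * edge_prob a N * (real N * ?p)\<^sup>2) / (advantage N y / (4 * K))\<^sup>2))
        \<le> \<delta> * ?p * L / (4 * advantage N y)"
      proof (rule tail_bound [OF K(1,2) _ rare_y _ L adv(3) small _ m(3) s_def])
        show "real N powr (- (a + \<epsilon>)) \<le> ?p" using rate_range(3) [OF y0] low by linarith
        show "real N \<le> 4 * \<l> * L\<^sup>2" using big(1) unfolding LL .
      qed (use m in simp)
    qed
    have "1 \<le> real N * ?h y"
      unfolding mx using adv red_le_half(4) [OF c adv(1)] by simp
    moreover have "expect (random_graph_pmf a b N y) (\<lambda>G. real N * ?h (majority_update N G y))
      \<le> (1 - q) * (real N * ?h y)"
      unfolding integral_mult_right_zero mult.left_commute [of "1 - q" "real N"]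
      by (rule mult_left_mono [OF h]) simp
    ultimately show "1 \<le> real N * ?h y
      \<and> expect (random_graph_pmf a b N y) (\<lambda>G. ?f (majority_update N G y)) \<le> ?f y
      \<and> expect (random_graph_pmf a b N y) (\<lambda>G. real N * ?h (majority_update N G y)) \<le> (1 - q) * (real N * ?h y)"
      using f by blast
  qed (use q e0 y0 in auto)
  moreover have "?f y0 = exp (- K / 2)" using adv0 by (simp add: L_def)
  moreover have "(1 - q) ^ n' * (real N * ?h y0) \<le> (1 - q) ^ n' * real N"
  proof (rule mult_left_mono [OF _ qn(2)])
    have "1 \<le> advantage N y0"
    proof -
      have "0 < card (blue N y0) - card (red N y0)" using adv0 by (simp add: advantage_def)
      then show ?thesis using adv0 by (simp add: advantage_def)
    qed
    then have "1 \<le> max (advantage N y0) L" by simp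
    then have "?h y0 \<le> 1" by simp
    then show "real N * ?h y0 \<le> real N" using N0 by (intro mult_left_le) auto
  qed
  ultimately show ?thesis unfolding e0_def q_def by (simp add: add_ac)
qed

end

section \<open>Time until all vertices are blue\<close>

text \<open>
  The time is split into one round for the last step and two equal parts for the two phases; each part
  exceeds the time scale \<open>1 / rate y0\<close> by the factor \<open>N powr (\<epsilon> / 2)\<close>, up to a constant. If the
  initial advantage is already large, the first phase is skipped.
\<close>

lemma (in large_population) survival_bound:
  assumes y0: "is_configuration N y0" "0 < advantage N y0"
    and \<xi>: "\<xi> \<le> \<xi>0" "\<xi> \<le> \<eta> / 16"
    and c: "0 < c" "1536 * (1 + 2 * a) * c \<le> \<delta> * (a - b)"
    and big: "real N \<le> (advantage N y0)\<^sup>2 * \<l>" "1280 * (1 + 2 * a) * real N \<le> \<delta> * (a - b) * ((advantage N y0)\<^sup>2 * \<l>)"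
      "real N \<le> 2 * c * ((advantage N y0)\<^sup>2 * \<l>)"
    and time: "real N * exp (- (\<delta> / 2) * (real N powr (\<epsilon> / 2) / 2 - 1)) \<le> real N powr (- \<xi>) / 2"
  shows "survival a b N (nat \<lceil>real N powr (exponent0 a b N y0 + \<epsilon>)\<rceil>) y0
    \<le> exp (- c * ((advantage N y0)\<^sup>2 * \<l> / real N)) + 4 * real N powr (- \<xi>)"
proof -
  define T where "T = nat \<lceil>real N powr (exponent0 a b N y0 + \<epsilon>)\<rceil>"
  define n where "n = (T - 1) div 2"
  define q where "q = \<delta> * rate y0 / 2"
  define X where "X = real N powr (- \<xi>)"
  define D where "D = (advantage N y0)\<^sup>2 * \<l> / real N"
  note r = rate_range [OF y0(1)] and e = exponent0_range [OF y0(1)]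
  have X0: "0 < X" using N0 by (simp add: X_def)
  have a0: "0 < a" using b by simp
  have TT: "real N powr (exponent0 a b N y0 + \<epsilon>) \<le> real T" unfolding T_def by linarith
  have "1 \<le> real N powr (exponent0 a b N y0 + \<epsilon>)"
    using Ngt1 e \<epsilon> by (intro ge_one_powr_ge_zero) auto
  then have T1: "1 \<le> T" using TT by linarith
  have nT: "1 + n + n \<le> T" "real T / 2 - 1 \<le> real n" using T1 unfolding n_def by linarith+
  have q: "0 \<le> q" "q \<le> 1"
  proof -
    show "0 \<le> q" using r \<delta> by (simp add: q_def)
    have "\<delta> * rate y0 \<le> 1 * 1" using r \<delta> by (intro mult_mono) auto
    then show "q \<le> 1" by (simp add: q_def)
  qed
  have geometric: "(1 - q) ^ n * real N \<le> X / 2"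
  proof -
    have "(\<delta> / 2) * (real N powr (\<epsilon> / 2) / 2 - 1) \<le> q * real n"
    proof -
      have "rate y0 * real N powr (exponent0 a b N y0 + \<epsilon>) = real N powr (\<epsilon> / 2)"
        unfolding rate_def powr_add [symmetric] by simp
      then have "real N powr (\<epsilon> / 2) \<le> rate y0 * real T"
        using mult_left_mono [OF TT, of "rate y0"] r by simp
      then have "real N powr (\<epsilon> / 2) / 2 - 1 \<le> rate y0 * (real T / 2 - 1)"
        using r by (simp add: right_diff_distrib)
      also have "\<dots> \<le> rate y0 * real n" using nT r by (intro mult_left_mono) auto
      finally have "(\<delta> / 2) * (real N powr (\<epsilon> / 2) / 2 - 1) \<le> (\<delta> / 2) * (rate y0 * real n)"
        using \<delta> by (intro mult_left_mono) auto
      then show ?thesis by (simp add: q_def)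
    qed
    then have "exp (- (q * real n)) \<le> exp (- (\<delta> / 2) * (real N powr (\<epsilon> / 2) / 2 - 1))" by simp
    moreover have "(1 - q) ^ n \<le> exp (- (q * real n))"
    proof -
      have "(1 - q) ^ n \<le> exp (- q) ^ n" using q exp_ge_add_one_self[of "- q"] by (intro power_mono) auto
      then show ?thesis by (simp add: exp_of_nat_mult [symmetric] mult.commute)
    qed
    ultimately have "(1 - q) ^ n \<le> exp (- (\<delta> / 2) * (real N powr (\<epsilon> / 2) / 2 - 1))"
      by (rule order_trans [rotated])
    then have "(1 - q) ^ n * real N \<le> exp (- (\<delta> / 2) * (real N powr (\<epsilon> / 2) / 2 - 1)) * real N"
      by (rule mult_right_mono) simp
    then show ?thesis using time by (simp add: X_def mult.commute)
  qed
  have pows: "real N powr (- \<xi>0) \<le> X" "real N powr (- (\<eta> / 16)) \<le> X"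
    unfolding X_def using \<xi> Ngt1 by (auto intro!: powr_mono)
  have "survival a b N T y0 \<le> exp (- c * D) + 4 * X"
  proof (cases "advantage N y0 < real N powr (1 / 2 + \<eta> / 8)")
    case False
    define s where "s = max 0 (advantage N y0 - real N powr (3 / 4))"
    have "real N powr (1 / 2 + \<eta> / 8) \<le> real N powr (3 / 4)" using Ngt1 \<eta> by (intro powr_mono) auto
    then have X: "real N powr (1 / 2 + \<eta> / 8) \<le> advantage N y0 - s" using False by (simp add: s_def)
    have s: "0 \<le> s" "advantage N y0 - real N powr (3 / 4) \<le> s" by (auto simp: s_def)
    have "survival a b N T y0 \<le> survival a b N (1 + n) y0"
      by (rule survival_antimono [OF y0(1)]) (use nT in simp)
    moreover have "survival a b N (1 + n) y0 \<le> real N powr (- \<xi>0) + real N powr (- (\<eta> / 16)) + (1 - q) ^ n * real N"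
      unfolding q_def by (rule survival_after_phase_1 [OF y0(1) s y0(1) X])
    moreover have "0 \<le> exp (- c * D)" by simp
    ultimately show ?thesis using geometric pows X0 by linarith
  next
    case True
    \<comment> \<open>the cap keeps \<open>exp K\<close> below \<open>N powr (\<eta> / 8)\<close>; where it is active, the failure probability is a negative power of \<open>N\<close>\<close>
    define K where "K = min (2 * c * D) (\<eta> / 8 * \<l>)"
    have "1 \<le> 2 * c * D" using big(3) N0 by (simp add: D_def pos_le_divide_eq)
    then have K: "1 \<le> K" "K \<le> \<eta> / 8 * \<l>" "K \<le> 2 * c * D" using lnN by (auto simp: K_def)
    have K3: "768 * (1 + 2 * a) * real N * K \<le> \<delta> * (a - b) * ((advantage N y0)\<^sup>2 * \<l>)"
    proof -
      have DN: "real N * D = (advantage N y0)\<^sup>2 * \<l>" using N0 by (simp add: D_def)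
      have "768 * (1 + 2 * a) * real N * K \<le> 768 * (1 + 2 * a) * real N * (2 * c * D)"
        using K a0 by (intro mult_left_mono) auto
      also have "\<dots> = (1536 * (1 + 2 * a) * c) * (real N * D)" by simp
      also have "\<dots> \<le> (\<delta> * (a - b)) * (real N * D)"
        using c lnN by (intro mult_right_mono) (auto simp: DN)
      finally show ?thesis unfolding DN .
    qed
    have "survival a b N T y0 \<le> survival a b N (1 + n + n) y0"
      by (rule survival_antimono [OF y0(1) nT(1)])
    moreover have "survival a b N (1 + n + n) y0 \<le>
      (real N powr (- \<xi>0) + real N powr (- (\<eta> / 16)) + (1 - q) ^ n * real N)
      + exp (- K / 2) + (1 - q) ^ n * real N"
      unfolding q_def by (rule survival_phase_1 [OF y0 True big(1,2) K(1,2) K3])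
    moreover have "exp (- K / 2) \<le> exp (- c * D) + X"
    proof (cases "2 * c * D \<le> \<eta> / 8 * \<l>")
      case True
      then show ?thesis using X0 by (simp add: K_def)
    next
      case False
      then have "exp (- K / 2) = real N powr (- (\<eta> / 16))" using N0 by (simp add: K_def powr_def)
      moreover have "0 \<le> exp (- c * D)" by simp
      ultimately show ?thesis using pows by linarith
    qed
    ultimately show ?thesis using geometric pows by linarith
  qed
  then show ?thesis by (simp only: T_def X_def D_def)
qed

theorem theorem1p8:
  fixes a b :: real
  assumes "1 < b" and "b < a"
  shows "\<exists>\<xi>>0. \<forall>\<epsilon>>0. \<exists>c>0. \<forall>y0 :: nat \<Rightarrow> configuration.
    (\<forall>N. is_configuration N (y0 N)) \<longrightarrow>
    (\<forall>N\<ge>1. advantage N (y0 N) > 0) \<longrightarrow>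
    filterlim (\<lambda>N. advantage N (y0 N) / sqrt (real N / ln (real N))) at_top sequentially \<longrightarrow>
    (\<forall>\<^sub>F N in sequentially.
       measure_pmf.prob
         (history_pmf a b N (y0 N) (nat \<lceil>real N powr (exponent0 a b N (y0 N) + \<epsilon>)\<rceil>))
         {Gs. red N (opinions N (y0 N) Gs) = {}}
       \<ge> 1 - exp (- c * ((advantage N (y0 N))\<^sup>2 * ln (real N) / real N))
           - 4 * real N powr (- \<xi>))"
proof -
  obtain \<delta> \<xi>0 where \<delta>: "0 < \<delta>" "\<delta> \<le> 1 / 16" and \<xi>0: "0 < \<xi>0"
    and few: "\<forall>\<^sub>F N::nat in sequentially. \<forall>y m. is_configuration N y \<longrightarrow> real (card (red N y)) \<le> \<delta> * real N \<longrightarrow>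
       survival a b N (Suc m) y \<le> real N powr (- \<xi>0)"
    by (rule survival_few_red [OF assms])
  define \<eta> where "\<eta> = min 1 ((sqrt a - sqrt b)\<^sup>2 / 4)"
  have \<eta>: "0 < \<eta>" "\<eta> \<le> 1" "\<eta> \<le> (sqrt a - sqrt b)\<^sup>2 / 4" using assms by (auto simp: \<eta>_def)
  define \<xi> where "\<xi> = min \<xi>0 (\<eta> / 16)"
  have \<xi>: "0 < \<xi>" "\<xi> \<le> \<xi>0" "\<xi> \<le> \<eta> / 16" using \<xi>0 \<eta> by (auto simp: \<xi>_def)
  \<comment> \<open>the constant depends on \<open>a\<close> and \<open>b\<close> only\<close>
  define c where "c = \<delta> * (a - b) / (1536 * (1 + 2 * a))"
  have a: "0 < a" and ab: "0 < a - b" using assms by auto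
  have c: "0 < c" "1536 * (1 + 2 * a) * c \<le> \<delta> * (a - b)"
    using \<delta> a ab by (auto simp: c_def)
  show ?thesis
  proof (rule exI [of _ \<xi>], rule conjI, rule \<xi>(1), intro allI impI,
      rule exI [of _ c], rule conjI, rule c(1), intro allI impI)
    fix \<epsilon> :: real and y0 :: "nat \<Rightarrow> configuration"
    assume \<epsilon>: "0 < \<epsilon>" and cfg: "\<forall>N. is_configuration N (y0 N)"
      and adv: "\<forall>N\<ge>1. advantage N (y0 N) > 0"
      and lim: "filterlim (\<lambda>N. advantage N (y0 N) / sqrt (real N / ln (real N))) at_top sequentially"
    define \<omega> where "\<omega> = 1 + 1280 * (1 + 2 * a) / (\<delta> * (a - b)) + 1 / (2 * c)"
    have \<omega>: "1 \<le> \<omega>" "1280 * (1 + 2 * a) / (\<delta> * (a - b)) \<le> \<omega>" "1 / (2 * c) \<le> \<omega>"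
    proof -
      have "0 \<le> 1280 * (1 + 2 * a) / (\<delta> * (a - b))" "0 \<le> 1 / (2 * c)" using a ab \<delta> c by auto
      then show "1 \<le> \<omega>" "1280 * (1 + 2 * a) / (\<delta> * (a - b)) \<le> \<omega>" "1 / (2 * c) \<le> \<omega>"
        unfolding \<omega>_def by linarith+
    qed
    have ev_lim: "\<forall>\<^sub>F N in sequentially. \<omega> \<le> advantage N (y0 N) / sqrt (real N / ln (real N))"
      using lim by (auto simp: filterlim_at_top)
    have ev_lower: "\<forall>\<^sub>F N::nat in sequentially. \<forall>R R0. \<delta> * real N < real R \<longrightarrow> 2 * R \<le> N \<longrightarrow> R0 \<le> N \<longrightarrow>
       real R \<le> real R0 + real N powr (3 / 4) \<longrightarrow>
       real N powr (- (rate_I (a * real R0 / real N) (b * real (N - R0) / real N) + \<epsilon> / 2))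
         \<le> outvote (N - R) (edge_prob b N) (R - 1) (edge_prob a N)"
      using assms \<delta> \<epsilon> by (intro red_flip_prob_lower) auto
    have ev_upper: "\<forall>\<^sub>F N::nat in sequentially. \<forall>R. real N / 2 - real N powr (1 / 2 + \<eta> / 8) \<le> real R \<longrightarrow> 2 * R \<le> N \<longrightarrow>
       outvote (N - R) (edge_prob b N) (R - 1) (edge_prob a N) \<le> real N powr (- \<eta>)"
      using assms \<eta> by (intro red_flip_prob_upper) auto
    have ev1: "\<forall>\<^sub>F N::nat in sequentially. 1 \<le> real N" by real_asymp
    have ev2: "\<forall>\<^sub>F N::nat in sequentially. 1 \<le> ln (real N)" by real_asymp
    have ev3: "\<forall>\<^sub>F N::nat in sequentially. 1 \<le> (a - b) * ln (real N)" using ab by real_asymp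
    have ev4: "\<forall>\<^sub>F N::nat in sequentially. 1 \<le> \<eta> / 8 * ln (real N)" using \<eta>(1) by real_asymp
    have ev5: "\<forall>\<^sub>F N::nat in sequentially. edge_prob a N \<le> 1 / 2" unfolding edge_prob_def using a by real_asymp
    have ev6: "\<forall>\<^sub>F N::nat in sequentially. 320 * (1 + 2 * a) * ln (real N) * real N \<le> \<delta> * (real N powr (1 / 2 + \<eta> / 16))\<^sup>2"
      using a \<delta>(1) \<eta>(1) by real_asymp
    have ev7: "\<forall>\<^sub>F N::nat in sequentially. (a - b) * ln (real N) * real N powr (1 / 2 + \<eta> / 8) \<le> real N"
      using ab \<eta>(1,2) by real_asymp
    have ev8: "\<forall>\<^sub>F N::nat in sequentially. 24 * (1 + (a - b)) * (ln (real N))\<^sup>2 * real N powr (- \<eta>) \<le> 1"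
      using ab \<eta>(1) by real_asymp
    have ev9: "\<forall>\<^sub>F N::nat in sequentially. 4 * a * ln (real N) \<le> real N" using a by real_asymp
    have ev10: "\<forall>\<^sub>F N::nat in sequentially. real N powr (\<eta> / 8) * (2 * (4 * a * ln (real N) + 2))
        * exp (3 - real N powr (\<eta> / 4) / (64 * (ln (real N))\<^sup>2 * (4 * a * ln (real N) + 2)))
      \<le> \<delta> * real N powr (- (a + \<epsilon>)) * real N powr (- (\<eta> / 8)) / (16 * ln (real N))"
      using a \<epsilon> \<delta>(1) \<eta>(1) by real_asymp
    have ev11: "\<forall>\<^sub>F N::nat in sequentially. real N powr (\<eta> / 8) * (2 * (4 * a * ln (real N) + 2))
        * (4096 * (4 * a * ln (real N) + 2)\<^sup>2 * (9 + 2 * a * ln (real N)) * ln (real N) ^ 3 * real N powr (- \<eta>))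
      \<le> \<delta> * real N powr (- (\<eta> / 8)) / (16 * ln (real N))"
      using a \<delta>(1) \<eta>(1) by real_asymp
    have ev12: "\<forall>\<^sub>F N::nat in sequentially. real N * exp (- (\<delta> / 2) * (real N powr (\<epsilon> / 2) / 2 - 1)) \<le> real N powr (- \<xi>) / 2"
      using \<delta>(1) \<epsilon> \<xi>(1) by real_asymp
    show "\<forall>\<^sub>F N in sequentially.
       measure_pmf.prob
         (history_pmf a b N (y0 N) (nat \<lceil>real N powr (exponent0 a b N (y0 N) + \<epsilon>)\<rceil>))
         {Gs. red N (opinions N (y0 N) Gs) = {}}
       \<ge> 1 - exp (- c * ((advantage N (y0 N))\<^sup>2 * ln (real N) / real N))
           - 4 * real N powr (- \<xi>)"
      using few ev_lim ev_lower ev_upper ev1 ev2 ev3 ev4 ev5 ev6 ev7 ev8 ev9 ev10 ev11 ev12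
    proof eventually_elim
      case (elim N)
      have N_ge_1: "1 \<le> N" using elim(5) by simp
      interpret large_population a b \<delta> \<xi>0 \<eta> \<epsilon> N
        by (unfold_locales; (fact assms \<delta> \<eta>(1,2) \<epsilon> N_ge_1 elim(5-) | (rule elim(1) [rule_format]; assumption)
              | (rule elim(3) [rule_format]; assumption) | (rule elim(4) [rule_format]; assumption)))
      define D where "D = (advantage N (y0 N))\<^sup>2 * ln (real N)"
      have adv0: "0 < advantage N (y0 N)" using adv N1 by simp
      have \<omega>D: "\<omega> * real N \<le> D"
      proof -
        have l0: "0 < ln (real N)" using lnN by linarith
        have pos: "0 < real N / ln (real N)" by (rule divide_pos_pos [OF N0 l0])
        have "\<omega> * 1 \<le> \<omega> * \<omega>" using \<omega> by (intro mult_left_mono) auto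
        also have "\<omega> * \<omega> \<le> (advantage N (y0 N) / sqrt (real N / ln (real N))) * (advantage N (y0 N) / sqrt (real N / ln (real N)))"
          using elim(2) \<omega> by (intro mult_mono) auto
        also have "\<dots> = D / real N"
        proof -
          have "sqrt (real N / ln (real N)) * sqrt (real N / ln (real N)) = real N / ln (real N)"
            by (rule real_sqrt_mult_self [THEN trans]) (rule abs_of_pos [OF pos])
          then show ?thesis
            unfolding times_divide_times_eq by (simp only: D_def power2_eq_square divide_divide_eq_right)
        qed
        finally show ?thesis using N0 by (simp add: pos_le_divide_eq)
      qed
      have scaled: "k * real N \<le> D" if "k \<le> \<omega>" for k
      proof -
        have "k * real N \<le> \<omega> * real N" using that by (rule mult_right_mono) simp
        then show ?thesis using \<omega>D by linarith
      qed
      have "survival a b N (nat \<lceil>real N powr (exponent0 a b N (y0 N) + \<epsilon>)\<rceil>) (y0 N)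
        \<le> exp (- c * (D / real N)) + 4 * real N powr (- \<xi>)"
        unfolding D_def
      proof (rule survival_bound [OF _ adv0 \<xi>(2,3) c])
        show "is_configuration N (y0 N)" using cfg by simp
        show "real N \<le> (advantage N (y0 N))\<^sup>2 * ln (real N)" using scaled [OF \<omega>(1)] by (simp add: D_def)
        show "1280 * (1 + 2 * a) * real N \<le> \<delta> * (a - b) * ((advantage N (y0 N))\<^sup>2 * ln (real N))"
          using scaled [OF \<omega>(2)] \<delta> ab by (simp add: D_def pos_divide_le_eq mult_ac)
        show "real N \<le> 2 * c * ((advantage N (y0 N))\<^sup>2 * ln (real N))"
          using scaled [OF \<omega>(3)] c by (simp add: D_def pos_divide_le_eq mult_ac)
        show "real N * exp (- (\<delta> / 2) * (real N powr (\<epsilon> / 2) / 2 - 1)) \<le> real N powr (- \<xi>) / 2"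
          by (rule elim)
      qed
      moreover have "measure_pmf.prob (history_pmf a b N (y0 N) t) {Gs. red N (opinions N (y0 N) Gs) = {}}
         = 1 - survival a b N t (y0 N)" for t
      proof -
        have "{Gs. red N (opinions N (y0 N) Gs) = {}} = UNIV - {Gs. red N (opinions N (y0 N) Gs) \<noteq> {}}" by auto
        then show ?thesis
          using measure_pmf.prob_compl[of "{Gs. red N (opinions N (y0 N) Gs) \<noteq> {}}"] by (simp add: survival_def)
      qed
      ultimately show ?case by (simp add: D_def)
    qed
  qed
qed

end
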